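(* Let $\psi_1,\psi_2,\widehat\phi_1,\widehat\phi_2:\mathcal{A}\to\mathcal{A}$ be conformal maps. The formulas $$F_0=\Re e\left[\int_\Gamma\left(-\psi_1\widehat\phi_1+\psi_2\widehat\phi_2\right)da\right],\qquad F_1=\Re e\left[\int_\Gamma\left(-\psi_1\widehat\phi_1-\psi_2\widehat\phi_2\right)da\right],$$ $$F_2=\Re e\left[\int_\Gamma\left(\psi_2\widehat\phi_1+\psi_1\widehat\phi_2\right)da\right],\qquad F_3=\Im m\left[\int_\Gamma\left(-\psi_2\widehat\phi_1+\psi_1\widehat\phi_2\right)da\right]$$ define a conformal minimal immersion of a Lorentz surface into $\mathbb{R}^{2,2}$. Conversely, the isometric immersion of a minimal simply-connected Lorentzian surface $(M,g)$ into $\mathbb{R}^{2,2}$ may be described in that way.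
   Context: $\mathbb{R}^{2,2}$ is $\mathbb{R}^4$ with the metric $-dx_0^2+dx_1^2-dx_2^2+dx_3^2$, and the immersion is $F=(F_0,F_1,F_2,F_3)$. The algebra of Lorentz numbers is $\mathcal{A}=\{u+\sigma v: u,v\in\mathbb{R}\}$, $\sigma\notin\mathbb{R}$, $\sigma^2=1$. For $a=u+\sigma v$: $\widehat a=u-\sigma v$, $\Re e(a)=u$, $\Im m(a)=v$, $da=du+\sigma dv$; for an $\mathcal{A}$-valued function $f$, $\widehat f$ is the pointwise conjugate. $\Gamma$ is an arbitrary path between a fixed point and a variable point in $\mathcal{A}$. A smooth map $\psi$ from (an open subset of) $\mathcal{A}$ to $\mathcal{A}$ is conformal if its differential commutes with multiplication by $\sigma$, i.e. $\partial_v\psi=\sigma\,\partial_u\psi$, equivalently $\frac12(\partial_u\psi-\sigma\partial_v\psi)=0$. A Lorentzian surface is a surface with a metric of signature $(1,1)$; a Lorentz surface is a surface with charts into $\mathcal{A}$ with conformal transition maps (equivalently, with a conformal class of Lorentzian metrics). Minimal means that the mean curvature vector vanishes identically.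
   Formalization: The immersion is claimed only where ψ1φ2−ψ2φ1 has nonzero norm (exactly where the induced form is Lorentzian; zero data give constant F); in the converse the conformal maps live on M with a global 𝒜-valued local coordinate, and F is given up to a translation. *)

theory Defs
  imports "HOL-Analysis.Analysis"
begin

section \<open>Lorentz numbers\<close>

datatype lorentz = Lor (lRe: real) (lIm: real)

lemma lorentz_eq_iff: "x = y \<longleftrightarrow> lRe x = lRe y \<and> lIm x = lIm y"
  by (cases x; cases y) auto

lemma lorentz_eqI: "lRe x = lRe y \<Longrightarrow> lIm x = lIm y \<Longrightarrow> x = y"
  by (simp add: lorentz_eq_iff)

instantiation lorentz :: comm_ring_1
begin

definition zero_lorentz_def: "0 = Lor 0 0"
definition one_lorentz_def: "1 = Lor 1 0"
definition plus_lorentz_def: "x + y = Lor (lRe x + lRe y) (lIm x + lIm y)"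
definition uminus_lorentz_def: "- x = Lor (- lRe x) (- lIm x)"
definition minus_lorentz_def: "x - y = Lor (lRe x - lRe y) (lIm x - lIm y)"
definition times_lorentz_def:
  "x * y = Lor (lRe x * lRe y + lIm x * lIm y) (lRe x * lIm y + lIm x * lRe y)"

instance
  by standard
    (auto simp: lorentz_eq_iff zero_lorentz_def one_lorentz_def plus_lorentz_def
      uminus_lorentz_def minus_lorentz_def times_lorentz_def algebra_simps)

end

lemma lorentz_sel_simps [simp]:
  "lRe 0 = 0" "lIm 0 = 0" "lRe 1 = 1" "lIm 1 = 0"
  "lRe (x + y) = lRe x + lRe y" "lIm (x + y) = lIm x + lIm y"
  "lRe (- x) = - lRe x" "lIm (- x) = - lIm x"
  "lRe (x - y) = lRe x - lRe y" "lIm (x - y) = lIm x - lIm y"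
  "lRe (x * y) = lRe x * lRe y + lIm x * lIm y"
  "lIm (x * y) = lRe x * lIm y + lIm x * lRe y"
  by (simp_all add: zero_lorentz_def one_lorentz_def plus_lorentz_def
      uminus_lorentz_def minus_lorentz_def times_lorentz_def)

instantiation lorentz :: real_algebra_1
begin

definition scaleR_lorentz_def: "scaleR r x = Lor (r * lRe x) (r * lIm x)"

instance
  by standard (auto simp: lorentz_eq_iff scaleR_lorentz_def algebra_simps)

end

lemma lorentz_sel_scaleR [simp]:
  "lRe (scaleR r x) = r * lRe x" "lIm (scaleR r x) = r * lIm x"
  by (simp_all add: scaleR_lorentz_def)

text \<open>The Euclidean structure below only serves to provide the topology and the
  differential calculus of the plane; the Lorentzian structure is \<open>lform\<close>.\<close>

instantiation lorentz :: real_inner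
begin

definition inner_lorentz_def: "inner x y = lRe x * lRe y + lIm x * lIm y"
definition norm_lorentz_def: "norm x = sqrt ((lRe x)\<^sup>2 + (lIm x)\<^sup>2)"
definition sgn_lorentz_def: "sgn x = x /\<^sub>R norm (x :: lorentz)"
definition dist_lorentz_def: "dist x y = norm (x - y :: lorentz)"
definition uniformity_lorentz_def [code del]:
  "(uniformity :: (lorentz \<times> lorentz) filter) =
     (INF e\<in>{0 <..}. principal {(x, y). dist x y < e})"
definition open_lorentz_def [code del]:
  "open (U :: lorentz set) \<longleftrightarrow>
     (\<forall>x\<in>U. eventually (\<lambda>(x', y). x' = x \<longrightarrow> y \<in> U) uniformity)"

instance
proof
  fix r :: real and x y z :: lorentz and U :: "lorentz set"
  show "inner x y = inner y x"
    by (simp add: inner_lorentz_def)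
  show "inner (x + y) z = inner x z + inner y z"
    by (simp add: inner_lorentz_def algebra_simps)
  show "inner (scaleR r x) y = r * inner x y"
    by (simp add: inner_lorentz_def algebra_simps)
  show "0 \<le> inner x x"
    by (simp add: inner_lorentz_def)
  show "(inner x x = 0) = (x = 0)"
    by (simp add: inner_lorentz_def lorentz_eq_iff[of x 0] sum_squares_eq_zero_iff)
  show "norm x = sqrt (inner x x)"
    by (simp add: inner_lorentz_def norm_lorentz_def power2_eq_square)
qed (rule sgn_lorentz_def dist_lorentz_def open_lorentz_def uniformity_lorentz_def)+

end

definition lsigma :: lorentz where
  "lsigma = Lor 0 1"

lemma lsigma_simps [simp]: "lRe lsigma = 0" "lIm lsigma = 1" "lsigma * lsigma = 1"
  by (simp_all add: lsigma_def times_lorentz_def one_lorentz_def)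

instantiation lorentz :: euclidean_space
begin

definition Basis_lorentz_def: "Basis = {1, lsigma}"

instance
proof
  show "(Basis :: lorentz set) \<noteq> {}" and "finite (Basis :: lorentz set)"
    by (simp_all add: Basis_lorentz_def)
next
  fix u v :: lorentz
  have ne: "(1 :: lorentz) \<noteq> lsigma"
    by (simp add: lorentz_eq_iff)
  assume "u \<in> Basis" "v \<in> Basis"
  then have "u = 1 \<or> u = lsigma" "v = 1 \<or> v = lsigma"
    by (simp_all add: Basis_lorentz_def)
  then show "inner u v = (if u = v then 1 else 0)"
    using ne by (elim disjE) (simp_all add: inner_lorentz_def)
next
  fix x :: lorentz
  show "(\<forall>u\<in>Basis. inner x u = 0) \<longleftrightarrow> x = 0"
    by (simp add: Basis_lorentz_def inner_lorentz_def lorentz_eq_iff[of x 0])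
qed

end

definition lconj :: "lorentz \<Rightarrow> lorentz" where
  "lconj a = Lor (lRe a) (- lIm a)"

text \<open>The polarisation of \<open>a * lconj a\<close>, that is, the metric $du^2 - dv^2$.\<close>

definition lform :: "lorentz \<Rightarrow> lorentz \<Rightarrow> real" where
  "lform x y = lRe (x * lconj y)"


section \<open>Smooth and conformal maps on open subsets of the Lorentz numbers\<close>

fun Ck_on :: "nat \<Rightarrow> 'a::euclidean_space set \<Rightarrow> ('a \<Rightarrow> 'b::real_normed_vector) \<Rightarrow> bool" where
  "Ck_on 0 S f \<longleftrightarrow> continuous_on S f"
| "Ck_on (Suc k) S f \<longleftrightarrow>
     (\<forall>x\<in>S. f differentiable at x) \<and>
     (\<forall>v. Ck_on k S (\<lambda>x. frechet_derivative f (at x) v))"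

definition smooth_on :: "'a::euclidean_space set \<Rightarrow> ('a \<Rightarrow> 'b::real_normed_vector) \<Rightarrow> bool" where
  "smooth_on S f \<longleftrightarrow> open S \<and> (\<forall>k. Ck_on k S f)"

definition conformal_on :: "lorentz set \<Rightarrow> (lorentz \<Rightarrow> lorentz) \<Rightarrow> bool" where
  "conformal_on S \<psi> \<longleftrightarrow> smooth_on S \<psi> \<and>
     (\<forall>x\<in>S. \<forall>h. frechet_derivative \<psi> (at x) (lsigma * h)
                 = lsigma * frechet_derivative \<psi> (at x) h)"


section \<open>Surfaces\<close>

text \<open>A chart is a pair of an open subset of the surface and a map on it. The model
  space is \<^typ>\<open>lorentz\<close> in all cases; for a smooth surface it is used only as a
  two-dimensional real vector space.\<close>

type_synonym 'm chart = "'m set \<times> ('m \<Rightarrow> lorentz)"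

definition atlas ::
  "(lorentz set \<Rightarrow> (lorentz \<Rightarrow> lorentz) \<Rightarrow> bool) \<Rightarrow> 'm::topological_space set \<Rightarrow> 'm chart set \<Rightarrow> bool"
where
  "atlas P M \<A> \<longleftrightarrow>
     M = (\<Union>(U, c)\<in>\<A>. U) \<and>
     (\<forall>(U, c)\<in>\<A>. openin (top_of_set M) U \<and> open (c ` U) \<and> homeomorphism U (c ` U) c (inv_into U c)) \<and>
     (\<forall>(U, c)\<in>\<A>. \<forall>(V, d)\<in>\<A>. P (c ` (U \<inter> V)) (d \<circ> inv_into U c))"

definition smooth_surface :: "'m::{t2_space, second_countable_topology} set \<Rightarrow> 'm chart set \<Rightarrow> bool" where
  "smooth_surface M \<A> \<longleftrightarrow> atlas smooth_on M \<A>"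

definition lorentz_surface :: "'m::{t2_space, second_countable_topology} set \<Rightarrow> 'm chart set \<Rightarrow> bool" where
  "lorentz_surface M \<A> \<longleftrightarrow> atlas conformal_on M \<A>"

definition conformal_map :: "'m chart set \<Rightarrow> ('m \<Rightarrow> lorentz) \<Rightarrow> bool" where
  "conformal_map \<A> \<psi> \<longleftrightarrow> (\<forall>(U, c)\<in>\<A>. conformal_on (c ` U) (\<psi> \<circ> inv_into U c))"

definition signature_1_1 :: "(lorentz \<Rightarrow> lorentz \<Rightarrow> real) \<Rightarrow> bool" where
  "signature_1_1 B \<longleftrightarrow> (\<exists>e1 e2. B e1 e1 = 1 \<and> B e2 e2 = - 1 \<and> B e1 e2 = 0)"

text \<open>A metric is given by its coordinate expressions: \<open>g (U, c) x\<close> is the bilinear form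
  at the point with coordinates \<open>x \<in> c ` U\<close>, expressed in the chart \<open>(U, c)\<close>.\<close>

type_synonym 'm metric = "'m chart \<Rightarrow> lorentz \<Rightarrow> lorentz \<Rightarrow> lorentz \<Rightarrow> real"

definition lorentzian_metric :: "'m chart set \<Rightarrow> 'm metric \<Rightarrow> bool" where
  "lorentzian_metric \<A> g \<longleftrightarrow>
     (\<forall>(U, c)\<in>\<A>.
        (\<forall>x\<in>c ` U. bilinear (g (U, c) x) \<and> (\<forall>X Y. g (U, c) x X Y = g (U, c) x Y X) \<and>
                    signature_1_1 (g (U, c) x)) \<and>
        (\<forall>X Y. smooth_on (c ` U) (\<lambda>x. g (U, c) x X Y))) \<and>
     (\<forall>(U, c)\<in>\<A>. \<forall>(V, d)\<in>\<A>. \<forall>x\<in>c ` (U \<inter> V). \<forall>X Y.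
        g (U, c) x X Y =
        g (V, d) ((d \<circ> inv_into U c) x) (frechet_derivative (d \<circ> inv_into U c) (at x) X)
                                         (frechet_derivative (d \<circ> inv_into U c) (at x) Y))"

definition lorentzian_surface ::
  "'m::{t2_space, second_countable_topology} set \<Rightarrow> 'm chart set \<Rightarrow> 'm metric \<Rightarrow> bool"
where
  "lorentzian_surface M \<A> g \<longleftrightarrow> smooth_surface M \<A> \<and> lorentzian_metric \<A> g"


section \<open>Immersions into the pseudo-Euclidean space of signature (2,2)\<close>

text \<open>The indices \<open>0, 1, 2, 3\<close> denote the four distinct elements of the index type
  \<^typ>\<open>4\<close>, in which \<open>4 = 0\<close>.\<close>

definition minner :: "real ^ 4 \<Rightarrow> real ^ 4 \<Rightarrow> real" where
  "minner x y = - (x $ 0) * (y $ 0) + (x $ 1) * (y $ 1) - (x $ 2) * (y $ 2) + (x $ 3) * (y $ 3)"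

definition pullback_metric :: "(lorentz \<Rightarrow> real ^ 4) \<Rightarrow> lorentz \<Rightarrow> lorentz \<Rightarrow> lorentz \<Rightarrow> real" where
  "pullback_metric f x X Y =
     minner (frechet_derivative f (at x) X) (frechet_derivative f (at x) Y)"

definition immersion :: "'m chart set \<Rightarrow> ('m \<Rightarrow> real ^ 4) \<Rightarrow> bool" where
  "immersion \<A> F \<longleftrightarrow>
     (\<forall>(U, c)\<in>\<A>. smooth_on (c ` U) (F \<circ> inv_into U c) \<and>
        (\<forall>x\<in>c ` U. inj (frechet_derivative (F \<circ> inv_into U c) (at x))))"

definition isometric_immersion :: "'m chart set \<Rightarrow> 'm metric \<Rightarrow> ('m \<Rightarrow> real ^ 4) \<Rightarrow> bool" where
  "isometric_immersion \<A> g F \<longleftrightarrow> immersion \<A> F \<and>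
     (\<forall>(U, c)\<in>\<A>. \<forall>x\<in>c ` U. pullback_metric (F \<circ> inv_into U c) x = g (U, c) x)"

text \<open>The conformal factor may have either sign: multiplication by \<open>\<sigma>\<close> is a conformal
  map and takes $du^2 - dv^2$ to its negative, so conformal transition maps determine the
  metric only up to a nowhere vanishing factor.\<close>

definition conformal_immersion :: "'m chart set \<Rightarrow> ('m \<Rightarrow> real ^ 4) \<Rightarrow> bool" where
  "conformal_immersion \<A> F \<longleftrightarrow> immersion \<A> F \<and>
     (\<forall>(U, c)\<in>\<A>. \<forall>x\<in>c ` U. \<exists>\<mu>. \<mu> \<noteq> 0 \<and>
        (\<forall>X Y. pullback_metric (F \<circ> inv_into U c) x X Y = \<mu> * lform X Y))"

text \<open>The definite description is meaningful where the induced metric is nondegenerate.\<close>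

definition normal_part :: "(lorentz \<Rightarrow> real ^ 4) \<Rightarrow> lorentz \<Rightarrow> real ^ 4 \<Rightarrow> real ^ 4" where
  "normal_part f x v =
     (THE n. v - n \<in> range (frechet_derivative f (at x)) \<and>
             (\<forall>X. minner n (frechet_derivative f (at x) X) = 0))"

definition second_fundamental_form ::
  "(lorentz \<Rightarrow> real ^ 4) \<Rightarrow> lorentz \<Rightarrow> lorentz \<Rightarrow> lorentz \<Rightarrow> real ^ 4"
where
  "second_fundamental_form f x X Y =
     normal_part f x (frechet_derivative (\<lambda>y. frechet_derivative f (at y) Y) (at x) X)"

text \<open>Half the trace of the second fundamental form with respect to the induced metric,
  computed in the coordinate basis \<open>1, \<sigma>\<close> with the inverse of the matrix of the metric.\<close>

definition mean_curvature :: "(lorentz \<Rightarrow> real ^ 4) \<Rightarrow> lorentz \<Rightarrow> real ^ 4" where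
  "mean_curvature f x =
     (let g11 = pullback_metric f x 1 1;
          g12 = pullback_metric f x 1 lsigma;
          g22 = pullback_metric f x lsigma lsigma
      in (1 / (2 * (g11 * g22 - g12\<^sup>2))) *\<^sub>R
           (g22 *\<^sub>R second_fundamental_form f x 1 1
            - (2 * g12) *\<^sub>R second_fundamental_form f x 1 lsigma
            + g11 *\<^sub>R second_fundamental_form f x lsigma lsigma))"

definition minimal :: "'m chart set \<Rightarrow> ('m \<Rightarrow> real ^ 4) \<Rightarrow> bool" where
  "minimal \<A> F \<longleftrightarrow> (\<forall>(U, c)\<in>\<A>. \<forall>x\<in>c ` U. mean_curvature (F \<circ> inv_into U c) x = 0)"


section \<open>The representation formulas\<close>

text \<open>\<open>I\<close> is the integral of \<open>f da\<close> along \<open>\<Gamma>\<close>, where \<open>a\<close> is a coordinate with values in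
  the Lorentz numbers.\<close>

definition has_line_integral ::
  "('m \<Rightarrow> lorentz) \<Rightarrow> ('m \<Rightarrow> lorentz) \<Rightarrow> (real \<Rightarrow> 'm) \<Rightarrow> lorentz \<Rightarrow> bool"
where
  "has_line_integral f a \<Gamma> I \<longleftrightarrow>
     ((\<lambda>t. f (\<Gamma> t) * vector_derivative (a \<circ> \<Gamma>) (at t within {0..1})) has_integral I) {0..1}"

text \<open>The paths \<open>\<Gamma>\<close> in \<open>M\<close> start at \<open>p0\<close> and are piecewise \<open>C\<^sup>1\<close> in the coordinate \<open>a\<close>, which is
  understood to be a local diffeomorphism. Independence of the path is part of the
  definition, since the values of \<open>F\<close> depend only on the end point.\<close>

definition weierstrass_formulas ::
  "'m::topological_space set \<Rightarrow> ('m \<Rightarrow> lorentz) \<Rightarrow> 'm \<Rightarrow>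
   ('m \<Rightarrow> lorentz) \<Rightarrow> ('m \<Rightarrow> lorentz) \<Rightarrow> ('m \<Rightarrow> lorentz) \<Rightarrow> ('m \<Rightarrow> lorentz) \<Rightarrow>
   ('m \<Rightarrow> real ^ 4) \<Rightarrow> bool"
where
  "weierstrass_formulas M a p0 \<psi>1 \<psi>2 \<phi>1 \<phi>2 F \<longleftrightarrow>
     (\<forall>\<Gamma>. path \<Gamma> \<and> path_image \<Gamma> \<subseteq> M \<and> valid_path (a \<circ> \<Gamma>) \<and> pathstart \<Gamma> = p0 \<longrightarrow>
        (\<exists>I0 I1 I2 I3.
           has_line_integral (\<lambda>p. - \<psi>1 p * lconj (\<phi>1 p) + \<psi>2 p * lconj (\<phi>2 p)) a \<Gamma> I0 \<and>
           has_line_integral (\<lambda>p. - \<psi>1 p * lconj (\<phi>1 p) - \<psi>2 p * lconj (\<phi>2 p)) a \<Gamma> I1 \<and>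
           has_line_integral (\<lambda>p. \<psi>2 p * lconj (\<phi>1 p) + \<psi>1 p * lconj (\<phi>2 p)) a \<Gamma> I2 \<and>
           has_line_integral (\<lambda>p. - \<psi>2 p * lconj (\<phi>1 p) + \<psi>1 p * lconj (\<phi>2 p)) a \<Gamma> I3 \<and>
           F (pathfinish \<Gamma>) $ 0 = lRe I0 \<and>
           F (pathfinish \<Gamma>) $ 1 = lRe I1 \<and>
           F (pathfinish \<Gamma>) $ 2 = lRe I2 \<and>
           F (pathfinish \<Gamma>) $ 3 = lIm I3))"

end

theory Submission
  imports Defs
begin

text \<open>
  Both directions become transparent in null coordinates.  The map \<open>u + \<sigma>v \<mapsto> (u + v, u - v)\<close> identifies
  the Lorentz numbers with the ring of pairs of real numbers.  Conjugation exchanges the two components,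
  and a conformal map is a pair of real functions, one of \<open>s = u + v\<close> and one of \<open>t = u - v\<close>.  The
  formulas then say \<open>dF = V(e1, f1) ds + V(e2, f2) dt\<close>, where \<open>e1, f1\<close> are functions of \<open>s\<close> and
  \<open>e2, f2\<close> functions of \<open>t\<close> with values in the Euclidean plane, and where \<open>V\<close> is the bilinear
  parametrization of the null vectors by pairs of plane vectors: null vectors of signature (2,2) are
  two by two matrices of rank at most one.

  A map of this form is conformal because \<open>V\<close> takes null values, so that the induced metric is a
  multiple of \<open>ds dt\<close>; the factor is, up to sign, the product of
  \<open>\<psi>1 \<phi>2 - \<psi>2 \<phi>1\<close> with its conjugate (\<open>weier_vec_minner\<close>).  It is minimal because its mixed second derivative in
  \<open>s\<close> and \<open>t\<close> vanishes (\<open>weierstrass_surface\<close>).  The integrals do not depend on the path because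
  \<open>G da\<close> is a closed form for conformal \<open>G\<close> (\<open>conformal_primitive\<close>, from \<open>poincare_lemma\<close>).

  For the converse let \<open>J\<close> be the endomorphism of the tangent planes that is \<open>1\<close> on one null
  line and \<open>-1\<close> on the other.  Minimality says that \<open>dF \<circ> J\<close> is closed, so \<open>dF\<close> is the sum of two
  closed forms, each with values in a null line.  Write such a form as \<open>\<eta> v\<close> with a field \<open>v\<close> of
  constant Euclidean length.  Since \<open>v\<close> is orthogonal to its derivatives, \<open>\<eta>\<close> is closed too; hence
  \<open>\<eta> = ds\<close>, and \<open>v\<close> is a function of \<open>s\<close> (\<open>null_wave_of_closed_form\<close>).  So \<open>s\<close> is, up to a
  constant factor, the Euclidean arc length of a null curve, and \<open>v = V(e, f)\<close> with unit vectors
  \<open>e, f\<close> that are unique up to a common sign.  This solves the problem near each point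
  (\<open>minimal_null_frame_exists\<close>).

  Passing to the whole surface depends on the choice of the arc length as coordinate.  Arbitrary null
  coordinates on a simply connected Lorentz surface cannot always be patched to a single map that is
  regular everywhere.  With the arc length, however, two solutions near a point differ only by signs,
  additive constants and an exchange of the two null lines (\<open>null_frame_unique\<close>), and these
  symmetries act freely on the values of the solutions (\<open>frame_sym_free\<close>).  The germs of the
  solutions therefore form a covering space of the surface, which has a section over a simply connected
  surface (\<open>monodromy\<close>).  The section consists of a global coordinate with values in the Lorentz
  numbers and of the functions \<open>\<psi>1, \<psi>2, \<phi>1, \<phi>2\<close>.
\<close>

section \<open>Calculus of smooth maps\<close>

abbreviation fderiv :: "('a::real_normed_vector \<Rightarrow> 'b::real_normed_vector) \<Rightarrow> 'a \<Rightarrow> 'a \<Rightarrow> 'b"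
  where "fderiv f x \<equiv> frechet_derivative f (at x)"

lemma fderiv_eqI: "(f has_derivative f') (at x) \<Longrightarrow> fderiv f x = f'"
  by (rule frechet_derivative_at[symmetric])

lemma fderiv_cong_open:
  assumes "open S" "x \<in> S" "\<And>y. y \<in> S \<Longrightarrow> f y = g y"
  shows "fderiv f x = fderiv g x"
proof -
  have "(f has_derivative D) (at x) \<longleftrightarrow> (g has_derivative D) (at x)" for D
  proof
    show "(g has_derivative D) (at x)" if "(f has_derivative D) (at x)"
      by (rule has_derivative_transform_within_open[OF that assms(1,2)]) (rule assms(3))
    show "(f has_derivative D) (at x)" if "(g has_derivative D) (at x)"
      by (rule has_derivative_transform_within_open[OF that assms(1,2)]) (simp add: assms(3))
  qed
  then show ?thesis by (simp add: frechet_derivative_def)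
qed

lemma Ck_on_cong:
  assumes "open S" "\<And>x. x \<in> S \<Longrightarrow> f x = g x" "Ck_on k S f"
  shows "Ck_on k S g"
  using assms(2,3)
proof (induction k arbitrary: f g)
  case 0
  then show ?case by (simp cong: continuous_on_cong)
next
  case (Suc k)
  have "g differentiable at x" if "x \<in> S" for x
  proof -
    from Suc.prems(2) that obtain D where "(f has_derivative D) (at x)"
      by (auto simp: differentiable_def)
    then have "(g has_derivative D) (at x)"
      by (rule has_derivative_transform_within_open[OF _ assms(1) that Suc.prems(1)])
    then show ?thesis by (auto simp: differentiable_def)
  qed
  moreover have "Ck_on k S (\<lambda>x. fderiv g x v)" for v
  proof (rule Suc.IH[of "\<lambda>x. fderiv f x v"])
    show "fderiv f x v = fderiv g x v" if "x \<in> S" for x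
      using fderiv_cong_open[OF assms(1) that Suc.prems(1)] by simp
    show "Ck_on k S (\<lambda>x. fderiv f x v)" using Suc.prems by simp
  qed
  ultimately show ?case by simp
qed

lemma Ck_on_SucI:
  assumes "open S" "\<And>x. x \<in> S \<Longrightarrow> (f has_derivative f' x) (at x)"
    and "\<And>v. Ck_on k S (\<lambda>x. f' x v)"
  shows "Ck_on (Suc k) S f"
proof -
  have "Ck_on k S (\<lambda>x. fderiv f x v)" for v
    by (rule Ck_on_cong[OF assms(1) _ assms(3)]) (simp add: fderiv_eqI[OF assms(2)])
  then show ?thesis using assms(2) by (auto simp: differentiable_def)
qed

lemma Ck_on_Suc_has_derivative:
  "Ck_on (Suc k) S f \<Longrightarrow> x \<in> S \<Longrightarrow> (f has_derivative fderiv f x) (at x)"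
  by (simp add: frechet_derivative_works)

lemma Ck_on_continuous_on: "Ck_on k S f \<Longrightarrow> continuous_on S f"
  by (cases k) (auto intro!: continuous_at_imp_continuous_on differentiable_imp_continuous_within)

lemma Ck_on_pred: "Ck_on (Suc k) S f \<Longrightarrow> Ck_on k S f"
proof (induction k arbitrary: f)
  case 0
  then show ?case using Ck_on_continuous_on[of "Suc 0" S f] by simp
next
  case (Suc k)
  then show ?case by simp
qed

lemma Ck_on_subset: "Ck_on k S f \<Longrightarrow> T \<subseteq> S \<Longrightarrow> Ck_on k T f"
  by (induction k arbitrary: f) (auto intro: continuous_on_subset)

lemma Ck_on_const: "open S \<Longrightarrow> Ck_on k S (\<lambda>x. c)"
proof (induction k arbitrary: c)
  case (Suc k)
  show ?case by (rule Ck_on_SucI[where f'="\<lambda>x v. 0"]) (use Suc in auto)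
qed auto

lemma Ck_on_linear:
  assumes "open S" "bounded_linear L"
  shows "Ck_on k S L"
proof (cases k)
  case 0
  then show ?thesis by (simp add: assms linear_continuous_on)
next
  case (Suc j)
  show ?thesis unfolding Suc
    by (rule Ck_on_SucI[where f'="\<lambda>x v. L v"])
      (use assms in \<open>auto intro: Ck_on_const bounded_linear_imp_has_derivative\<close>)
qed

lemma Ck_on_linear_compose:
  assumes "open S" "bounded_linear L" "Ck_on k S f"
  shows "Ck_on k S (\<lambda>x. L (f x))"
  using assms(3)
proof (induction k arbitrary: f)
  case 0
  then show ?case using assms by (simp add: bounded_linear.continuous_on)
next
  case (Suc k)
  show ?case
  proof (rule Ck_on_SucI[where f'="\<lambda>x v. L (fderiv f x v)"])
    show "((\<lambda>x. L (f x)) has_derivative (\<lambda>v. L (fderiv f x v))) (at x)" if "x \<in> S" for x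
      by (rule bounded_linear.has_derivative[OF assms(2)] Ck_on_Suc_has_derivative Suc.prems that)+
  qed (use Suc assms in auto)
qed

lemma Ck_on_add:
  assumes "open S" "Ck_on k S f" "Ck_on k S g"
  shows "Ck_on k S (\<lambda>x. f x + g x)"
  using assms(2,3)
proof (induction k arbitrary: f g)
  case 0
  then show ?case by (simp add: continuous_on_add)
next
  case (Suc k)
  show ?case
  proof (rule Ck_on_SucI[where f'="\<lambda>x v. fderiv f x v + fderiv g x v"])
    show "((\<lambda>x. f x + g x) has_derivative (\<lambda>v. fderiv f x v + fderiv g x v)) (at x)" if "x \<in> S" for x
      by (rule has_derivative_add Ck_on_Suc_has_derivative Suc.prems that)+
  qed (use Suc assms in auto)
qed

text \<open>In this lemma and the similar ones below the induction works because the derivative is built, by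
  the operation in question and by sums and products, from the functions and their derivatives.\<close>

lemma Ck_on_bilinear:
  assumes "open S" "bounded_bilinear B" "Ck_on k S f" "Ck_on k S g"
  shows "Ck_on k S (\<lambda>x. B (f x) (g x))"
  using assms(3,4)
proof (induction k arbitrary: f g)
  case 0
  then show ?case using assms by (simp add: bounded_bilinear.continuous_on)
next
  case (Suc k)
  show ?case
  proof (rule Ck_on_SucI[where f'="\<lambda>x v. B (f x) (fderiv g x v) + B (fderiv f x v) (g x)"])
    show "((\<lambda>x. B (f x) (g x)) has_derivative (\<lambda>v. B (f x) (fderiv g x v) + B (fderiv f x v) (g x))) (at x)"
      if "x \<in> S" for x
      by (rule bounded_bilinear.FDERIV[OF assms(2)] Ck_on_Suc_has_derivative Suc.prems that)+
    show "Ck_on k S (\<lambda>x. B (f x) (fderiv g x v) + B (fderiv f x v) (g x))" for v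
    proof (rule Ck_on_add)
      show "Ck_on k S (\<lambda>x. B (f x) (fderiv g x v))"
        by (rule Suc.IH) (use Suc.prems Ck_on_pred in auto)
      show "Ck_on k S (\<lambda>x. B (fderiv f x v) (g x))"
        by (rule Suc.IH) (use Suc.prems Ck_on_pred in auto)
    qed (fact assms)
  qed (fact assms)
qed

lemma Ck_on_sum:
  assumes "open S" "\<And>i. i \<in> I \<Longrightarrow> Ck_on k S (f i)"
  shows "Ck_on k S (\<lambda>x. \<Sum>i\<in>I. f i x)"
  using assms(2)
  by (induction I rule: infinite_finite_induct) (auto intro: Ck_on_const Ck_on_add assms)

lemma Ck_on_inverse:
  fixes f :: "'a::euclidean_space \<Rightarrow> real"
  assumes "open S" "Ck_on k S f" "\<And>x. x \<in> S \<Longrightarrow> f x \<noteq> 0"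
  shows "Ck_on k S (\<lambda>x. inverse (f x))"
  using assms(2,3)
proof (induction k)
  case 0
  then show ?case by (simp add: continuous_on_inverse)
next
  case (Suc k)
  have IH: "Ck_on k S (\<lambda>x. inverse (f x))"
    using Suc Ck_on_pred by blast
  show ?case
  proof (rule Ck_on_SucI[where f'="\<lambda>x v. - (inverse (f x) * fderiv f x v * inverse (f x))"])
    show "((\<lambda>x. inverse (f x)) has_derivative (\<lambda>v. - (inverse (f x) * fderiv f x v * inverse (f x)))) (at x)"
      if "x \<in> S" for x
      by (rule Deriv.has_derivative_inverse[OF Suc.prems(2)[OF that]
            Ck_on_Suc_has_derivative[OF Suc.prems(1) that]])
    show "Ck_on k S (\<lambda>x. - (inverse (f x) * fderiv f x v * inverse (f x)))" for v
      using Suc.prems(1)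
      by (intro Ck_on_linear_compose[OF assms(1) bounded_linear_minus[OF bounded_linear_ident]]
            Ck_on_bilinear[OF assms(1) bounded_bilinear_mult] IH) simp
  qed (fact assms)
qed

lemma Ck_on_sqrt:
  assumes "open S" "Ck_on k S f" "\<And>x. x \<in> S \<Longrightarrow> f x > 0"
  shows "Ck_on k S (\<lambda>x. sqrt (f x))"
  using assms(2,3)
proof (induction k)
  case 0
  then show ?case by (simp add: continuous_on_real_sqrt)
next
  case (Suc k)
  have IH: "Ck_on k S (\<lambda>x. sqrt (f x))"
    using Suc Ck_on_pred by blast
  have *: "Ck_on k S (\<lambda>x. inverse (sqrt (f x)))"
    using Ck_on_inverse[OF assms(1) IH] Suc.prems(2) by force
  show ?case
  proof (rule Ck_on_SucI[where f'="\<lambda>x v. (inverse (sqrt (f x)) * fderiv f x v) * (1/2)"])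
    show "((\<lambda>x. sqrt (f x)) has_derivative (\<lambda>v. (inverse (sqrt (f x)) * fderiv f x v) * (1/2))) (at x)"
      if "x \<in> S" for x
      by (rule has_derivative_eq_rhs[OF has_derivative_real_sqrt[OF Suc.prems(2)[OF that]
            Ck_on_Suc_has_derivative[OF Suc.prems(1) that]]]) (simp add: fun_eq_iff field_simps)
    show "Ck_on k S (\<lambda>x. (inverse (sqrt (f x)) * fderiv f x v) * (1/2))" for v
      using Suc.prems(1) by (intro Ck_on_bilinear[OF assms(1) bounded_bilinear_mult] * Ck_on_const assms(1)) simp
  qed (fact assms)
qed

text \<open>The derivative of the composition is expanded in the basis, so that the induction hypothesis
  applies to the maps \<open>x \<mapsto> fderiv f (g x) b\<close> with a fixed vector \<open>b\<close>.\<close>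

lemma Ck_on_compose:
  fixes f :: "'b::euclidean_space \<Rightarrow> 'c::real_normed_vector" and g :: "'a::euclidean_space \<Rightarrow> 'b"
  assumes "open S" "Ck_on k T f" "Ck_on k S g" "g ` S \<subseteq> T"
  shows "Ck_on k S (\<lambda>x. f (g x))"
  using assms(2,3)
proof (induction k arbitrary: f)
  case 0
  then show ?case using assms(4) by (auto intro: continuous_on_compose2)
next
  case (Suc k)
  have lin: "linear (fderiv f y)" if "y \<in> T" for y
    using Ck_on_Suc_has_derivative[OF Suc.prems(1) that] has_derivative_linear by blast
  show ?case
  proof (rule Ck_on_SucI[where f'="\<lambda>x v. \<Sum>b\<in>Basis. (fderiv g x v \<bullet> b) *\<^sub>R fderiv f (g x) b"])
    fix x assume x: "x \<in> S"
    then have gx: "g x \<in> T" using assms(4) by auto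
    have 1: "((\<lambda>x. f (g x)) has_derivative (\<lambda>v. fderiv f (g x) (fderiv g x v))) (at x)"
      using has_derivative_compose[OF Ck_on_Suc_has_derivative[OF Suc.prems(2) x]
          Ck_on_Suc_has_derivative[OF Suc.prems(1) gx]] .
    have 2: "fderiv f (g x) w = (\<Sum>b\<in>Basis. (w \<bullet> b) *\<^sub>R fderiv f (g x) b)" for w
      using linear_sum[OF lin[OF gx], of "\<lambda>b. (w \<bullet> b) *\<^sub>R b" Basis]
      by (simp add: euclidean_representation linear_cmul[OF lin[OF gx]])
    show "((\<lambda>x. f (g x)) has_derivative (\<lambda>v. \<Sum>b\<in>Basis. (fderiv g x v \<bullet> b) *\<^sub>R fderiv f (g x) b)) (at x)"
      by (rule has_derivative_eq_rhs[OF 1 ext[OF 2]])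
  next
    fix v
    show "Ck_on k S (\<lambda>x. \<Sum>b\<in>Basis. (fderiv g x v \<bullet> b) *\<^sub>R fderiv f (g x) b)"
    proof (rule Ck_on_sum[OF assms(1)], rule Ck_on_bilinear[OF assms(1) bounded_bilinear_scaleR])
      fix b :: 'b
      show "Ck_on k S (\<lambda>x. fderiv g x v \<bullet> b)"
        by (rule Ck_on_linear_compose[OF assms(1) bounded_linear_inner_left]) (use Suc.prems in simp)
      show "Ck_on k S (\<lambda>x. fderiv f (g x) b)"
        by (rule Suc.IH) (use Suc.prems Ck_on_pred in auto)
    qed
  qed (fact assms)
qed

lemma smooth_on_open: "smooth_on S f \<Longrightarrow> open S"
  by (simp add: smooth_on_def)

lemma smooth_on_cong:
  "smooth_on S f \<Longrightarrow> (\<And>x. x \<in> S \<Longrightarrow> f x = g x) \<Longrightarrow> smooth_on S g"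
  unfolding smooth_on_def using Ck_on_cong by blast

lemma smooth_on_subset: "smooth_on S f \<Longrightarrow> open T \<Longrightarrow> T \<subseteq> S \<Longrightarrow> smooth_on T f"
  unfolding smooth_on_def using Ck_on_subset by blast

lemma smooth_on_continuous_on: "smooth_on S f \<Longrightarrow> continuous_on S f"
  unfolding smooth_on_def using Ck_on_continuous_on by blast

lemma smooth_on_has_derivative:
  "smooth_on S f \<Longrightarrow> x \<in> S \<Longrightarrow> (f has_derivative fderiv f x) (at x)"
  unfolding smooth_on_def using Ck_on_Suc_has_derivative by blast

lemma smooth_on_linear_fderiv: "smooth_on S f \<Longrightarrow> x \<in> S \<Longrightarrow> linear (fderiv f x)"
  using smooth_on_has_derivative has_derivative_linear by blast

lemma smooth_on_fderiv: "smooth_on S f \<Longrightarrow> smooth_on S (\<lambda>x. fderiv f x v)"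
  unfolding smooth_on_def using Ck_on.simps(2)[of _ S f] by blast

lemma smooth_on_if_derivative:
  assumes "open S" "\<And>x. x \<in> S \<Longrightarrow> (f has_derivative f' x) (at x)"
    and "\<And>v. smooth_on S (\<lambda>x. f' x v)"
  shows "smooth_on S f"
proof -
  have "Ck_on (Suc k) S f" for k
    by (rule Ck_on_SucI) (use assms smooth_on_def in blast)+
  then show ?thesis using assms(1) unfolding smooth_on_def using Ck_on_pred by blast
qed

lemma smooth_on_const: "open S \<Longrightarrow> smooth_on S (\<lambda>x. c)"
  by (simp add: smooth_on_def Ck_on_const)

lemma smooth_on_linear: "open S \<Longrightarrow> bounded_linear L \<Longrightarrow> smooth_on S L"
  by (simp add: smooth_on_def Ck_on_linear)

lemma smooth_on_id: "open S \<Longrightarrow> smooth_on S (\<lambda>x. x)"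
  by (rule smooth_on_linear) (auto intro: bounded_linear_ident)

lemma smooth_on_linear_compose:
  "bounded_linear L \<Longrightarrow> smooth_on S f \<Longrightarrow> smooth_on S (\<lambda>x. L (f x))"
  by (simp add: smooth_on_def Ck_on_linear_compose)

lemma smooth_on_add: "smooth_on S f \<Longrightarrow> smooth_on S g \<Longrightarrow> smooth_on S (\<lambda>x. f x + g x)"
  by (simp add: smooth_on_def Ck_on_add)

lemma smooth_on_minus: "smooth_on S f \<Longrightarrow> smooth_on S (\<lambda>x. - f x)"
  by (rule smooth_on_linear_compose) (auto intro: bounded_linear_minus bounded_linear_ident)

lemma smooth_on_diff: "smooth_on S f \<Longrightarrow> smooth_on S g \<Longrightarrow> smooth_on S (\<lambda>x. f x - g x)"
  using smooth_on_add[OF _ smooth_on_minus, of S f g] by simp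

lemma smooth_on_bilinear:
  "bounded_bilinear B \<Longrightarrow> smooth_on S f \<Longrightarrow> smooth_on S g \<Longrightarrow> smooth_on S (\<lambda>x. B (f x) (g x))"
  by (simp add: smooth_on_def Ck_on_bilinear)

lemmas smooth_on_mult = smooth_on_bilinear[OF bounded_bilinear_mult]
lemmas smooth_on_scaleR = smooth_on_bilinear[OF bounded_bilinear_scaleR]
lemmas smooth_on_inner = smooth_on_bilinear[OF bounded_bilinear_inner]

lemma smooth_on_sum:
  "open S \<Longrightarrow> (\<And>i. i \<in> I \<Longrightarrow> smooth_on S (f i)) \<Longrightarrow> smooth_on S (\<lambda>x. \<Sum>i\<in>I. f i x)"
  by (simp add: smooth_on_def Ck_on_sum)

lemma smooth_on_inverse:
  fixes f :: "'a::euclidean_space \<Rightarrow> real"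
  shows "smooth_on S f \<Longrightarrow> (\<And>x. x \<in> S \<Longrightarrow> f x \<noteq> 0) \<Longrightarrow> smooth_on S (\<lambda>x. inverse (f x))"
  by (simp add: smooth_on_def Ck_on_inverse)

lemma smooth_on_sqrt:
  "smooth_on S f \<Longrightarrow> (\<And>x. x \<in> S \<Longrightarrow> f x > 0) \<Longrightarrow> smooth_on S (\<lambda>x. sqrt (f x))"
  by (simp add: smooth_on_def Ck_on_sqrt)

lemma smooth_on_compose:
  "smooth_on T f \<Longrightarrow> smooth_on S g \<Longrightarrow> g ` S \<subseteq> T \<Longrightarrow> smooth_on S (\<lambda>x. f (g x))"
  using Ck_on_compose unfolding smooth_on_def by blast

lemma smooth_on_euclidean:
  fixes f :: "'a::euclidean_space \<Rightarrow> 'b::euclidean_space"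
  assumes "open S" "\<And>b. b \<in> Basis \<Longrightarrow> smooth_on S (\<lambda>x. f x \<bullet> b)"
  shows "smooth_on S f"
proof -
  have "smooth_on S (\<lambda>x. \<Sum>b\<in>Basis. (f x \<bullet> b) *\<^sub>R b)"
    by (intro smooth_on_sum smooth_on_scaleR assms smooth_on_const)
  then show ?thesis by (simp add: euclidean_representation)
qed

lemma smooth_on_Pair:
  assumes "smooth_on S f" "smooth_on S g"
  shows "smooth_on S (\<lambda>x. (f x, g x))"
proof -
  have 1: "bounded_linear (\<lambda>y::'b. (y, 0::'c))" and 2: "bounded_linear (\<lambda>y::'c. (0::'b, y))"
    by (auto intro!: bounded_linear_Pair bounded_linear_ident bounded_linear_zero)
  have "smooth_on S (\<lambda>x. (f x, 0) + (0, g x))"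
    by (intro smooth_on_add smooth_on_linear_compose[OF 1] smooth_on_linear_compose[OF 2] assms)
  then show ?thesis by simp
qed

lemma smooth_on_fst: "smooth_on S f \<Longrightarrow> smooth_on S (\<lambda>x. fst (f x))"
  by (rule smooth_on_linear_compose[OF bounded_linear_fst])

lemma smooth_on_snd: "smooth_on S f \<Longrightarrow> smooth_on S (\<lambda>x. snd (f x))"
  by (rule smooth_on_linear_compose[OF bounded_linear_snd])

lemma smooth_on_differentiable: "smooth_on S f \<Longrightarrow> x \<in> S \<Longrightarrow> f differentiable at x"
  using smooth_on_has_derivative differentiable_def by blast

lemma fderiv_linear_compose:
  assumes "bounded_linear L" "f differentiable at x"
  shows "fderiv (\<lambda>y. L (f y)) x = (\<lambda>v. L (fderiv f x v))"
  by (rule fderiv_eqI[OF bounded_linear.has_derivative[OF assms(1) assms(2)[unfolded frechet_derivative_works]]])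

lemma fderiv_bilinear:
  assumes "bounded_bilinear B" "f differentiable at x" "g differentiable at x"
  shows "fderiv (\<lambda>y. B (f y) (g y)) x k = B (f x) (fderiv g x k) + B (fderiv f x k) (g x)"
proof -
  have "((\<lambda>y. B (f y) (g y)) has_derivative (\<lambda>k. B (f x) (fderiv g x k) + B (fderiv f x k) (g x))) (at x)"
    by (rule bounded_bilinear.FDERIV[OF assms(1)])
      (use assms(2,3) frechet_derivative_works in blast)+
  from fderiv_eqI[OF this] show ?thesis by simp
qed

lemmas fderiv_scaleR = fderiv_bilinear[OF bounded_bilinear_scaleR]
lemmas fderiv_inner = fderiv_bilinear[OF bounded_bilinear_inner]

lemma fderiv_add:
  assumes "f differentiable at x" "g differentiable at x"
  shows "fderiv (\<lambda>y. f y + g y) x k = fderiv f x k + fderiv g x k"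
proof -
  have "((\<lambda>y. f y + g y) has_derivative (\<lambda>k. fderiv f x k + fderiv g x k)) (at x)"
    by (rule has_derivative_add) (use assms frechet_derivative_works in blast)+
  from fderiv_eqI[OF this] show ?thesis by simp
qed

lemma fderiv_left_inverse:
  assumes \<theta>: "smooth_on D \<theta>" and \<eta>: "smooth_on D' \<eta>" and "\<theta> ` D \<subseteq> D'" and inv: "\<And>y. y \<in> D \<Longrightarrow> \<eta> (\<theta> y) = y"
    and x: "x \<in> D"
  shows "fderiv \<eta> (\<theta> x) (fderiv \<theta> x h) = h"
proof -
  have "((\<lambda>y. \<eta> (\<theta> y)) has_derivative (\<lambda>h. fderiv \<eta> (\<theta> x) (fderiv \<theta> x h))) (at x)"
  proof (rule has_derivative_compose[of \<theta> _ x UNIV \<eta>])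
    show "(\<theta> has_derivative fderiv \<theta> x) (at x)" by (rule smooth_on_has_derivative[OF \<theta> x])
    show "(\<eta> has_derivative fderiv \<eta> (\<theta> x)) (at (\<theta> x))"
      by (rule smooth_on_has_derivative[OF \<eta>]) (use assms(3) x in blast)
  qed
  then have "((\<lambda>y. y) has_derivative (\<lambda>h. fderiv \<eta> (\<theta> x) (fderiv \<theta> x h))) (at x)"
    by (rule has_derivative_transform_within_open[OF _ smooth_on_open[OF \<theta>] x]) (rule inv)
  from has_derivative_unique[OF this has_derivative_ident] show ?thesis by (simp add: fun_eq_iff)
qed

section \<open>Symmetry of the second derivative and closed forms\<close>

text \<open>By the mean value theorem in the two directions, the second difference over a parallelogram is a
  value of one mixed second derivative inside it.  The second difference is symmetric in the two
  directions, which yields the theorem of Schwarz.\<close>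

lemma second_difference_mvt:
  fixes f :: "'a::real_normed_vector \<Rightarrow> real"
  assumes "t > 0"
    and f: "\<And>a b. a \<in> {0..t} \<Longrightarrow> b \<in> {0..t} \<Longrightarrow>
       (f has_derivative f' (x + a *\<^sub>R h + b *\<^sub>R k)) (at (x + a *\<^sub>R h + b *\<^sub>R k))"
    and f': "\<And>a b. a \<in> {0..t} \<Longrightarrow> b \<in> {0..t} \<Longrightarrow>
       ((\<lambda>y. f' y h) has_derivative f'' (x + a *\<^sub>R h + b *\<^sub>R k)) (at (x + a *\<^sub>R h + b *\<^sub>R k))"
  shows "\<exists>a\<in>{0..t}. \<exists>b\<in>{0..t}.
     f (x + t *\<^sub>R h + t *\<^sub>R k) - f (x + t *\<^sub>R h) - f (x + t *\<^sub>R k) + f x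
       = t * (t * f'' (x + a *\<^sub>R h + b *\<^sub>R k) k)"
proof -
  define \<phi> where "\<phi> a = f (x + a *\<^sub>R h + t *\<^sub>R k) - f (x + a *\<^sub>R h)" for a
  have d\<phi>: "(\<phi> has_derivative (\<lambda>c. c * (f' (x + a *\<^sub>R h + t *\<^sub>R k) h - f' (x + a *\<^sub>R h) h))) (at a)"
    if a: "a \<in> {0..t}" for a
  proof -
    have 1: "(f has_derivative f' (x + a *\<^sub>R h + t *\<^sub>R k)) (at (x + a *\<^sub>R h + t *\<^sub>R k))"
      using f[of a t] a assms(1) by simp
    have 2: "(f has_derivative f' (x + a *\<^sub>R h)) (at (x + a *\<^sub>R h))"
      using f[of a 0] a assms(1) by simp
    have l: "linear (f' (x + a *\<^sub>R h + t *\<^sub>R k))" "linear (f' (x + a *\<^sub>R h))"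
      using 1 2 has_derivative_linear by auto
    have "(\<phi> has_derivative (\<lambda>c. f' (x + a *\<^sub>R h + t *\<^sub>R k) (c *\<^sub>R h) - f' (x + a *\<^sub>R h) (c *\<^sub>R h))) (at a)"
      unfolding \<phi>_def
      by (intro has_derivative_diff
          has_derivative_compose[where f="\<lambda>a. x + a *\<^sub>R h + t *\<^sub>R k" and g=f, OF _ 1]
          has_derivative_compose[where f="\<lambda>a. x + a *\<^sub>R h" and g=f, OF _ 2])
        (auto intro!: derivative_eq_intros)
    then show ?thesis
      by (simp add: linear_cmul[OF l(1)] linear_cmul[OF l(2)] right_diff_distrib)
  qed
  have "\<exists>a. 0 < a \<and> a < t \<and> \<phi> t - \<phi> 0 = (t - 0) * (f' (x + a *\<^sub>R h + t *\<^sub>R k) h - f' (x + a *\<^sub>R h) h)"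
  proof (rule mvt[OF assms(1), of \<phi>])
    show "continuous_on {0..t} \<phi>"
      using d\<phi> has_derivative_continuous by (blast intro: continuous_at_imp_continuous_on)
    show "(\<phi> has_derivative (\<lambda>c. c * (f' (x + a *\<^sub>R h + t *\<^sub>R k) h - f' (x + a *\<^sub>R h) h))) (at a)"
      if "0 < a" "a < t" for a using d\<phi> that by simp
  qed blast
  then obtain a where a: "0 < a" "a < t" "\<phi> t - \<phi> 0 = t * (f' (x + a *\<^sub>R h + t *\<^sub>R k) h - f' (x + a *\<^sub>R h) h)"
    by auto
  define \<theta> where "\<theta> b = f' (x + a *\<^sub>R h + b *\<^sub>R k) h" for b
  have d\<theta>: "(\<theta> has_derivative (\<lambda>c. c * f'' (x + a *\<^sub>R h + b *\<^sub>R k) k)) (at b)" if b: "b \<in> {0..t}" for b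
  proof -
    have 1: "((\<lambda>y. f' y h) has_derivative f'' (x + a *\<^sub>R h + b *\<^sub>R k)) (at (x + a *\<^sub>R h + b *\<^sub>R k))"
      using f'[of a b] a b by simp
    have l: "linear (f'' (x + a *\<^sub>R h + b *\<^sub>R k))" using 1 has_derivative_linear by auto
    have "(\<theta> has_derivative (\<lambda>c. f'' (x + a *\<^sub>R h + b *\<^sub>R k) (c *\<^sub>R k))) (at b)"
      unfolding \<theta>_def
      by (intro has_derivative_compose[where f="\<lambda>b. x + a *\<^sub>R h + b *\<^sub>R k" and g="\<lambda>y. f' y h", OF _ 1]) (auto intro!: derivative_eq_intros)
    then show ?thesis by (simp add: linear_cmul[OF l])
  qed
  have "\<exists>b. 0 < b \<and> b < t \<and> \<theta> t - \<theta> 0 = (t - 0) * f'' (x + a *\<^sub>R h + b *\<^sub>R k) k"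
  proof (rule mvt[OF assms(1), of \<theta>])
    show "continuous_on {0..t} \<theta>"
      using d\<theta> has_derivative_continuous by (blast intro: continuous_at_imp_continuous_on)
    show "(\<theta> has_derivative (\<lambda>c. c * f'' (x + a *\<^sub>R h + b *\<^sub>R k) k)) (at b)"
      if "0 < b" "b < t" for b using d\<theta> that by simp
  qed blast
  then obtain b where b: "0 < b" "b < t" "\<theta> t - \<theta> 0 = t * f'' (x + a *\<^sub>R h + b *\<^sub>R k) k"
    by auto
  have "f (x + t *\<^sub>R h + t *\<^sub>R k) - f (x + t *\<^sub>R h) - f (x + t *\<^sub>R k) + f x = \<phi> t - \<phi> 0"
    by (simp add: \<phi>_def)
  also have "\<dots> = t * (\<theta> t - \<theta> 0)" by (simp add: a \<theta>_def)
  finally show ?thesis using a b by (metis atLeastAtMost_iff less_imp_le)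
qed

lemma second_derivative_symmetric_real:
  fixes f :: "'a::euclidean_space \<Rightarrow> real"
  assumes "smooth_on S f" "x \<in> S"
  shows "fderiv (\<lambda>y. fderiv f y h) x k = fderiv (\<lambda>y. fderiv f y k) x h"
proof (rule ccontr)
  define A where "A y = fderiv (\<lambda>y. fderiv f y h) y k" for y
  define B where "B y = fderiv (\<lambda>y. fderiv f y k) y h" for y
  assume "\<not> ?thesis"
  then have ne: "\<bar>A x - B x\<bar> > 0" by (simp add: A_def B_def)
  \<comment> \<open>Near \<open>x\<close> the two mixed derivatives are closer than \<open>e\<close> to their values at \<open>x\<close>, hence distinct.\<close>
  define e where "e = \<bar>A x - B x\<bar> / 2"
  have e: "e > 0" using ne by (simp add: e_def)
  have "continuous_on S A" "continuous_on S B" unfolding A_def B_def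
    by (rule smooth_on_continuous_on[OF smooth_on_fderiv[OF smooth_on_fderiv[OF assms(1)]]])+
  then have "isCont A x" "isCont B x"
    using assms smooth_on_open continuous_on_eq_continuous_at by blast+
  then obtain d1 d2 where d12: "d1 > 0" "\<And>y. dist y x < d1 \<Longrightarrow> dist (A y) (A x) < e"
      "d2 > 0" "\<And>y. dist y x < d2 \<Longrightarrow> dist (B y) (B x) < e"
    using e unfolding continuous_at_eps_delta by metis
  obtain d3 where d3: "d3 > 0" "\<And>y. dist y x < d3 \<Longrightarrow> y \<in> S"
    using smooth_on_open[OF assms(1)] assms(2) unfolding open_dist by metis
  define d where "d = min d1 (min d2 d3)"
  have d: "d > 0" "\<And>y. dist y x < d \<Longrightarrow> dist (A y) (A x) < e \<and> dist (B y) (B x) < e \<and> y \<in> S"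
    using d12 d3 by (auto simp: d_def)
  \<comment> \<open>small enough for the parallelogram to stay in the ball of radius \<open>d\<close>\<close>
  define t where "t = d / (2 * (norm h + norm k + 1))"
  have den: "norm h + norm k + 1 > 0" by (smt (verit) norm_ge_zero)
  have t: "t > 0" using d(1) den by (simp add: t_def)
  have near: "dist (x + a *\<^sub>R h + b *\<^sub>R k) x < d" if "a \<in> {0..t}" "b \<in> {0..t}" for a b
  proof -
    have "dist (x + a *\<^sub>R h + b *\<^sub>R k) x = norm (a *\<^sub>R h + b *\<^sub>R k)"
      by (simp add: dist_norm add.assoc)
    also have "\<dots> \<le> a * norm h + b * norm k"
      using norm_triangle_ineq[of "a *\<^sub>R h" "b *\<^sub>R k"] that by simp
    also have "\<dots> \<le> t * norm h + t * norm k"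
      using that by (intro add_mono mult_right_mono) auto
    also have "\<dots> = t * (norm h + norm k)" by (simp add: distrib_left)
    also have "\<dots> < t * (2 * (norm h + norm k + 1))"
    proof (rule mult_strict_left_mono[OF _ t])
      have *: "n < 2 * (n + 1)" if "0 \<le> n" for n :: real using that by simp
      show "norm h + norm k < 2 * (norm h + norm k + 1)" by (rule *) simp
    qed
    also have "\<dots> = d" using den by (simp add: t_def)
    finally show ?thesis .
  qed
  have near': "dist (x + b *\<^sub>R k + a *\<^sub>R h) x < d" if "a \<in> {0..t}" "b \<in> {0..t}" for a b
    using near[OF that] by (simp add: algebra_simps)
  have df: "(f has_derivative fderiv f y) (at y)" if "dist y x < d" for y
    by (rule smooth_on_has_derivative[OF assms(1)]) (use d(2) that in blast)
  have ddf: "((\<lambda>y. fderiv f y h) has_derivative fderiv (\<lambda>y. fderiv f y h) y) (at y)" if "dist y x < d" for y h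
    by (rule smooth_on_has_derivative[OF smooth_on_fderiv[OF assms(1)]]) (use d(2) that in blast)
  obtain a b where ab: "a \<in> {0..t}" "b \<in> {0..t}"
     "f (x + t *\<^sub>R h + t *\<^sub>R k) - f (x + t *\<^sub>R h) - f (x + t *\<^sub>R k) + f x = t * (t * A (x + a *\<^sub>R h + b *\<^sub>R k))"
    using second_difference_mvt[OF t, of f "fderiv f" x h k "fderiv (\<lambda>y. fderiv f y h)"] df ddf near
    unfolding A_def by metis
  obtain a' b' where ab': "a' \<in> {0..t}" "b' \<in> {0..t}"
     "f (x + t *\<^sub>R k + t *\<^sub>R h) - f (x + t *\<^sub>R k) - f (x + t *\<^sub>R h) + f x = t * (t * B (x + a' *\<^sub>R k + b' *\<^sub>R h))"
    using second_difference_mvt[OF t, of f "fderiv f" x k h "fderiv (\<lambda>y. fderiv f y k)"] df ddf near'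
    unfolding B_def by metis
  have swap: "x + t *\<^sub>R k + t *\<^sub>R h = x + t *\<^sub>R h + t *\<^sub>R k" by (simp add: algebra_simps)
  have "t * (t * A (x + a *\<^sub>R h + b *\<^sub>R k)) = t * (t * B (x + a' *\<^sub>R k + b' *\<^sub>R h))"
    using ab(3) ab'(3)[unfolded swap] by linarith
  then have "A (x + a *\<^sub>R h + b *\<^sub>R k) = B (x + a' *\<^sub>R k + b' *\<^sub>R h)" using t by simp
  moreover have "dist (A (x + a *\<^sub>R h + b *\<^sub>R k)) (A x) < e" using d(2) near ab by blast
  moreover have "dist (B (x + a' *\<^sub>R k + b' *\<^sub>R h)) (B x) < e" using d(2) near' ab' by blast
  ultimately show False unfolding e_def dist_real_def by (auto simp: abs_if split: if_splits)
qed

lemma second_derivative_symmetric: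
  fixes f :: "'a::euclidean_space \<Rightarrow> 'b::euclidean_space"
  assumes "smooth_on S f" "x \<in> S"
  shows "fderiv (\<lambda>y. fderiv f y h) x k = fderiv (\<lambda>y. fderiv f y k) x h"
proof (rule euclidean_eqI)
  fix b :: 'b
  have bl: "bounded_linear (\<lambda>z::'b. z \<bullet> b)" by (rule bounded_linear_inner_left)
  have sm: "smooth_on S (\<lambda>y. f y \<bullet> b)" by (rule smooth_on_linear_compose[OF bl assms(1)])
  have *: "fderiv (\<lambda>y. fderiv (\<lambda>y. f y \<bullet> b) y h) x k = fderiv (\<lambda>y. fderiv f y h) x k \<bullet> b" for h k
  proof -
    have "fderiv (\<lambda>y. fderiv (\<lambda>y. f y \<bullet> b) y h) x = fderiv (\<lambda>y. fderiv f y h \<bullet> b) x"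
      by (rule fderiv_cong_open[OF smooth_on_open[OF assms(1)] assms(2)])
        (simp add: fderiv_linear_compose[OF bl smooth_on_differentiable[OF assms(1)]])
    then show ?thesis
      by (simp add: fderiv_linear_compose[OF bl smooth_on_differentiable[OF smooth_on_fderiv[OF assms(1)] assms(2)]])
  qed
  show "fderiv (\<lambda>y. fderiv f y h) x k \<bullet> b = fderiv (\<lambda>y. fderiv f y k) x h \<bullet> b"
    using second_derivative_symmetric_real[OF sm assms(2), of h k] by (simp add: *)
qed

text \<open>The primitive integrates \<open>\<omega>\<close> along the segments that start at a fixed point.  Under the integral
  sign the closedness of \<open>\<omega>\<close> turns the derivative of the integrand into the derivative of
  \<open>t *\<^sub>R \<omega> (\<gamma> x t) h\<close> with respect to \<open>t\<close>, whose integral is \<open>\<omega> x h\<close>.\<close>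

lemma poincare_lemma:
  fixes \<omega> :: "'a::euclidean_space \<Rightarrow> 'a \<Rightarrow> 'b::banach"
  assumes S: "open S" "convex S"
    and lin: "\<And>x. x \<in> S \<Longrightarrow> linear (\<omega> x)"
    and der: "\<And>x h. x \<in> S \<Longrightarrow> ((\<lambda>y. \<omega> y h) has_derivative \<omega>' x h) (at x)"
    and cont: "\<And>h k. continuous_on S (\<lambda>x. \<omega>' x h k)"
    and closed: "\<And>x h k. x \<in> S \<Longrightarrow> \<omega>' x h k = \<omega>' x k h"
  shows "\<exists>P. \<forall>x\<in>S. (P has_derivative \<omega> x) (at x)"
proof (cases "S = {}")
  case False
  then obtain x0 where x0: "x0 \<in> S" by auto
  define \<gamma> where "\<gamma> x t = x0 + t *\<^sub>R (x - x0)" for x and t :: real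
  have \<gamma>S: "\<gamma> x t \<in> S" if "x \<in> S" "t \<in> {0..1}" for x t
  proof -
    have "\<gamma> x t = (1 - t) *\<^sub>R x0 + t *\<^sub>R x" by (simp add: \<gamma>_def algebra_simps)
    then show ?thesis using S(2) x0 that by (simp add: convex_alt)
  qed
  have lin': "linear (\<omega>' x h)" if "x \<in> S" for x h
    using der[OF that] has_derivative_linear by blast
  have lin'': "linear (\<lambda>h. \<omega>' x h k)" if "x \<in> S" for x k
  proof -
    have "(\<lambda>h. \<omega>' x h k) = \<omega>' x k" using closed[OF that] by blast
    then show ?thesis using lin'[OF that] by metis
  qed
  define D where "D x t h = \<omega> (\<gamma> x t) h + t *\<^sub>R \<omega>' (\<gamma> x t) h (x - x0)" for x and t :: real and h
  have expand: "L w = (\<Sum>b\<in>Basis. (w \<bullet> b) *\<^sub>R L b)" if "linear L" for L :: "'a \<Rightarrow> 'b" and w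
    using linear_sum[OF that, of "\<lambda>b. (w \<bullet> b) *\<^sub>R b" Basis]
    by (simp add: euclidean_representation linear_cmul[OF that])
  have bl: "bounded_linear (D x t)" if "x \<in> S" "t \<in> {0..1}" for x t
    unfolding D_def linear_conv_bounded_linear[symmetric]
    by (intro linear_compose_add linear_compose_scale_right lin lin'' \<gamma>S that)
  have dD: "((\<lambda>x. \<omega> (\<gamma> x t) (x - x0)) has_derivative D x t) (at x)"
    if x: "x \<in> S" and t: "t \<in> {0..1}" for x t
  proof -
    have g: "((\<lambda>x. \<gamma> x t) has_derivative (\<lambda>h. t *\<^sub>R h)) (at x)"
      unfolding \<gamma>_def by (auto intro!: derivative_eq_intros)
    have 1: "((\<lambda>x. \<omega> (\<gamma> x t) b) has_derivative (\<lambda>h. \<omega>' (\<gamma> x t) b (t *\<^sub>R h))) (at x)" for b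
      by (rule has_derivative_compose[where g="\<lambda>y. \<omega> y b", OF g der[OF \<gamma>S[OF x t]]])
    have "((\<lambda>x. \<Sum>b\<in>Basis. ((x - x0) \<bullet> b) *\<^sub>R \<omega> (\<gamma> x t) b) has_derivative
        (\<lambda>h. \<Sum>b\<in>Basis. ((x - x0) \<bullet> b) *\<^sub>R \<omega>' (\<gamma> x t) b (t *\<^sub>R h) + (h \<bullet> b) *\<^sub>R \<omega> (\<gamma> x t) b)) (at x)"
      by (intro has_derivative_sum has_derivative_scaleR 1) (auto intro!: derivative_eq_intros)
    moreover have "(\<Sum>b\<in>Basis. ((x - x0) \<bullet> b) *\<^sub>R \<omega>' (\<gamma> x t) b (t *\<^sub>R h) + (h \<bullet> b) *\<^sub>R \<omega> (\<gamma> x t) b)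
        = D x t h" for h
    proof -
      have "\<omega>' (\<gamma> x t) b (t *\<^sub>R h) = t *\<^sub>R \<omega>' (\<gamma> x t) h b" for b
        using closed[OF \<gamma>S[OF x t]] linear_cmul[OF lin'[OF \<gamma>S[OF x t]]] by metis
      then show ?thesis
        by (simp add: D_def sum.distrib expand[OF lin[OF \<gamma>S[OF x t]], of h]
            expand[OF lin'[OF \<gamma>S[OF x t]], of h "x - x0"] scaleR_sum_right mult.commute)
    qed
    moreover have "\<omega> (\<gamma> y t) (y - x0) = (\<Sum>b\<in>Basis. ((y - x0) \<bullet> b) *\<^sub>R \<omega> (\<gamma> y t) b)" if "y \<in> S" for y
      by (rule expand[OF lin[OF \<gamma>S[OF that t]]])
    ultimately show ?thesis
      by (auto intro: has_derivative_transform_within_open[OF _ S(1) x])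
  qed
  have cont\<omega>: "continuous_on S (\<lambda>x. \<omega> x h)" for h
    using der has_derivative_continuous by (blast intro: continuous_at_imp_continuous_on)
  have cont\<gamma>: "continuous_on (S \<times> {0..1}) (\<lambda>(x, t). \<gamma> x t)"
    unfolding \<gamma>_def split_def by (intro continuous_intros)
  have comp\<gamma>: "continuous_on (S \<times> {0..1}) (\<lambda>(x, t). f (\<gamma> x t))"
    if "continuous_on S f" for f :: "'a \<Rightarrow> 'b"
    using continuous_on_compose2[OF that cont\<gamma>[unfolded split_def]] \<gamma>S
    by (force simp: split_def image_subset_iff)
  have contD: "continuous_on (S \<times> {0..1}) (\<lambda>(x, t). D x t h)" for h
  proof -
    have "continuous_on (S \<times> {0..1}) (\<lambda>z. \<omega> (\<gamma> (fst z) (snd z)) h +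
        snd z *\<^sub>R (\<Sum>b\<in>Basis. ((fst z - x0) \<bullet> b) *\<^sub>R \<omega>' (\<gamma> (fst z) (snd z)) h b))"
      using comp\<gamma>[OF cont\<omega>] comp\<gamma>[OF cont]
      by (intro continuous_intros) (auto simp: split_def)
    then show ?thesis
      by (rule continuous_on_eq) (auto simp: D_def expand[OF lin'[OF \<gamma>S], of _ _ _ "_ - x0", symmetric])
  qed
  define P where "P x = integral {0..1} (\<lambda>t. \<omega> (\<gamma> x t) (x - x0))" for x
  have "(P has_derivative \<omega> x) (at x)" if x: "x \<in> S" for x
  proof -
    have app: "blinfun_apply (Blinfun (D y t)) = D y t" if "y \<in> S" "t \<in> {0..1}" for y t
      by (rule bounded_linear_Blinfun_apply[OF bl[OF that]])
    have contB: "continuous_on (S \<times> {0..1}) (\<lambda>(x, t). Blinfun (D x t))"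
    proof (rule continuous_on_blinfun_componentwise)
      show "continuous_on (S \<times> {0..1}) (\<lambda>z. blinfun_apply (case z of (x, t) \<Rightarrow> Blinfun (D x t)) i)" for i
        by (rule continuous_on_eq[OF contD[of i]]) (auto simp: app)
    qed
    have "((\<lambda>x. integral (cbox 0 1) (\<lambda>t. \<omega> (\<gamma> x t) (x - x0))) has_derivative
        blinfun_apply (integral (cbox 0 1) (\<lambda>t. Blinfun (D x t)))) (at x within S)"
    proof (rule leibniz_rule[OF _ _ _ x S(2)])
      show "((\<lambda>x. \<omega> (\<gamma> x t) (x - x0)) has_derivative blinfun_apply (Blinfun (D y t))) (at y within S)"
        if "y \<in> S" "t \<in> cbox 0 1" for y t
        using dD[of y t] app[of y t] that by (auto intro: has_derivative_at_withinI)
      show "(\<lambda>t. \<omega> (\<gamma> y t) (y - x0)) integrable_on cbox 0 1" if "y \<in> S" for y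
      proof (rule integrable_continuous)
        have "continuous_on {0..1} (\<lambda>t. \<gamma> y t)" unfolding \<gamma>_def by (intro continuous_intros)
        then show "continuous_on (cbox 0 1) (\<lambda>t. \<omega> (\<gamma> y t) (y - x0))"
          using continuous_on_compose2[OF cont\<omega>, of "{0..1}" "\<gamma> y"] \<gamma>S[OF that]
          by (auto simp: image_subset_iff)
      qed
      show "continuous_on (S \<times> cbox 0 1) (\<lambda>(x, t). Blinfun (D x t))" using contB by simp
    qed
    moreover have "blinfun_apply (integral (cbox 0 1) (\<lambda>t. Blinfun (D x t))) h = \<omega> x h" for h
    proof -
      have "continuous_on {0..1} (\<lambda>t. Blinfun (D x t))"
        using continuous_on_compose2[OF contB, of "{0..1}" "Pair x"] x
          continuous_on_Pair[OF continuous_on_const continuous_on_id, of "{0..1}" x]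
        by (auto simp: image_subset_iff)
      then have "(\<lambda>t. Blinfun (D x t)) integrable_on {0..1}"
        by (rule integrable_continuous_interval)
      then have "blinfun_apply (integral {0..1} (\<lambda>t. Blinfun (D x t))) h
          = integral {0..1} (\<lambda>t. blinfun_apply (Blinfun (D x t)) h)"
        by (rule blinfun_apply_integral)
      also have "\<dots> = integral {0..1} (\<lambda>t. D x t h)"
        by (rule integral_cong) (simp add: app[OF x])
      also have "\<dots> = 1 *\<^sub>R \<omega> (\<gamma> x 1) h - 0 *\<^sub>R \<omega> (\<gamma> x 0) h"
      proof (rule integral_unique)
        show "((\<lambda>t. D x t h) has_integral (1 *\<^sub>R \<omega> (\<gamma> x 1) h - 0 *\<^sub>R \<omega> (\<gamma> x 0) h)) {0..1}"
        proof (rule fundamental_theorem_of_calculus)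
          fix t :: real assume t: "t \<in> {0..1}"
          have g: "((\<lambda>t. \<gamma> x t) has_derivative (\<lambda>c. c *\<^sub>R (x - x0))) (at t within {0..1})"
            unfolding \<gamma>_def by (auto intro!: derivative_eq_intros)
          have "((\<lambda>t. \<omega> (\<gamma> x t) h) has_derivative (\<lambda>c. \<omega>' (\<gamma> x t) h (c *\<^sub>R (x - x0)))) (at t within {0..1})"
            by (rule has_derivative_compose[where g="\<lambda>y. \<omega> y h", OF g der[OF \<gamma>S[OF x t]]])
          then have "((\<lambda>t. \<omega> (\<gamma> x t) h) has_vector_derivative \<omega>' (\<gamma> x t) h (x - x0)) (at t within {0..1})"
            unfolding has_vector_derivative_def by (simp add: linear_cmul[OF lin'[OF \<gamma>S[OF x t]]])
          then show "((\<lambda>t. t *\<^sub>R \<omega> (\<gamma> x t) h) has_vector_derivative D x t h) (at t within {0..1})"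
            unfolding D_def by (auto intro!: derivative_eq_intros)
        qed simp
      qed
      finally show ?thesis by (simp add: \<gamma>_def)
    qed
    then have "blinfun_apply (integral (cbox (0::real) 1) (\<lambda>t. Blinfun (D x t))) = \<omega> x" by (rule ext)
    ultimately show ?thesis
      by (simp only: P_def[abs_def] cbox_interval at_within_open[OF x S(1)])
  qed
  then show ?thesis by blast
qed auto

section \<open>Maps between the Lorentz numbers and other vector spaces\<close>

lemma bounded_linear_lRe: "bounded_linear lRe"
  and bounded_linear_lIm: "bounded_linear lIm"
  unfolding linear_conv_bounded_linear[symmetric] by (auto intro!: linearI)

lemma lconj_simps [simp]: "lRe (lconj x) = lRe x" "lIm (lconj x) = - lIm x"
  by (simp_all add: lconj_def)

lemma bounded_linear_lconj: "bounded_linear lconj"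
  unfolding linear_conv_bounded_linear[symmetric]
  by (auto intro!: linearI simp: lorentz_eq_iff)

lemma bounded_bilinear_ltimes: "bounded_bilinear ((*) :: lorentz \<Rightarrow> lorentz \<Rightarrow> lorentz)"
  unfolding bilinear_conv_bounded_bilinear[symmetric] bilinear_def
  by (auto intro!: linearI simp: lorentz_eq_iff algebra_simps)

lemmas smooth_on_ltimes = smooth_on_bilinear[OF bounded_bilinear_ltimes]
lemmas smooth_on_lRe = smooth_on_linear_compose[OF bounded_linear_lRe]
lemmas smooth_on_lIm = smooth_on_linear_compose[OF bounded_linear_lIm]
lemmas smooth_on_lconj = smooth_on_linear_compose[OF bounded_linear_lconj]

lemma lorentz_components: "Lor a b = a *\<^sub>R 1 + b *\<^sub>R lsigma"
  by (simp add: lorentz_eq_iff)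

lemma smooth_on_Lor:
  assumes "smooth_on S a" "smooth_on S b"
  shows "smooth_on S (\<lambda>x. Lor (a x) (b x))"
  unfolding lorentz_components
  by (intro smooth_on_add smooth_on_scaleR assms smooth_on_const smooth_on_open[OF assms(1)])

lemma smooth_on_vec:
  fixes f :: "'a::euclidean_space \<Rightarrow> real ^ 'n"
  assumes "open S" "\<And>i. smooth_on S (\<lambda>x. f x $ i)"
  shows "smooth_on S f"
  by (rule smooth_on_euclidean) (auto simp: Basis_vec_def inner_axis assms)

lemma smooth_on_vec_nth: "smooth_on S f \<Longrightarrow> smooth_on S (\<lambda>x. f x $ i)"
  by (rule smooth_on_linear_compose[OF bounded_linear_vec_nth])

lemma smooth_on_Complex:
  assumes "smooth_on S a" "smooth_on S b"
  shows "smooth_on S (\<lambda>x. Complex (a x) (b x))"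
proof -
  have "Complex (a x) (b x) = a x *\<^sub>R 1 + b x *\<^sub>R \<i>" for x by (simp add: complex_eq_iff)
  then show ?thesis
    by (auto intro!: smooth_on_add smooth_on_scaleR assms smooth_on_const smooth_on_open[OF assms(1)])
qed

lemma linear_lorentz_expand:
  assumes "linear L"
  shows "L h = lRe h *\<^sub>R L 1 + lIm h *\<^sub>R L lsigma"
proof -
  have h: "h = lRe h *\<^sub>R 1 + lIm h *\<^sub>R lsigma" by (simp add: lorentz_eq_iff)
  have "L h = L (lRe h *\<^sub>R 1 + lIm h *\<^sub>R lsigma)" by (rule arg_cong[OF h])
  also have "\<dots> = lRe h *\<^sub>R L 1 + lIm h *\<^sub>R L lsigma"
    by (simp only: linear_add[OF assms] linear_cmul[OF assms])
  finally show ?thesis .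
qed

text \<open>The derivative of the local inverse \<open>\<kappa>\<close> is, by the rule of Cramer, a smooth function \<open>N\<close> composed
  with \<open>\<kappa>\<close> itself; hence each order of differentiability of \<open>\<kappa>\<close> yields the next one.\<close>

lemma smooth_local_inverse:
  fixes \<alpha> :: "lorentz \<Rightarrow> lorentz"
  assumes sm: "smooth_on B \<alpha>" and inj: "\<And>x h. x \<in> B \<Longrightarrow> fderiv \<alpha> x h = 0 \<Longrightarrow> h = 0" and x0: "x0 \<in> B"
  shows "\<exists>B' V \<kappa>. open B' \<and> B' \<subseteq> B \<and> x0 \<in> B' \<and> open V \<and> homeomorphism B' V \<alpha> \<kappa> \<and> smooth_on V \<kappa>"
proof -
  define p where "p x = fderiv \<alpha> x 1" for x
  define q where "q x = fderiv \<alpha> x lsigma" for x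
  define det where "det x = lRe (p x) * lIm (q x) - lIm (p x) * lRe (q x)" for x
  have exp: "fderiv \<alpha> x h = lRe h *\<^sub>R p x + lIm h *\<^sub>R q x" if "x \<in> B" for x h
    unfolding p_def q_def by (rule linear_lorentz_expand[OF smooth_on_linear_fderiv[OF sm that]])
  have det: "det x \<noteq> 0" if x: "x \<in> B" for x
  proof
    assume 0: "det x = 0"
    have "fderiv \<alpha> x (Lor (lIm (q x)) (- lIm (p x))) = 0" "fderiv \<alpha> x (Lor (lRe (q x)) (- lRe (p x))) = 0"
      using 0 by (simp_all add: exp[OF x] lorentz_eq_iff det_def algebra_simps)
    then have "Lor (lIm (q x)) (- lIm (p x)) = 0" "Lor (lRe (q x)) (- lRe (p x)) = 0"
      using inj[OF x] by blast+
    then have "p x = 0" by (simp add: lorentz_eq_iff)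
    then have "(1::lorentz) = 0" using inj[OF x, of 1] by (simp add: p_def)
    then show False by simp
  qed
  \<comment> \<open>the inverse of the derivative by the rule of Cramer\<close>
  define N where "N x k = Lor ((lIm (q x) * lRe k - lRe (q x) * lIm k) * inverse (det x))
      ((lRe (p x) * lIm k - lIm (p x) * lRe k) * inverse (det x))" for x k
  have N1: "fderiv \<alpha> x (N x k) = k" and N2: "N x (fderiv \<alpha> x h) = h" if x: "x \<in> B" for x k h
  proof -
    have i: "(lRe (p x) * lIm (q x) - lIm (p x) * lRe (q x)) * inverse (det x) = 1"
      using det[OF x] by (simp add: det_def)
    show "fderiv \<alpha> x (N x k) = k" "N x (fderiv \<alpha> x h) = h"
      unfolding exp[OF x] N_def lorentz_eq_iff lorentz_sel_simps lorentz_sel_scaleR lorentz.sel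
      using i by (intro conjI; algebra)+
  qed
  have smp: "smooth_on B p" "smooth_on B q" unfolding p_def q_def by (rule smooth_on_fderiv[OF sm])+
  have smN: "smooth_on B (\<lambda>x. N x k)" for k
    unfolding N_def det_def
    by (intro smooth_on_Lor smooth_on_mult smooth_on_inverse smooth_on_diff smooth_on_lRe smooth_on_lIm smp
        smooth_on_const smooth_on_open[OF sm]) (use det det_def in auto)
  have linN: "bounded_linear (N x)" for x
    unfolding linear_conv_bounded_linear[symmetric] N_def
    by (auto intro!: linearI simp: lorentz_eq_iff algebra_simps)
  have bl: "bounded_linear (fderiv \<alpha> x)" if "x \<in> B" for x
    using smooth_on_has_derivative[OF sm that] has_derivative_bounded_linear by blast
  have app: "blinfun_apply (Blinfun (fderiv \<alpha> x)) = fderiv \<alpha> x" if "x \<in> B" for x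
    by (rule bounded_linear_Blinfun_apply[OF bl[OF that]])
  have appN: "blinfun_apply (Blinfun (N x)) = N x" for x
    by (rule bounded_linear_Blinfun_apply[OF linN])
  obtain B' V \<kappa> \<kappa>' where inv: "open B'" "B' \<subseteq> B" "x0 \<in> B'" "open V" "homeomorphism B' V \<alpha> \<kappa>"
    "\<And>y. y \<in> V \<Longrightarrow> (\<kappa> has_derivative (\<kappa>' y)) (at y)"
    "\<And>y. y \<in> V \<Longrightarrow> \<kappa>' y = Hilbert_Choice.inv (blinfun_apply (Blinfun (fderiv \<alpha> (\<kappa> y))))"
  proof (rule inverse_function_theorem[of B \<alpha> "\<lambda>x. Blinfun (fderiv \<alpha> x)" x0 "Blinfun (N x0)"])
    show "open B" using smooth_on_open[OF sm] .
    show "(\<alpha> has_derivative blinfun_apply (Blinfun (fderiv \<alpha> x))) (at x)" if "x \<in> B" for x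
      using smooth_on_has_derivative[OF sm that] app[OF that] by simp
    show "continuous_on B (\<lambda>x. Blinfun (fderiv \<alpha> x))"
    proof (rule continuous_on_blinfun_componentwise)
      show "continuous_on B (\<lambda>x. blinfun_apply (Blinfun (fderiv \<alpha> x)) i)" for i
        using smooth_on_continuous_on[OF smooth_on_fderiv[OF sm, of i]] by (simp add: app cong: continuous_on_cong)
    qed
    show "Blinfun (N x0) o\<^sub>L Blinfun (fderiv \<alpha> x0) = id_blinfun"
      by (rule blinfun_eqI) (simp add: app[OF x0] appN N2[OF x0])
  qed (use x0 in auto)
  have \<kappa>B: "\<kappa> ` V \<subseteq> B" using inv(2,5) by (auto simp: homeomorphism_def)
  have d\<kappa>: "(\<kappa> has_derivative N (\<kappa> y)) (at y)" if y: "y \<in> V" for y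
  proof -
    have "\<kappa> y \<in> B" using \<kappa>B y by blast
    then have "Hilbert_Choice.inv (fderiv \<alpha> (\<kappa> y)) = N (\<kappa> y)"
      using N1 N2 by (intro inv_equality) auto
    then show ?thesis using inv(6,7)[OF y] app[OF \<open>\<kappa> y \<in> B\<close>] by simp
  qed
  have "Ck_on k V \<kappa>" for k
  proof (induction k)
    case 0
    then show ?case using inv(5) by (simp add: homeomorphism_def)
  next
    case (Suc k)
    have N\<kappa>: "Ck_on k V (\<lambda>y. N (\<kappa> y) v)" for v
      by (rule Ck_on_compose[OF inv(4) _ Suc \<kappa>B]) (use smN smooth_on_def in blast)
    show ?case by (rule Ck_on_SucI[OF inv(4) d\<kappa>]) (auto intro: N\<kappa>)
  qed
  then have "smooth_on V \<kappa>" using inv(4) by (simp add: smooth_on_def)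
  then show ?thesis using inv by blast
qed

section \<open>Monodromy\<close>

text \<open>Unlike the filter \<open>at x within S\<close>, this filter takes the point \<open>x\<close> itself into account.\<close>

abbreviation near :: "'a::topological_space set \<Rightarrow> 'a \<Rightarrow> 'a filter"
  where "near S x \<equiv> inf (nhds x) (principal S)"

lemma eventually_near: "eventually P (near S x) \<longleftrightarrow> (\<exists>U. open U \<and> x \<in> U \<and> (\<forall>y\<in>U \<inter> S. P y))"
  by (auto simp: eventually_inf_principal eventually_nhds)

lemma eventually_near_self: "eventually P (near S x) \<Longrightarrow> x \<in> S \<Longrightarrow> P x"
  by (auto simp: eventually_near)

lemma eventually_near_compose:
  assumes "continuous_on K k" "k ` K \<subseteq> M" "z \<in> K" "eventually P (near M (k z))"
  shows "eventually (\<lambda>z'. P (k z')) (near K z)"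
proof -
  obtain U where U: "open U" "k z \<in> U" "\<And>y. y \<in> U \<inter> M \<Longrightarrow> P y"
    using assms(4) by (auto simp: eventually_near)
  then obtain A where "open A" "z \<in> A" "\<forall>y\<in>K. y \<in> A \<longrightarrow> k y \<in> U"
    using assms(1,3) unfolding continuous_on_topological by metis
  then show ?thesis unfolding eventually_near using U(3) assms(2) by blast
qed

text \<open>The predicate \<open>Sol p \<sigma>\<close> says that \<open>\<sigma>\<close> solves a local problem near \<open>p\<close>.  The symmetries in \<open>G\<close>
  act transitively on the germs of solutions at a point and freely on their values.  The germs then form
  a covering space of \<open>M\<close>; a global solution is a section of it.\<close>

locale local_problem =
  fixes M :: "'m::topological_space set" and X :: "'x set" and G :: "('x \<Rightarrow> 'x) set"
    and Sol :: "'m \<Rightarrow> ('m \<Rightarrow> 'x) \<Rightarrow> bool"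
  assumes Sol_value: "p \<in> M \<Longrightarrow> Sol p \<sigma> \<Longrightarrow> \<sigma> p \<in> X"
    and Sol_near: "p \<in> M \<Longrightarrow> Sol p \<sigma> \<Longrightarrow> \<forall>\<^sub>F q in near M p. Sol q \<sigma>"
    and Sol_exists: "p \<in> M \<Longrightarrow> \<exists>\<sigma>. Sol p \<sigma>"
    and Sol_unique: "p \<in> M \<Longrightarrow> Sol p \<sigma> \<Longrightarrow> Sol p \<tau> \<Longrightarrow> \<exists>g\<in>G. \<forall>\<^sub>F q in near M p. \<tau> q = g (\<sigma> q)"
    and Sol_act: "p \<in> M \<Longrightarrow> g \<in> G \<Longrightarrow> Sol p \<sigma> \<Longrightarrow> Sol p (\<lambda>x. g (\<sigma> x))"
    and free: "g \<in> G \<Longrightarrow> h \<in> G \<Longrightarrow> x \<in> X \<Longrightarrow> g x = h x \<Longrightarrow> y \<in> X \<Longrightarrow> g y = h y"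
begin

text \<open>A lift along \<open>k\<close> is a continuation of solutions: near each point of \<open>K\<close> it is the pullback of
  a solution.  It is the substitute for a lift to the covering space of germs.\<close>

definition lift :: "'k::topological_space set \<Rightarrow> ('k \<Rightarrow> 'm) \<Rightarrow> ('k \<Rightarrow> 'x) \<Rightarrow> bool" where
  "lift K k u \<longleftrightarrow> continuous_on K k \<and> k ` K \<subseteq> M \<and>
     (\<forall>z\<in>K. \<exists>\<sigma>. Sol (k z) \<sigma> \<and> (\<forall>\<^sub>F z' in near K z. u z' = \<sigma> (k z')))"

lemma liftD:
  assumes "lift K k u" "z \<in> K"
  obtains \<sigma> where "Sol (k z) \<sigma>" "\<forall>\<^sub>F z' in near K z. u z' = \<sigma> (k z')" "u z = \<sigma> (k z)" "k z \<in> M"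
proof -
  obtain \<sigma> where "Sol (k z) \<sigma>" "\<forall>\<^sub>F z' in near K z. u z' = \<sigma> (k z')"
    using assms unfolding lift_def by blast
  moreover from this have "u z = \<sigma> (k z)"
    using assms(2) eventually_near_self by blast
  moreover have "k z \<in> M" using assms unfolding lift_def by blast
  ultimately show ?thesis using that by blast
qed

lemma lift_value: "lift K k u \<Longrightarrow> z \<in> K \<Longrightarrow> u z \<in> X"
  by (erule (1) liftD) (simp add: Sol_value)

lemma lift_near: "lift K k u \<Longrightarrow> z \<in> K \<Longrightarrow> eventually P (near M (k z)) \<Longrightarrow> \<forall>\<^sub>F z' in near K z. P (k z')"
  by (rule eventually_near_compose[of K k M]) (auto simp: lift_def)

lemma lift_unique_near:
  assumes "lift K k u" "lift K k v" "z \<in> K"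
  shows "\<exists>g\<in>G. \<forall>\<^sub>F z' in near K z. v z' = g (u z')"
proof -
  obtain \<sigma> where \<sigma>: "Sol (k z) \<sigma>" "\<forall>\<^sub>F z' in near K z. u z' = \<sigma> (k z')" "k z \<in> M"
    using liftD[OF assms(1,3)] by metis
  obtain \<tau> where \<tau>: "Sol (k z) \<tau>" "\<forall>\<^sub>F z' in near K z. v z' = \<tau> (k z')"
    using liftD[OF assms(2,3)] by metis
  obtain g where g: "g \<in> G" "\<forall>\<^sub>F q in near M (k z). \<tau> q = g (\<sigma> q)"
    using Sol_unique[OF \<sigma>(3,1) \<tau>(1)] by blast
  have "\<forall>\<^sub>F z' in near K z. \<tau> (k z') = g (\<sigma> (k z'))"
    using lift_near[OF assms(1,3) g(2)] .
  then have "\<forall>\<^sub>F z' in near K z. v z' = g (u z')"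
    using \<sigma>(2) \<tau>(2) by eventually_elim auto
  then show ?thesis using g(1) by blast
qed

text \<open>A symmetry is determined by its effect on a single value; hence the symmetry that relates two
  lifts is locally constant.\<close>

lemma lift_unique_connected:
  assumes "lift K k u" "lift K k v" "connected K" "z0 \<in> K" "g \<in> G" "v z0 = g (u z0)" "z \<in> K"
  shows "v z = g (u z)"
proof (rule connected_induction_simple[where P="\<lambda>z. v z = g (u z)" and a=z0 and b=z, OF assms(3,4,7,6)])
  fix a assume a: "a \<in> K"
  obtain g' where g': "g' \<in> G" "\<forall>\<^sub>F z' in near K a. v z' = g' (u z')"
    using lift_unique_near[OF assms(1,2) a] by blast
  then obtain U where U: "open U" "a \<in> U" "\<And>z. z \<in> U \<inter> K \<Longrightarrow> v z = g' (u z)"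
    by (auto simp: eventually_near)
  have "v y = g (u y)" if "x \<in> K \<inter> U" "y \<in> K \<inter> U" "v x = g (u x)" for x y
  proof -
    have "g (u x) = g' (u x)" using that U(3) by auto
    then have "g (u y) = g' (u y)"
      using free[OF assms(5) g'(1)] lift_value[OF assms(1)] that by blast
    then show ?thesis using U(3) that by auto
  qed
  then show "\<exists>T. openin (top_of_set K) T \<and> a \<in> T \<and> (\<forall>x\<in>T. \<forall>y\<in>T. v x = g (u x) \<longrightarrow> v y = g (u y))"
    using openin_open_Int[OF U(1), of K] U(2) a by blast
qed

lemma lift_agree:
  assumes "lift K k u" "lift K k v" "connected K" "z0 \<in> K" "v z0 = u z0" "z \<in> K"
  shows "v z = u z"
proof -
  obtain e where e: "e \<in> G" "\<forall>\<^sub>F z' in near K z0. u z' = e (u z')"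
    using lift_unique_near[OF assms(1,1,4)] by blast
  have e0: "u z0 = e (u z0)" using eventually_near_self[OF e(2) assms(4)] .
  have "u z = e (u z)" by (rule lift_unique_connected[OF assms(1,1,3,4) e(1) e0 assms(6)])
  moreover have "v z = e (u z)"
    by (rule lift_unique_connected[OF assms(1,2,3,4) e(1) _ assms(6)]) (use e0 assms(5) in simp)
  ultimately show ?thesis by simp
qed

lemma lift_act:
  assumes "lift K k u" "g \<in> G"
  shows "lift K k (\<lambda>z. g (u z))"
  unfolding lift_def
proof (intro conjI ballI)
  fix z assume z: "z \<in> K"
  obtain \<sigma> where \<sigma>: "Sol (k z) \<sigma>" "\<forall>\<^sub>F z' in near K z. u z' = \<sigma> (k z')" "k z \<in> M"
    using liftD[OF assms(1) z] by metis
  have "Sol (k z) (\<lambda>x. g (\<sigma> x))" using Sol_act[OF \<sigma>(3) assms(2) \<sigma>(1)] .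
  moreover have "\<forall>\<^sub>F z' in near K z. g (u z') = g (\<sigma> (k z'))"
    using \<sigma>(2) by eventually_elim auto
  ultimately show "\<exists>\<sigma>. Sol (k z) \<sigma> \<and> (\<forall>\<^sub>F z' in near K z. g (u z') = \<sigma> (k z'))"
    by (intro exI[of _ "\<lambda>x. g (\<sigma> x)"]) simp
qed (use assms(1) lift_def[of K k u] in auto)

lemma lift_reparametrize:
  assumes "lift K k u" "continuous_on L \<theta>" "\<theta> ` L \<subseteq> K"
    and eq: "\<And>z. z \<in> L \<Longrightarrow> k' z = k (\<theta> z)" "\<And>z. z \<in> L \<Longrightarrow> u' z = u (\<theta> z)"
  shows "lift L k' u'"
  unfolding lift_def
proof (intro conjI ballI)
  have "continuous_on L (\<lambda>z. k (\<theta> z))"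
    using assms(1-3) unfolding lift_def by (metis continuous_on_compose2)
  then show "continuous_on L k'" using eq(1) by (simp cong: continuous_on_cong)
  show "k' ` L \<subseteq> M" using assms(1,3) eq(1) unfolding lift_def by fastforce
  fix z assume z: "z \<in> L"
  then have \<theta>z: "\<theta> z \<in> K" using assms(3) by auto
  obtain \<sigma> where \<sigma>: "Sol (k (\<theta> z)) \<sigma>" "\<forall>\<^sub>F z' in near K (\<theta> z). u z' = \<sigma> (k z')"
    using liftD[OF assms(1) \<theta>z] by metis
  have "\<forall>\<^sub>F z' in near L z. u (\<theta> z') = \<sigma> (k (\<theta> z'))"
    using eventually_near_compose[OF assms(2,3) z \<sigma>(2)] .
  then have "\<forall>\<^sub>F z' in near L z. u' z' = \<sigma> (k' z')"
    using eq by (auto simp: eventually_inf_principal elim!: eventually_mono)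
  then show "\<exists>\<sigma>. Sol (k' z) \<sigma> \<and> (\<forall>\<^sub>F z' in near L z. u' z' = \<sigma> (k' z'))"
    using \<sigma>(1) eq(1)[OF z] by auto
qed

lemma lift_subset: "lift K k u \<Longrightarrow> L \<subseteq> K \<Longrightarrow> lift L k u"
  by (rule lift_reparametrize[where \<theta>="\<lambda>x. x"]) auto

lemma Sol_agree:
  assumes "p \<in> M" "Sol p \<sigma>" "Sol p \<tau>" "\<tau> p = \<sigma> p"
  shows "\<forall>\<^sub>F q in near M p. \<tau> q = \<sigma> q"
proof -
  obtain e where e: "e \<in> G" "\<forall>\<^sub>F q in near M p. \<sigma> q = e (\<sigma> q)"
    using Sol_unique[OF assms(1,2,2)] by blast
  obtain g where g: "g \<in> G" "\<forall>\<^sub>F q in near M p. \<tau> q = g (\<sigma> q)"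
    using Sol_unique[OF assms(1-3)] by blast
  have "e (\<sigma> p) = g (\<sigma> p)"
    using eventually_near_self[OF e(2) assms(1)] eventually_near_self[OF g(2) assms(1)] assms(4) by simp
  then have *: "e y = g y" if "y \<in> X" for y
    using free[OF e(1) g(1) Sol_value[OF assms(1,2)]] that by blast
  have "\<forall>\<^sub>F q in near M p. \<sigma> q \<in> X"
    using Sol_near[OF assms(1,2)] by (auto simp: eventually_inf_principal Sol_value elim!: eventually_mono)
  then show ?thesis using e(2) g(2) by eventually_elim (use * in auto)
qed

text \<open>A symmetry moves the second lift so that it agrees with the first one at one point of the
  connected intersection, and then on all of it.\<close>

lemma lift_glue:
  assumes k: "continuous_on (A \<union> B) k" and cl: "closed A" "closed B"
    and u: "lift A k u" and v: "lift B k v"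
    and con: "connected (A \<inter> B)" "A \<inter> B \<noteq> {}"
  shows "\<exists>w. lift (A \<union> B) k w \<and> (\<forall>z\<in>A. w z = u z)"
proof -
  obtain z0 where z0: "z0 \<in> A \<inter> B" using con(2) by blast
  have uI: "lift (A \<inter> B) k u" and vI: "lift (A \<inter> B) k v"
    using lift_subset u v by blast+
  obtain g where g: "g \<in> G" "\<forall>\<^sub>F z' in near (A \<inter> B) z0. u z' = g (v z')"
    using lift_unique_near[OF vI uI z0] by blast
  define v' where "v' z = g (v z)" for z
  have v': "lift B k v'" unfolding v'_def using lift_act[OF v g(1)] .
  have agree: "u z = v' z" if "z \<in> A \<inter> B" for z
    unfolding v'_def
    by (rule lift_unique_connected[OF vI uI con(1) z0 g(1) eventually_near_self[OF g(2) z0] that])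
  define w where "w z = (if z \<in> A then u z else v' z)" for z
  have wA: "w z = u z" if "z \<in> A" for z using that by (simp add: w_def)
  have wB: "w z = v' z" if "z \<in> B" for z using that agree by (auto simp: w_def)
  have kM: "k ` (A \<union> B) \<subseteq> M" using u v unfolding lift_def by blast
  have "\<exists>\<sigma>. Sol (k z) \<sigma> \<and> (\<forall>\<^sub>F z' in near (A \<union> B) z. w z' = \<sigma> (k z'))" if z: "z \<in> A \<union> B" for z
  proof -
    have notin: "\<forall>\<^sub>F z' in nhds z. z' \<notin> C" if "closed C" "z \<notin> C" for C
      using eventually_nhds_in_open[of "- C" z] that by (auto simp: open_Compl)
    have A: "\<exists>\<sigma>. Sol (k z) \<sigma> \<and> w z = \<sigma> (k z) \<and> (\<forall>\<^sub>F z' in nhds z. z' \<in> A \<longrightarrow> w z' = \<sigma> (k z'))" if zA: "z \<in> A"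
    proof -
      obtain \<sigma> where \<sigma>: "Sol (k z) \<sigma>" "\<forall>\<^sub>F z' in near A z. u z' = \<sigma> (k z')" "u z = \<sigma> (k z)"
        using liftD[OF u zA] by metis
      then have "\<forall>\<^sub>F z' in nhds z. z' \<in> A \<longrightarrow> w z' = \<sigma> (k z')"
        by (simp add: eventually_inf_principal wA cong: imp_cong)
      then show ?thesis using \<sigma> wA[OF zA] by auto
    qed
    have B: "\<exists>\<sigma>. Sol (k z) \<sigma> \<and> w z = \<sigma> (k z) \<and> (\<forall>\<^sub>F z' in nhds z. z' \<in> B \<longrightarrow> w z' = \<sigma> (k z'))" if zB: "z \<in> B"
    proof -
      obtain \<sigma> where \<sigma>: "Sol (k z) \<sigma>" "\<forall>\<^sub>F z' in near B z. v' z' = \<sigma> (k z')" "v' z = \<sigma> (k z)"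
        using liftD[OF v' zB] by metis
      then have "\<forall>\<^sub>F z' in nhds z. z' \<in> B \<longrightarrow> w z' = \<sigma> (k z')"
        by (simp add: eventually_inf_principal wB cong: imp_cong)
      then show ?thesis using \<sigma> wB[OF zB] by auto
    qed
    consider "z \<in> A" "z \<notin> B" | "z \<in> B" "z \<notin> A" | "z \<in> A" "z \<in> B" using z by blast
    then show ?thesis
    proof cases
      case 1
      then obtain \<sigma> where \<sigma>: "Sol (k z) \<sigma>" "\<forall>\<^sub>F z' in nhds z. z' \<in> A \<longrightarrow> w z' = \<sigma> (k z')"
        using A by blast
      have "\<forall>\<^sub>F z' in nhds z. z' \<in> A \<union> B \<longrightarrow> w z' = \<sigma> (k z')"
        using \<sigma>(2) notin[OF cl(2) 1(2)] by eventually_elim auto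
      then show ?thesis using \<sigma>(1) by (auto simp: eventually_inf_principal)
    next
      case 2
      then obtain \<sigma> where \<sigma>: "Sol (k z) \<sigma>" "\<forall>\<^sub>F z' in nhds z. z' \<in> B \<longrightarrow> w z' = \<sigma> (k z')"
        using B by blast
      have "\<forall>\<^sub>F z' in nhds z. z' \<in> A \<union> B \<longrightarrow> w z' = \<sigma> (k z')"
        using \<sigma>(2) notin[OF cl(1) 2(2)] by eventually_elim auto
      then show ?thesis using \<sigma>(1) by (auto simp: eventually_inf_principal)
    next
      case 3
      obtain \<sigma> where \<sigma>: "Sol (k z) \<sigma>" "w z = \<sigma> (k z)" "\<forall>\<^sub>F z' in nhds z. z' \<in> A \<longrightarrow> w z' = \<sigma> (k z')"
        using A 3 by blast
      obtain \<tau> where \<tau>: "Sol (k z) \<tau>" "w z = \<tau> (k z)" "\<forall>\<^sub>F z' in nhds z. z' \<in> B \<longrightarrow> w z' = \<tau> (k z')"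
        using B 3 by blast
      have kz: "k z \<in> M" using kM z by blast
      have "\<forall>\<^sub>F q in near M (k z). \<tau> q = \<sigma> q"
        by (rule Sol_agree[OF kz \<sigma>(1) \<tau>(1)]) (use \<sigma>(2) \<tau>(2) in simp)
      then have "\<forall>\<^sub>F z' in near (A \<union> B) z. \<tau> (k z') = \<sigma> (k z')"
        using eventually_near_compose[OF k kM z] by blast
      then have "\<forall>\<^sub>F z' in nhds z. z' \<in> A \<union> B \<longrightarrow> \<tau> (k z') = \<sigma> (k z')"
        by (simp add: eventually_inf_principal)
      then have "\<forall>\<^sub>F z' in nhds z. z' \<in> A \<union> B \<longrightarrow> w z' = \<sigma> (k z')"
        using \<sigma>(3) \<tau>(3) by eventually_elim auto
      then show ?thesis using \<sigma>(1) by (auto simp: eventually_inf_principal)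
    qed
  qed
  then have "lift (A \<union> B) k w" unfolding lift_def using k kM by blast
  then show ?thesis using wA by blast
qed

text \<open>Bisection in one variable yields lifts on thin strips around each horizontal segment, and bisection
  in the other variable glues the strips.\<close>

lemma lift_exists_plane:
  fixes k :: "real \<times> real \<Rightarrow> 'm"
  assumes k: "continuous_on UNIV k" "range k \<subseteq> M" and ab: "a \<le> b" "c \<le> d"
  shows "\<exists>u. lift ({a..b} \<times> {c..d}) k u"
proof -
  have kS: "continuous_on S k" for S using k(1) continuous_on_subset by blast
  have strip: "\<exists>\<delta>>0. \<forall>c d. c \<le> y \<and> y \<le> d \<and> d - c < \<delta> \<longrightarrow> (\<exists>u. lift ({a..b} \<times> {c..d}) k u)"
    for y
    using ab(1)
  proof (induction a b rule: Bolzano)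
    case (trans a1 a2 a3)
    obtain \<delta>1 where d1: "\<delta>1 > 0" "\<forall>c d. c \<le> y \<and> y \<le> d \<and> d - c < \<delta>1 \<longrightarrow> (\<exists>u. lift ({a1..a2} \<times> {c..d}) k u)"
      using trans by blast
    obtain \<delta>2 where d2: "\<delta>2 > 0" "\<forall>c d. c \<le> y \<and> y \<le> d \<and> d - c < \<delta>2 \<longrightarrow> (\<exists>u. lift ({a2..a3} \<times> {c..d}) k u)"
      using trans by blast
    have "\<exists>u. lift ({a1..a3} \<times> {c..d}) k u" if cd: "c \<le> y \<and> y \<le> d \<and> d - c < min \<delta>1 \<delta>2" for c d
    proof -
      have un: "{a1..a3} \<times> {c..d} = {a1..a2} \<times> {c..d} \<union> {a2..a3} \<times> {c..d}"
        using trans by auto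
      have int: "({a1..a2} \<times> {c..d}) \<inter> ({a2..a3} \<times> {c..d}) = {a2..a2} \<times> {c..d}"
        using trans by auto
      obtain u v where uv: "lift ({a1..a2} \<times> {c..d}) k u" "lift ({a2..a3} \<times> {c..d}) k v"
        using d1(2) d2(2) cd by fastforce
      show ?thesis unfolding un
        using lift_glue[OF kS _ _ uv, unfolded int] cd
        by (auto simp: closed_Times connected_Times)
    qed
    then show ?case using d1(1) d2(1) by (intro exI[of _ "min \<delta>1 \<delta>2"]) auto
  next
    case (local x)
    have "k (x, y) \<in> M" using k by auto
    then obtain \<sigma> where \<sigma>: "Sol (k (x, y)) \<sigma>" using Sol_exists by blast
    have "\<forall>\<^sub>F z in near UNIV (x, y). Sol (k z) \<sigma>"
      using eventually_near_compose[OF k(1,2) _ Sol_near[OF _ \<sigma>]] \<open>k (x, y) \<in> M\<close> by simp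
    then have "\<forall>\<^sub>F z in nhds x \<times>\<^sub>F nhds y. Sol (k z) \<sigma>"
      by (simp add: nhds_prod)
    then obtain P Q where P: "eventually P (nhds x)" and Q: "eventually Q (nhds y)"
      and PQ: "\<And>x y. P x \<Longrightarrow> Q y \<Longrightarrow> Sol (k (x, y)) \<sigma>"
      unfolding eventually_prod_filter by blast
    obtain r where r: "r > 0" "\<And>x'. dist x' x < r \<Longrightarrow> P x'"
      using P unfolding eventually_nhds_metric by blast
    obtain s where s: "s > 0" "\<And>y'. dist y' y < s \<Longrightarrow> Q y'"
      using Q unfolding eventually_nhds_metric by blast
    have "\<exists>u. lift ({a..b} \<times> {c..d}) k u" if "a \<le> x \<and> x \<le> b \<and> b - a < r" "c \<le> y \<and> y \<le> d \<and> d - c < s"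
      for a b c d
    proof -
      have "Sol (k z) \<sigma>" if z: "z \<in> {a..b} \<times> {c..d}" for z
        using z that PQ[OF r(2) s(2)] \<open>a \<le> x \<and> x \<le> b \<and> b - a < r\<close> \<open>c \<le> y \<and> y \<le> d \<and> d - c < s\<close>
        by (cases z) (auto simp: dist_real_def)
      then have "lift ({a..b} \<times> {c..d}) k (\<lambda>z. \<sigma> (k z))"
        unfolding lift_def using kS k(2) by (auto intro!: exI[of _ \<sigma>])
      then show ?thesis by blast
    qed
    then show ?case using r(1) s(1) by blast
  qed
  show ?thesis
    using ab(2)
  proof (induction c d rule: Bolzano)
    case (trans c1 c2 c3)
    have un: "{a..b} \<times> {c1..c3} = {a..b} \<times> {c1..c2} \<union> {a..b} \<times> {c2..c3}"
      using trans by auto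
    have int: "({a..b} \<times> {c1..c2}) \<inter> ({a..b} \<times> {c2..c3}) = {a..b} \<times> {c2..c2}"
      using trans by auto
    obtain u v where uv: "lift ({a..b} \<times> {c1..c2}) k u" "lift ({a..b} \<times> {c2..c3}) k v"
      using trans by blast
    show ?case unfolding un
      using lift_glue[OF kS _ _ uv, unfolded int] ab(1)
      by (auto simp: closed_Times connected_Times)
  next
    case (local y)
    then show ?case using strip[of y] by blast
  qed
qed

lemma lift_exists_square:
  fixes k :: "real \<times> real \<Rightarrow> 'm"
  assumes k: "continuous_on ({0..1} \<times> {0..1}) k" "k ` ({0..1} \<times> {0..1}) \<subseteq> M"
  shows "\<exists>u. lift ({0..1} \<times> {0..1}) k u"
proof -
  \<comment> \<open>the retraction of the plane onto the square\<close>
  define c where "c z = (max 0 (min 1 (fst z)), max 0 (min 1 (snd z)))" for z :: "real \<times> real"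
  have c: "continuous_on UNIV c" "range c \<subseteq> {0..1} \<times> {0..1}" "\<And>z. z \<in> {0..1} \<times> {0..1} \<Longrightarrow> c z = z"
    unfolding c_def by (auto intro!: continuous_intros)
  have "\<exists>u. lift ({0..1} \<times> {0..1}) (\<lambda>z. k (c z)) u"
  proof (rule lift_exists_plane)
    show "continuous_on UNIV (\<lambda>z. k (c z))" using continuous_on_compose2[OF k(1) c(1,2)] .
    show "range (\<lambda>z. k (c z)) \<subseteq> M" using k(2) c(2) by blast
  qed auto
  then obtain u where "lift ({0..1} \<times> {0..1}) (\<lambda>z. k (c z)) u" by blast
  then have "lift ({0..1} \<times> {0..1}) k u"
    by (rule lift_reparametrize[where \<theta>="\<lambda>z. z"]) (auto simp: c(3))
  then show ?thesis by blast
qed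

lemma lift_normalize:
  assumes "lift K k u" "z \<in> K" "Sol (k z) \<sigma>"
  shows "\<exists>u'. lift K k u' \<and> u' z = \<sigma> (k z)"
proof -
  obtain \<tau> where \<tau>: "Sol (k z) \<tau>" "u z = \<tau> (k z)" "k z \<in> M"
    using liftD[OF assms(1,2)] by metis
  obtain g where g: "g \<in> G" "\<forall>\<^sub>F q in near M (k z). \<sigma> q = g (\<tau> q)"
    using Sol_unique[OF \<tau>(3,1) assms(3)] by blast
  show ?thesis
    using lift_act[OF assms(1) g(1)] eventually_near_self[OF g(2) \<tau>(3)] \<tau>(2) by auto
qed

lemma lift_exists_path:
  assumes "path \<gamma>" "path_image \<gamma> \<subseteq> M" "Sol (pathstart \<gamma>) \<sigma>"
  shows "\<exists>u. lift {0..1} \<gamma> u \<and> u 0 = \<sigma> (pathstart \<gamma>)"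
proof -
  have "\<exists>u. lift ({0..1} \<times> {0..1}) (\<lambda>z::real \<times> real. \<gamma> (fst z)) u"
  proof (rule lift_exists_square)
    show "continuous_on ({0..1} \<times> {0..1}) (\<lambda>z::real \<times> real. \<gamma> (fst z))"
      using assms(1) unfolding path_def
      by (rule continuous_on_compose2) (auto intro!: continuous_intros)
    show "(\<lambda>z::real \<times> real. \<gamma> (fst z)) ` ({0..1} \<times> {0..1}) \<subseteq> M"
      using assms(2) unfolding path_image_def by auto
  qed
  then obtain u where "lift ({0..1} \<times> {0..1}) (\<lambda>z::real \<times> real. \<gamma> (fst z)) u" by blast
  then have "lift {0..1} \<gamma> (\<lambda>t. u (t, 0))"
    by (rule lift_reparametrize[where \<theta>="\<lambda>t. (t, 0)"]) (auto intro!: continuous_intros)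
  from lift_normalize[OF this, of 0] show ?thesis using assms(3) by (auto simp: pathstart_def)
qed

lemma lift_const:
  assumes "p \<in> M" "Sol p \<sigma>"
  shows "lift K (\<lambda>t. p) (\<lambda>t. \<sigma> p)"
  unfolding lift_def using assms by auto

text \<open>In the lift of a free homotopy to a constant loop, the two edges traced by the base point are lifts
  of the same path.  They agree where the loop has become constant, hence also at the given loop.\<close>

lemma lift_loop_closed:
  assumes h: "homotopic_loops M l (\<lambda>t. p0)" and u: "lift {0..1} l u"
  shows "u 1 = u 0"
proof -
  obtain H where H: "continuous_on ({0..1::real} \<times> {0..1}) H" "H \<in> ({0..1} \<times> {0..1}) \<rightarrow> M"
    "\<forall>x\<in>{0..1}. H (0, x) = l x" "\<forall>x\<in>{0..1}. H (1, x) = p0"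
    "\<forall>t\<in>{0..1}. pathfinish (H \<circ> Pair t) = pathstart (H \<circ> Pair t)"
    using h unfolding homotopic_loops by metis
  obtain U0 where U0: "lift ({0..1} \<times> {0..1}) H U0"
    using lift_exists_square[OF H(1)] H(2) by blast
  obtain \<sigma> where \<sigma>: "Sol (l 0) \<sigma>" "u 0 = \<sigma> (l 0)"
    using liftD[OF u, of 0] by auto
  obtain U where U: "lift ({0..1} \<times> {0..1}) H U" "U (0, 0) = u 0"
    using lift_normalize[OF U0, of "(0, 0)" \<sigma>] \<sigma> H(3) by auto
  have left: "lift {0..1} l (\<lambda>t. U (0, t))"
    by (rule lift_reparametrize[OF U(1), where \<theta>="\<lambda>t. (0, t)"]) (use H in \<open>auto intro!: continuous_intros\<close>)
  have "u 1 = U (0, 1)"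
    by (rule lift_agree[OF left u, of 0]) (auto simp: U(2))
  also have "U (0, 1) = U (0, 0)"
  proof -
    have right: "lift {0..1} (\<lambda>t. p0) (\<lambda>t. U (1, t))"
      by (rule lift_reparametrize[OF U(1), where \<theta>="\<lambda>t. (1, t)"]) (use H in \<open>auto intro!: continuous_intros\<close>)
    obtain \<tau> where \<tau>: "Sol p0 \<tau>" "U (1, 0) = \<tau> p0" "p0 \<in> M"
      using liftD[OF right, of 0] by auto
    have "U (1, 1) = \<tau> p0"
      by (rule lift_agree[OF lift_const[OF \<tau>(3,1)] right, of 0]) (use \<tau>(2) in auto)
    then have 1: "U (1, 1) = U (1, 0)" using \<tau>(2) by simp
    have bot: "lift {0..1} (\<lambda>x. H (x, 0)) (\<lambda>x. U (x, 0))"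
      by (rule lift_reparametrize[OF U(1), where \<theta>="\<lambda>x. (x, 0)"]) (auto intro!: continuous_intros)
    have top: "lift {0..1} (\<lambda>x. H (x, 0)) (\<lambda>x. U (x, 1))"
      by (rule lift_reparametrize[OF U(1), where \<theta>="\<lambda>x. (x, 1)"])
        (use H(5) in \<open>auto intro!: continuous_intros simp: pathfinish_def pathstart_def\<close>)
    show ?thesis by (rule lift_agree[OF bot top, of 1]) (use 1 in auto)
  qed
  finally show ?thesis using U(2) by simp
qed

text \<open>The lift of the loop that runs along the first path and back along the second one is closed.\<close>

lemma lift_endpoint_unique:
  fixes \<gamma>1 \<gamma>2 :: "real \<Rightarrow> 'm"
  assumes M: "simply_connected M"
    and 1: "lift {0..1} \<gamma>1 u1" "\<gamma>1 0 = p" "\<gamma>1 1 = q"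
    and 2: "lift {0..1} \<gamma>2 u2" "\<gamma>2 0 = p" "\<gamma>2 1 = q"
    and start: "u1 0 = u2 0"
  shows "u1 1 = u2 1"
proof -
  define l where "l = \<gamma>1 +++ reversepath \<gamma>2"
  have p1: "path \<gamma>1" "path_image \<gamma>1 \<subseteq> M" and p2: "path \<gamma>2" "path_image \<gamma>2 \<subseteq> M"
    using 1(1) 2(1) by (auto simp: lift_def path_def path_image_def)
  have pl: "path l" "path_image l \<subseteq> M" "pathstart l = p" "pathfinish l = p"
  proof -
    have e: "pathstart \<gamma>1 = p" "pathfinish \<gamma>1 = q" "pathstart \<gamma>2 = p" "pathfinish \<gamma>2 = q"
      using 1 2 by (auto simp: pathfinish_def pathstart_def)
    show "path l" "path_image l \<subseteq> M" "pathstart l = p" "pathfinish l = p"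
      unfolding l_def using p1 p2 e by (simp_all add: path_image_join)
  qed
  have p: "p \<in> M" using p1 1(2) by (auto simp: path_image_def)
  have hom: "homotopic_loops M l (\<lambda>t. p)"
    using M[unfolded simply_connected_def, rule_format, of l "\<lambda>t. p"] pl p
    by (simp add: pathfinish_def pathstart_def path_def path_image_def image_subset_iff)
  obtain \<sigma> where \<sigma>: "Sol p \<sigma>" "u1 0 = \<sigma> p" using liftD[OF 1(1), of 0] 1(2) by auto
  obtain u where u: "lift {0..1} l u" "u 0 = \<sigma> p"
    using lift_exists_path[OF pl(1,2)] \<sigma> pl(3) by auto
  have u01: "u 1 = u 0" by (rule lift_loop_closed[OF hom u(1)])
  have half1: "lift {0..1} \<gamma>1 (\<lambda>t. u (t / 2))"
    by (rule lift_reparametrize[OF u(1), where \<theta>="\<lambda>t. t / 2"])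
       (auto simp: l_def joinpaths_def intro!: continuous_intros)
  have "u1 1 = u (1 / 2)"
    by (rule lift_agree[OF half1 1(1), of 0]) (use u \<sigma> in auto)
  moreover have half2: "lift {0..1} \<gamma>2 (\<lambda>t. u (1 - t / 2))"
    by (rule lift_reparametrize[OF u(1), where \<theta>="\<lambda>t. 1 - t / 2"])
       (use 1 2 in \<open>auto simp: l_def joinpaths_def reversepath_def intro!: continuous_intros\<close>)
  have "u2 1 = u (1 - 1 / 2)"
    by (rule lift_agree[OF half2 2(1), of 0]) (use u u01 \<sigma> start in auto)
  ultimately show ?thesis by simp
qed

text \<open>The value of the global solution at \<open>p\<close> is the end value of the continuation along any path from a
  base point to \<open>p\<close>.\<close>

theorem monodromy:
  assumes M: "simply_connected M" and loc: "locally path_connected M"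
  shows "\<exists>u. \<forall>p\<in>M. \<exists>\<sigma>. Sol p \<sigma> \<and> (\<forall>\<^sub>F q in near M p. u q = \<sigma> q)"
proof (cases "M = {}")
  case False
  then obtain p0 where p0: "p0 \<in> M" by blast
  obtain \<sigma>0 where \<sigma>0: "Sol p0 \<sigma>0" using Sol_exists[OF p0] by blast
  have conn: "\<exists>\<gamma>. path \<gamma> \<and> path_image \<gamma> \<subseteq> M \<and> \<gamma> 0 = p0 \<and> \<gamma> 1 = p" if p: "p \<in> M" for p
  proof -
    have "homotopic_loops M (\<lambda>t. p0) (\<lambda>t. p)"
      using M[unfolded simply_connected_def, rule_format, of "\<lambda>t. p0" "\<lambda>t. p"] p p0
      by (simp add: pathfinish_def pathstart_def path_def path_image_def image_subset_iff)
    then obtain H where H: "continuous_on ({0..1::real} \<times> {0..1::real}) H" "H \<in> ({0..1} \<times> {0..1}) \<rightarrow> M"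
      "\<forall>x\<in>{0..1}. H (0, x) = p0" "\<forall>x\<in>{0..1}. H (1, x) = p"
      unfolding homotopic_loops by metis
    have "continuous_on {0..1} (\<lambda>t. H (t, 0))"
      by (rule continuous_on_compose2[OF H(1)]) (auto intro!: continuous_intros)
    then show ?thesis
      using H by (intro exI[of _ "\<lambda>t. H (t, 0)"]) (auto simp: path_def path_image_def)
  qed
  define R where "R p x \<longleftrightarrow> (\<exists>\<gamma> u. lift {0..1::real} \<gamma> u \<and> \<gamma> 0 = p0 \<and> \<gamma> 1 = p \<and> u 0 = \<sigma>0 p0 \<and> u 1 = x)" for p x
  have R_ex: "\<exists>x. R p x" if pM: "p \<in> M" for p
  proof -
    obtain \<gamma> where \<gamma>: "path \<gamma>" "path_image \<gamma> \<subseteq> M" "\<gamma> 0 = p0" "\<gamma> 1 = p" using conn[OF pM] by blast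
    then obtain u where "lift {0..1} \<gamma> u" "u 0 = \<sigma>0 p0"
      using lift_exists_path[OF \<gamma>(1,2), of \<sigma>0] \<sigma>0 by (auto simp: pathstart_def)
    then show ?thesis unfolding R_def using \<gamma> by blast
  qed
  have R_unique: "x = y" if "R p x" "R p y" for p x y
    using that unfolding R_def by (metis lift_endpoint_unique[OF M])
  define u where "u p = (SOME x. R p x)" for p
  have Ru: "R p (u p)" if "p \<in> M" for p unfolding u_def using R_ex[OF that] by (rule someI_ex)
  have "\<exists>\<sigma>. Sol p \<sigma> \<and> (\<forall>\<^sub>F q in near M p. u q = \<sigma> q)" if p: "p \<in> M" for p
  proof -
    obtain \<gamma> w where \<gamma>: "lift {0..1::real} \<gamma> w" "\<gamma> 0 = p0" "\<gamma> 1 = p" "w 0 = \<sigma>0 p0" "w 1 = u p"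
      using Ru[OF p] unfolding R_def by blast
    obtain \<tau> where \<tau>: "Sol p \<tau>" "w 1 = \<tau> p" using liftD[OF \<gamma>(1), of 1] \<gamma>(3) by auto
    obtain U where U: "open U" "p \<in> U" "\<And>q. q \<in> U \<inter> M \<Longrightarrow> Sol q \<tau>"
      using Sol_near[OF p \<tau>(1)] by (auto simp: eventually_near)
    obtain V W where V: "openin (top_of_set M) V" "path_connected W" "p \<in> V" "V \<subseteq> W" "W \<subseteq> M \<inter> U"
      using loc U(1,2) p unfolding locally_def by (metis IntI openin_open_Int)
    have "u q = \<tau> q" if q: "q \<in> V" for q
    proof -
      obtain \<beta> where \<beta>: "path \<beta>" "path_image \<beta> \<subseteq> W" "pathstart \<beta> = p" "pathfinish \<beta> = q"
        using V q unfolding path_connected_def by blast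
      define \<delta> where "\<delta> = \<gamma> +++ \<beta>"
      have p\<gamma>: "path \<gamma>" using \<gamma>(1) by (auto simp: lift_def path_def)
      have p\<delta>: "path \<delta>" unfolding \<delta>_def using p\<gamma> \<beta> \<gamma>(3) by (intro path_join_imp) (auto simp: pathfinish_def)
      have \<beta>W: "\<beta> t \<in> W" if "t \<in> {0..1}" for t using \<beta>(2) that by (auto simp: path_image_def)
      have \<delta>1: "\<delta> t = \<gamma> (2 * t)" if "t \<in> {0..1/2}" for t using that by (simp add: \<delta>_def joinpaths_def)
      have \<delta>2: "\<delta> t = \<beta> (2 * t - 1)" if "t \<in> {1/2..1}" for t
      proof (cases "t = 1/2")
        case True
        then show ?thesis using \<beta>(3) \<gamma>(3) unfolding True by (simp add: \<delta>_def joinpaths_def pathstart_def)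
      next
        case False
        then show ?thesis using that by (auto simp: \<delta>_def joinpaths_def)
      qed
      have l1: "lift {0..1/2} \<delta> (\<lambda>t. w (2 * t))"
        by (rule lift_reparametrize[OF \<gamma>(1), where \<theta>="\<lambda>t. 2 * t"])
          (auto simp: \<delta>1 intro!: continuous_intros)
      have l\<beta>: "lift {0..1} \<beta> (\<lambda>t. \<tau> (\<beta> t))"
        unfolding lift_def using \<beta>(1) \<beta>W V(5) U(3) by (fastforce simp: path_def)
      have l2: "lift {1/2..1} \<delta> (\<lambda>t. \<tau> (\<beta> (2 * t - 1)))"
        by (rule lift_reparametrize[OF l\<beta>, where \<theta>="\<lambda>t. 2 * t - 1"])
          (auto simp: \<delta>2 intro!: continuous_intros)
      have un: "{0..1/2} \<union> {1/2..1} = {0..1::real}" "{0..1/2} \<inter> {1/2..1} = {1/2::real}" by auto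
      obtain v where v: "lift {0..1} \<delta> v" "\<And>t. t \<in> {0..1/2} \<Longrightarrow> v t = w (2 * t)"
        using lift_glue[OF _ _ _ l1 l2] p\<delta> unfolding un path_def by auto
      have "v 1 = \<tau> (\<beta> (2 * 1 - 1))"
      proof (rule lift_agree[OF l2 lift_subset[OF v(1)], of "1/2"])
        show "v (1/2) = \<tau> (\<beta> (2 * (1/2) - 1))" using v(2)[of "1/2"] \<tau>(2) \<beta>(3) by (simp add: pathstart_def)
      qed auto
      then have "v 1 = \<tau> q" using \<beta>(4) by (simp add: pathfinish_def)
      moreover have "\<delta> 0 = p0" "\<delta> 1 = q" "v 0 = \<sigma>0 p0"
        using \<delta>1[of 0] \<delta>2[of 1] v(2)[of 0] \<gamma> \<beta>(4) by (auto simp: pathfinish_def)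
      ultimately have "R q (\<tau> q)" unfolding R_def using v(1) by blast
      then show ?thesis using R_unique Ru V q by blast
    qed
    moreover obtain T where "open T" "V = M \<inter> T" using V(1) by (auto simp: openin_open)
    ultimately have "\<forall>\<^sub>F q in near M p. u q = \<tau> q"
      unfolding eventually_near using V(3) by (intro exI[of _ T]) auto
    then show ?thesis using \<tau>(1) by blast
  qed
  then show ?thesis by blast
qed auto

end

section \<open>Conformal maps\<close>

lemma lorentz_linear_sigma:
  assumes "linear L" "\<And>h. L (lsigma * h) = lsigma * L h"
  shows "L h = L 1 * (h :: lorentz)"
proof -
  have h: "h = lRe h *\<^sub>R 1 + lIm h *\<^sub>R (lsigma * 1)" by (simp add: lorentz_eq_iff)
  have "L h = lRe h *\<^sub>R L 1 + lIm h *\<^sub>R (lsigma * L 1)"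
    by (subst h) (simp only: linear_add[OF assms(1)] linear_cmul[OF assms(1)] assms(2))
  then show ?thesis by (simp add: lorentz_eq_iff algebra_simps)
qed

lemma conformal_on_has_derivative:
  assumes "conformal_on S \<psi>" "x \<in> S"
  shows "(\<psi> has_derivative (\<lambda>h. fderiv \<psi> x 1 * h)) (at x)"
proof -
  have sm: "smooth_on S \<psi>" and c: "\<And>h. fderiv \<psi> x (lsigma * h) = lsigma * fderiv \<psi> x h"
    using assms by (auto simp: conformal_on_def)
  have "fderiv \<psi> x = (\<lambda>h. fderiv \<psi> x 1 * h)"
    using lorentz_linear_sigma[OF smooth_on_linear_fderiv[OF sm assms(2)] c] by blast
  then show ?thesis using smooth_on_has_derivative[OF sm assms(2)] by metis
qed

lemma conformal_onI:
  assumes "smooth_on S \<psi>" "\<And>x. x \<in> S \<Longrightarrow> \<exists>d. (\<psi> has_derivative (\<lambda>h. d * h)) (at x)"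
  shows "conformal_on S \<psi>"
  unfolding conformal_on_def
proof (intro conjI ballI allI assms(1))
  fix x h assume "x \<in> S"
  then obtain d where "(\<psi> has_derivative (\<lambda>h. d * h)) (at x)" using assms(2) by blast
  then have "fderiv \<psi> x = (\<lambda>h. d * h)" by (rule fderiv_eqI)
  then show "fderiv \<psi> x (lsigma * h) = lsigma * fderiv \<psi> x h" by (simp add: mult.left_commute)
qed

lemma conformal_on_smooth_on: "conformal_on S \<psi> \<Longrightarrow> smooth_on S \<psi>"
  by (simp add: conformal_on_def)

lemma conformal_on_subset: "conformal_on S \<psi> \<Longrightarrow> open T \<Longrightarrow> T \<subseteq> S \<Longrightarrow> conformal_on T \<psi>"
  unfolding conformal_on_def using smooth_on_subset by blast

lemma conformal_on_cong:
  assumes "conformal_on S f" "\<And>x. x \<in> S \<Longrightarrow> f x = g x"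
  shows "conformal_on S g"
proof -
  have op: "open S" using assms(1) conformal_on_smooth_on smooth_on_open by blast
  have "fderiv f x = fderiv g x" if "x \<in> S" for x
    by (rule fderiv_cong_open[OF op that assms(2)])
  then show ?thesis
    using assms smooth_on_cong[of S f g] unfolding conformal_on_def by simp
qed

lemma conformal_on_mult:
  assumes "conformal_on S f" "conformal_on S g"
  shows "conformal_on S (\<lambda>x. f x * g x)"
proof (rule conformal_onI)
  show "smooth_on S (\<lambda>x. f x * g x)"
    using assms conformal_on_smooth_on smooth_on_ltimes by blast
  fix x assume "x \<in> S"
  then have "((\<lambda>x. f x * g x) has_derivative (\<lambda>h. f x * (fderiv g x 1 * h) + (fderiv f x 1 * h) * g x)) (at x)"
    using bounded_bilinear.FDERIV[OF bounded_bilinear_ltimes conformal_on_has_derivative[OF assms(1)]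
        conformal_on_has_derivative[OF assms(2)]] by blast
  moreover have "(\<lambda>h. f x * (fderiv g x 1 * h) + (fderiv f x 1 * h) * g x)
      = (\<lambda>h. (f x * fderiv g x 1 + fderiv f x 1 * g x) * h)"
    by (simp add: fun_eq_iff algebra_simps)
  ultimately show "\<exists>d. ((\<lambda>x. f x * g x) has_derivative (\<lambda>h. d * h)) (at x)" by metis
qed

lemma conformal_on_add:
  assumes "conformal_on S f" "conformal_on S g"
  shows "conformal_on S (\<lambda>x. f x + g x)"
proof (rule conformal_onI)
  show "smooth_on S (\<lambda>x. f x + g x)"
    using assms conformal_on_smooth_on smooth_on_add by blast
  fix x assume "x \<in> S"
  then have "((\<lambda>x. f x + g x) has_derivative (\<lambda>h. fderiv f x 1 * h + fderiv g x 1 * h)) (at x)"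
    using has_derivative_add conformal_on_has_derivative assms by blast
  then show "\<exists>d. ((\<lambda>x. f x + g x) has_derivative (\<lambda>h. d * h)) (at x)"
    by (metis (no_types, lifting) distrib_right ext)
qed

lemma conformal_on_minus:
  assumes "conformal_on S f"
  shows "conformal_on S (\<lambda>x. - f x)"
proof (rule conformal_onI)
  show "smooth_on S (\<lambda>x. - f x)"
    using assms conformal_on_smooth_on smooth_on_minus by blast
  fix x assume "x \<in> S"
  then have "((\<lambda>x. - f x) has_derivative (\<lambda>h. - (fderiv f x 1 * h))) (at x)"
    using has_derivative_minus conformal_on_has_derivative assms by blast
  then show "\<exists>d. ((\<lambda>x. - f x) has_derivative (\<lambda>h. d * h)) (at x)"
    by (intro exI[of _ "- fderiv f x 1"]) simp
qed

lemma conformal_on_id: "open S \<Longrightarrow> conformal_on S (\<lambda>x. x)"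
  by (rule conformal_onI) (auto intro!: smooth_on_id exI[of _ 1])

text \<open>For conformal \<open>G\<close> with derivative \<open>G'\<close> the derivative \<open>G' k h\<close> of \<open>G h\<close> in direction \<open>k\<close> is symmetric
  in \<open>h\<close> and \<open>k\<close>, so \<open>G da\<close> is closed.\<close>

lemma conformal_primitive:
  assumes G: "conformal_on S G" and S: "convex S"
  shows "\<exists>P. \<forall>x\<in>S. (P has_derivative (\<lambda>h. G x * h)) (at x)"
proof (rule poincare_lemma[where \<omega>'="\<lambda>x h k. fderiv G x 1 * k * h"])
  have sm: "smooth_on S G" using G conformal_on_smooth_on by blast
  show "open S" using sm smooth_on_open by blast
  show "linear (\<lambda>h. G x * h)" for x
    by (auto intro!: linearI simp: algebra_simps)
  show "((\<lambda>y. G y * h) has_derivative (\<lambda>k. fderiv G x 1 * k * h)) (at x)" if "x \<in> S" for x h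
    using bounded_linear.has_derivative[OF bounded_bilinear.bounded_linear_left[OF bounded_bilinear_ltimes, of h]
        conformal_on_has_derivative[OF G that]] .
  show "continuous_on S (\<lambda>x. fderiv G x 1 * k * h)" for h k
    by (intro smooth_on_continuous_on smooth_on_ltimes smooth_on_fderiv[OF sm] smooth_on_const smooth_on_open[OF sm])
qed (use S in \<open>auto simp: algebra_simps\<close>)

section \<open>Integration along paths\<close>

lemma valid_path_has_vector_derivative:
  assumes "valid_path \<gamma>"
  obtains S where "finite S" "\<And>t. t \<in> {0..1} - S \<Longrightarrow>
     (\<gamma> has_vector_derivative vector_derivative \<gamma> (at t within {0..1})) (at t)"
proof -
  obtain S where S: "finite S" "\<gamma> C1_differentiable_on {0..1} - S"
    using assms by (auto simp: valid_path_def piecewise_C1_differentiable_on_def)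
  have "(\<gamma> has_vector_derivative vector_derivative \<gamma> (at t within {0..1})) (at t)"
    if t: "t \<in> {0..1} - S" for t
  proof -
    obtain D where D: "(\<gamma> has_vector_derivative D) (at t)"
      using S(2) t unfolding C1_differentiable_on_def by blast
    then have "vector_derivative \<gamma> (at t within {0..1}) = D"
      using t by (intro vector_derivative_at_within_ivl) auto
    then show ?thesis using D by simp
  qed
  then show ?thesis using that S(1) by blast
qed

text \<open>Near its finitely many exceptional points the derivative of a valid path may be unbounded.  The
  existence of path integrals therefore rests on primitives instead of the continuity of the integrand.\<close>

lemma path_integral_primitive:
  fixes \<gamma> :: "real \<Rightarrow> 'a::real_normed_vector" and P :: "'a \<Rightarrow> 'b::banach"
  assumes \<gamma>: "valid_path \<gamma>" and uv: "u \<le> v" "{u..v} \<subseteq> {0..1}"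
    and P: "\<And>t. t \<in> {u..v} \<Longrightarrow> (P has_derivative L t) (at (\<gamma> t))"
  shows "((\<lambda>t. L t (vector_derivative \<gamma> (at t within {0..1}))) has_integral P (\<gamma> v) - P (\<gamma> u)) {u..v}"
proof -
  obtain S where S: "finite S" "\<And>t. t \<in> {0..1} - S \<Longrightarrow>
     (\<gamma> has_vector_derivative vector_derivative \<gamma> (at t within {0..1})) (at t)"
    using valid_path_has_vector_derivative[OF \<gamma>] by blast
  have cont: "continuous_on {u..v} (\<lambda>t. P (\<gamma> t))"
  proof (rule continuous_on_compose2[where t="\<gamma> ` {u..v}" and g=P])
    show "continuous_on (\<gamma> ` {u..v}) P"
    proof (intro continuous_at_imp_continuous_on ballI)
      fix y assume "y \<in> \<gamma> ` {u..v}"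
      then obtain t where t: "t \<in> {u..v}" "y = \<gamma> t" by blast
      show "isCont P y" unfolding t(2) by (rule has_derivative_continuous[OF P[OF t(1)]])
    qed
    show "continuous_on {u..v} \<gamma>"
      using valid_path_imp_path[OF \<gamma>] uv(2) continuous_on_subset unfolding path_def by blast
  qed auto
  show ?thesis
  proof (rule fundamental_theorem_of_calculus_interior_strong[OF S(1) uv(1) _ cont])
    fix t assume t: "t \<in> {u<..<v} - S"
    have "linear (L t)" using P[of t] t has_derivative_linear by force
    moreover have "((\<lambda>t. P (\<gamma> t)) has_derivative (\<lambda>c. L t (c *\<^sub>R vector_derivative \<gamma> (at t within {0..1})))) (at t)"
    proof (rule has_derivative_compose[of \<gamma> _ t UNIV P])
      show "(\<gamma> has_derivative (\<lambda>c. c *\<^sub>R vector_derivative \<gamma> (at t within {0..1}))) (at t)"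
        using S(2)[of t] t uv by (auto simp: has_vector_derivative_def)
      show "(P has_derivative L t) (at (\<gamma> t))" using P t by auto
    qed
    ultimately show "((\<lambda>t. P (\<gamma> t)) has_vector_derivative L t (vector_derivative \<gamma> (at t within {0..1}))) (at t)"
      unfolding has_vector_derivative_def by (simp add: linear_cmul)
  qed
qed

text \<open>If the function \<open>H\<close> is locally the composition of a primitive with the path, then the integrals over
  short intervals add up to the increment of \<open>H\<close>.\<close>

lemma path_integral_local:
  fixes \<gamma> :: "real \<Rightarrow> 'a::real_normed_vector" and H :: "real \<Rightarrow> 'b::banach"
  assumes \<gamma>: "valid_path \<gamma>"
    and loc: "\<And>t0. t0 \<in> {0..1} \<Longrightarrow> \<exists>d>0. \<exists>P. \<forall>t\<in>{0..1}. \<bar>t - t0\<bar> < d \<longrightarrow>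
       (P has_derivative L t) (at (\<gamma> t)) \<and> H t = P (\<gamma> t)"
  shows "((\<lambda>t. L t (vector_derivative \<gamma> (at t within {0..1}))) has_integral H 1 - H 0) {0..1}"
proof -
  let ?f = "\<lambda>t. L t (vector_derivative \<gamma> (at t within {0..1}))"
  have "{0..1} \<subseteq> {0..1::real} \<longrightarrow> (?f has_integral H 1 - H 0) {0..1}"
  proof (rule Bolzano[where P="\<lambda>u v. {u..v} \<subseteq> {0..1} \<longrightarrow> (?f has_integral H v - H u) {u..v}"])
    show "{a..c} \<subseteq> {0..1} \<longrightarrow> (?f has_integral H c - H a) {a..c}"
      if "{a..b} \<subseteq> {0..1} \<longrightarrow> (?f has_integral H b - H a) {a..b}"
        "{b..c} \<subseteq> {0..1} \<longrightarrow> (?f has_integral H c - H b) {b..c}" "a \<le> b" "b \<le> c" for a b c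
    proof
      assume ac: "{a..c} \<subseteq> {0..1}"
      have "{a..b} \<subseteq> {a..c}" "{b..c} \<subseteq> {a..c}" using that(3,4) by auto
      then have "(?f has_integral H b - H a) {a..b}" "(?f has_integral H c - H b) {b..c}"
        using that(1,2) ac by blast+
      then show "(?f has_integral H c - H a) {a..c}"
        using has_integral_combine[OF that(3,4), of ?f "H b - H a" "H c - H b"] by simp
    qed
    fix x :: real assume x: "0 \<le> x" "x \<le> 1"
    then have "x \<in> {0..1}" by simp
    from loc[OF this] obtain d P where d: "d > 0" "\<And>t. t \<in> {0..1} \<Longrightarrow> \<bar>t - x\<bar> < d \<Longrightarrow>
       (P has_derivative L t) (at (\<gamma> t)) \<and> H t = P (\<gamma> t)"
      by blast
    have "(?f has_integral H b - H a) {a..b}" if ab: "a \<le> x" "x \<le> b" "b - a < d" "{a..b} \<subseteq> {0..1}" for a b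
    proof -
      have *: "(P has_derivative L t) (at (\<gamma> t)) \<and> H t = P (\<gamma> t)" if "t \<in> {a..b}" for t
        by (rule d(2)) (use ab that in auto)
      have "(?f has_integral P (\<gamma> b) - P (\<gamma> a)) {a..b}"
        by (rule path_integral_primitive[OF \<gamma> _ ab(4)]) (use ab * in auto)
      then show ?thesis using *[of a] *[of b] ab(1,2) by simp
    qed
    then show "\<exists>d>0. \<forall>a b. a \<le> x \<and> x \<le> b \<and> b - a < d \<longrightarrow> {a..b} \<subseteq> {0..1} \<longrightarrow> (?f has_integral H b - H a) {a..b}"
      using d(1) by blast
  qed simp
  then show ?thesis by simp
qed

lemma path_integral_exists:
  fixes \<gamma> :: "real \<Rightarrow> 'a::real_normed_vector" and L :: "real \<Rightarrow> 'a \<Rightarrow> 'b::banach"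
  assumes \<gamma>: "valid_path \<gamma>"
    and loc: "\<And>t0. t0 \<in> {0..1} \<Longrightarrow> \<exists>d>0. \<exists>P. \<forall>t\<in>{0..1}. \<bar>t - t0\<bar> < d \<longrightarrow> (P has_derivative L t) (at (\<gamma> t))"
  shows "(\<lambda>t. L t (vector_derivative \<gamma> (at t within {0..1}))) integrable_on {0..1}"
proof -
  let ?f = "\<lambda>t. L t (vector_derivative \<gamma> (at t within {0..1}))"
  have "?f integrable_on cbox 0 1"
  proof (rule integrable_on_little_subintervals, intro ballI)
    fix x :: real assume x: "x \<in> cbox 0 1"
    then have "x \<in> {0..1}" by simp
    from loc[OF this] obtain d P where d: "d > 0" "\<And>t. t \<in> {0..1} \<Longrightarrow> \<bar>t - x\<bar> < d \<Longrightarrow> (P has_derivative L t) (at (\<gamma> t))"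
      by blast
    have "?f integrable_on cbox u v" if uv: "x \<in> cbox u v" "cbox u v \<subseteq> ball x d" "cbox u v \<subseteq> cbox 0 1" for u v
    proof -
      have "(?f has_integral P (\<gamma> v) - P (\<gamma> u)) {u..v}"
      proof (rule path_integral_primitive[OF \<gamma>])
        show "u \<le> v" "{u..v} \<subseteq> {0..1}" using uv by auto
        fix t assume t: "t \<in> {u..v}"
        then have "t \<in> ball x d" "t \<in> {0..1}" using uv by auto
        then show "(P has_derivative L t) (at (\<gamma> t))"
          using d(2)[of t] by (simp add: dist_real_def abs_minus_commute)
      qed
      then show ?thesis by (auto simp: integrable_on_def)
    qed
    then show "\<exists>d>0. \<forall>u v. x \<in> cbox u v \<and> cbox u v \<subseteq> ball x d \<and> cbox u v \<subseteq> cbox 0 1 \<longrightarrow> ?f integrable_on cbox u v"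
      using d(1) by blast
  qed
  then show ?thesis by simp
qed

section \<open>The differential prescribed by the representation formulas\<close>

text \<open>The four Lorentz numbers whose products with \<open>da\<close> are integrated in the representation formulas.\<close>

definition weier0 :: "lorentz \<Rightarrow> lorentz \<Rightarrow> lorentz \<Rightarrow> lorentz \<Rightarrow> lorentz" where
  "weier0 p1 p2 f1 f2 = - p1 * lconj f1 + p2 * lconj f2"

definition weier1 :: "lorentz \<Rightarrow> lorentz \<Rightarrow> lorentz \<Rightarrow> lorentz \<Rightarrow> lorentz" where
  "weier1 p1 p2 f1 f2 = - p1 * lconj f1 - p2 * lconj f2"

definition weier2 :: "lorentz \<Rightarrow> lorentz \<Rightarrow> lorentz \<Rightarrow> lorentz \<Rightarrow> lorentz" where
  "weier2 p1 p2 f1 f2 = p2 * lconj f1 + p1 * lconj f2"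

definition weier3 :: "lorentz \<Rightarrow> lorentz \<Rightarrow> lorentz \<Rightarrow> lorentz \<Rightarrow> lorentz" where
  "weier3 p1 p2 f1 f2 = - p2 * lconj f1 + p1 * lconj f2"

lemmas weier_defs = weier0_def weier1_def weier2_def weier3_def

text \<open>The differential of \<open>F\<close> at a point where the data have the values \<open>p1\<close>, \<open>p2\<close>, \<open>f1\<close>, \<open>f2\<close>.\<close>

definition weier_vec :: "lorentz \<Rightarrow> lorentz \<Rightarrow> lorentz \<Rightarrow> lorentz \<Rightarrow> lorentz \<Rightarrow> real ^ 4" where
  "weier_vec p1 p2 f1 f2 h = (\<chi> i.
     if i = 0 then lRe (weier0 p1 p2 f1 f2 * h) else if i = 1 then lRe (weier1 p1 p2 f1 f2 * h)
     else if i = 2 then lRe (weier2 p1 p2 f1 f2 * h) else lIm (weier3 p1 p2 f1 f2 * h))"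

lemma weier_vec_nth:
  "weier_vec p1 p2 f1 f2 h $ 0 = lRe (weier0 p1 p2 f1 f2 * h)"
  "weier_vec p1 p2 f1 f2 h $ 1 = lRe (weier1 p1 p2 f1 f2 * h)"
  "weier_vec p1 p2 f1 f2 h $ 2 = lRe (weier2 p1 p2 f1 f2 * h)"
  "weier_vec p1 p2 f1 f2 h $ 3 = lIm (weier3 p1 p2 f1 f2 * h)"
  by (simp_all add: weier_vec_def)

lemma weierstrass_formulas_iff:
  "weierstrass_formulas M a p0 \<psi>1 \<psi>2 \<phi>1 \<phi>2 F \<longleftrightarrow>
     (\<forall>\<Gamma>. path \<Gamma> \<and> path_image \<Gamma> \<subseteq> M \<and> valid_path (a \<circ> \<Gamma>) \<and> pathstart \<Gamma> = p0 \<longrightarrow>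
        (\<exists>I0 I1 I2 I3.
           has_line_integral (\<lambda>p. weier0 (\<psi>1 p) (\<psi>2 p) (\<phi>1 p) (\<phi>2 p)) a \<Gamma> I0 \<and>
           has_line_integral (\<lambda>p. weier1 (\<psi>1 p) (\<psi>2 p) (\<phi>1 p) (\<phi>2 p)) a \<Gamma> I1 \<and>
           has_line_integral (\<lambda>p. weier2 (\<psi>1 p) (\<psi>2 p) (\<phi>1 p) (\<phi>2 p)) a \<Gamma> I2 \<and>
           has_line_integral (\<lambda>p. weier3 (\<psi>1 p) (\<psi>2 p) (\<phi>1 p) (\<phi>2 p)) a \<Gamma> I3 \<and>
           F (pathfinish \<Gamma>) $ 0 = lRe I0 \<and> F (pathfinish \<Gamma>) $ 1 = lRe I1 \<and>
           F (pathfinish \<Gamma>) $ 2 = lRe I2 \<and> F (pathfinish \<Gamma>) $ 3 = lIm I3))"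
  by (simp only: weierstrass_formulas_def weier_defs)

lemma conformal_on_weier:
  assumes "conformal_on S \<psi>1" "conformal_on S \<psi>2"
    "conformal_on S (\<lambda>a. lconj (\<phi>1 a))" "conformal_on S (\<lambda>a. lconj (\<phi>2 a))"
  shows "conformal_on S (\<lambda>a. weier0 (\<psi>1 a) (\<psi>2 a) (\<phi>1 a) (\<phi>2 a))"
    and "conformal_on S (\<lambda>a. weier1 (\<psi>1 a) (\<psi>2 a) (\<phi>1 a) (\<phi>2 a))"
    and "conformal_on S (\<lambda>a. weier2 (\<psi>1 a) (\<psi>2 a) (\<phi>1 a) (\<phi>2 a))"
    and "conformal_on S (\<lambda>a. weier3 (\<psi>1 a) (\<psi>2 a) (\<phi>1 a) (\<phi>2 a))"
  unfolding weier_defs diff_conv_add_uminus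
  by (intro conformal_on_add conformal_on_mult conformal_on_minus assms)+

lemma forall_index4: "(\<forall>i::4. P i) \<longleftrightarrow> P 0 \<and> P 1 \<and> P 2 \<and> P 3"
proof -
  have "(4::4) = 0" by simp
  then show ?thesis using forall_4[of P] by metis
qed

lemma vec4_eqI: "x $ 0 = y $ 0 \<Longrightarrow> x $ 1 = y $ 1 \<Longrightarrow> x $ 2 = y $ 2 \<Longrightarrow> x $ 3 = y $ 3 \<Longrightarrow> x = (y :: 'a ^ 4)"
  by (simp add: vec_eq_iff forall_index4)

lemma weier_vec_linear: "linear (weier_vec p1 p2 f1 f2)"
  by (rule linearI) (auto intro!: vec4_eqI simp: weier_vec_nth algebra_simps)

definition weier_det :: "lorentz \<Rightarrow> lorentz \<Rightarrow> lorentz \<Rightarrow> lorentz \<Rightarrow> real" where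
  "weier_det p1 p2 f1 f2 = lform (p1 * f2 - p2 * f1) (p1 * f2 - p2 * f1)"

text \<open>In null components \<open>weier_vec p1 p2 f1 f2 h\<close> is the sum of two null vectors, one proportional to the
  first and one to the second component of \<open>h\<close>; only their mixed product contributes.\<close>

lemma weier_vec_minner:
  "minner (weier_vec p1 p2 f1 f2 h) (weier_vec p1 p2 f1 f2 k) = - weier_det p1 p2 f1 f2 * lform h k"
  unfolding minner_def weier_vec_nth weier_defs weier_det_def lform_def lorentz_sel_simps lconj_simps
  by algebra

lemma lform_self_nonzero: "lform d d \<noteq> 0 \<longleftrightarrow> d * lconj d \<noteq> 0"
  by (auto simp: lform_def lorentz_eq_iff)

lemma weier_det_eq: "weier_det p1 p2 f1 f2 \<noteq> 0 \<longleftrightarrow> (p1 * f2 - p2 * f1) * lconj (p1 * f2 - p2 * f1) \<noteq> 0"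
  by (simp only: weier_det_def lform_self_nonzero)

lemma smooth_on_weier_vec:
  assumes "conformal_on S \<psi>1" "conformal_on S \<psi>2"
    "conformal_on S (\<lambda>a. lconj (\<phi>1 a))" "conformal_on S (\<lambda>a. lconj (\<phi>2 a))"
  shows "smooth_on S (\<lambda>x. weier_vec (\<psi>1 x) (\<psi>2 x) (\<phi>1 x) (\<phi>2 x) h)"
proof -
  have op: "open S" using assms(1) conformal_on_smooth_on smooth_on_open by blast
  have "\<forall>i. smooth_on S (\<lambda>x. weier_vec (\<psi>1 x) (\<psi>2 x) (\<phi>1 x) (\<phi>2 x) h $ i)"
    unfolding forall_index4 weier_vec_nth
    by (intro conjI smooth_on_lRe smooth_on_lIm smooth_on_ltimes smooth_on_const op
        conformal_on_weier[OF assms, THEN conformal_on_smooth_on])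
  then show ?thesis by (intro smooth_on_vec op) blast
qed

lemma mean_curvature_cong:
  assumes "open S" "x \<in> S" "\<And>y. y \<in> S \<Longrightarrow> f y = g y"
  shows "mean_curvature f x = mean_curvature g x" "pullback_metric f x = pullback_metric g x"
proof -
  have 1: "fderiv f y = fderiv g y" if "y \<in> S" for y
    by (rule fderiv_cong_open[OF assms(1) that assms(3)])
  have 2: "fderiv (\<lambda>y. fderiv f y Y) x = fderiv (\<lambda>y. fderiv g y Y) x" for Y
    by (rule fderiv_cong_open[OF assms(1,2)]) (simp add: 1)
  show 3: "pullback_metric f x = pullback_metric g x"
    by (simp add: pullback_metric_def fun_eq_iff 1[OF assms(2)])
  show "mean_curvature f x = mean_curvature g x"
    by (simp add: mean_curvature_def second_fundamental_form_def normal_part_def 3 2 1[OF assms(2)])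
qed

text \<open>The second derivatives of \<open>F\<close> in the directions \<open>1\<close> and \<open>\<sigma>\<close> are equal because the derivative of a
  conformal map is the multiplication by a Lorentz number and \<open>\<sigma>\<^sup>2 = 1\<close>, while the induced metric has opposite signs on the
  two directions and makes them orthogonal.  So the trace that defines the mean curvature vanishes.\<close>

lemma weierstrass_surface:
  assumes conf: "conformal_on S \<psi>1" "conformal_on S \<psi>2"
    "conformal_on S (\<lambda>a. lconj (\<phi>1 a))" "conformal_on S (\<lambda>a. lconj (\<phi>2 a))"
    and F: "\<And>x. x \<in> S \<Longrightarrow> (F has_derivative weier_vec (\<psi>1 x) (\<psi>2 x) (\<phi>1 x) (\<phi>2 x)) (at x)"
  shows "smooth_on S F"
    and "x \<in> S \<Longrightarrow> pullback_metric F x h k = - weier_det (\<psi>1 x) (\<psi>2 x) (\<phi>1 x) (\<phi>2 x) * lform h k"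
    and "x \<in> S \<Longrightarrow> weier_det (\<psi>1 x) (\<psi>2 x) (\<phi>1 x) (\<phi>2 x) \<noteq> 0 \<Longrightarrow> inj (fderiv F x)"
    and "x \<in> S \<Longrightarrow> mean_curvature F x = 0"
proof -
  have op: "open S" using conf(1) conformal_on_smooth_on smooth_on_open by blast
  have dF: "fderiv F y = weier_vec (\<psi>1 y) (\<psi>2 y) (\<phi>1 y) (\<phi>2 y)" if "y \<in> S" for y
    using fderiv_eqI[OF F[OF that]] .
  show "smooth_on S F"
    by (rule smooth_on_if_derivative[OF op F smooth_on_weier_vec[OF conf]])
  then have ddF: "((\<lambda>y. fderiv F y h) has_derivative fderiv (\<lambda>y. fderiv F y h) x) (at x)" if "x \<in> S" for x h
    using smooth_on_has_derivative[OF smooth_on_fderiv] that by blast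
  show metric: "pullback_metric F x h k = - weier_det (\<psi>1 x) (\<psi>2 x) (\<phi>1 x) (\<phi>2 x) * lform h k"
    if "x \<in> S" for x h k
    using that by (simp add: pullback_metric_def dF weier_vec_minner)
  show "inj (fderiv F x)" if x: "x \<in> S" and nz: "weier_det (\<psi>1 x) (\<psi>2 x) (\<phi>1 x) (\<phi>2 x) \<noteq> 0"
  proof -
    have "h = 0" if "fderiv F x h = 0" for h
    proof -
      have "pullback_metric F x h k = 0" for k
        using that by (simp add: pullback_metric_def minner_def)
      then have "lform h k = 0" for k using metric[OF x, of h k] nz by simp
      from this[of 1] this[of lsigma] show "h = 0" by (simp add: lform_def lorentz_eq_iff)
    qed
    moreover have "linear (fderiv F x)" unfolding dF[OF x] by (rule weier_vec_linear)
    ultimately show ?thesis by (simp add: linear_injective_0)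
  qed
  show "mean_curvature F x = 0" if x: "x \<in> S"
  proof -
    note G = conformal_on_weier[OF conf]
    have *: "fderiv (\<lambda>y. fderiv F y h) x h $ i = L (fderiv G x 1 * (h * h))"
      if "conformal_on S G" "bounded_linear L" "\<And>y. y \<in> S \<Longrightarrow> fderiv F y h $ i = L (G y * h)"
      for G i L h
    proof -
      have "((\<lambda>y. fderiv F y h $ i) has_derivative (\<lambda>k. fderiv (\<lambda>y. fderiv F y h) x k $ i)) (at x)"
        using bounded_linear.has_derivative[OF bounded_linear_vec_nth ddF[OF x]] .
      moreover have "((\<lambda>y. L (G y * h)) has_derivative (\<lambda>k. L (fderiv G x 1 * k * h))) (at x)"
        by (intro bounded_linear.has_derivative[OF that(2)]
            bounded_linear.has_derivative[OF bounded_bilinear.bounded_linear_left[OF bounded_bilinear_ltimes, of h]]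
            conformal_on_has_derivative[OF that(1) x])
      then have "((\<lambda>y. fderiv F y h $ i) has_derivative (\<lambda>k. L (fderiv G x 1 * k * h))) (at x)"
        by (rule has_derivative_transform_within_open[OF _ op x]) (simp add: that(3))
      ultimately have "fderiv (\<lambda>y. fderiv F y h) x k $ i = L (fderiv G x 1 * k * h)" for k
        using has_derivative_unique by metis
      then show ?thesis by (simp add: mult.assoc)
    qed
    have "fderiv (\<lambda>y. fderiv F y lsigma) x lsigma $ i = fderiv (\<lambda>y. fderiv F y 1) x 1 $ i"
      if "i = 0 \<or> i = 1 \<or> i = 2 \<or> i = 3" for i
      using that *[OF G(1) bounded_linear_lRe, of _ 0] *[OF G(2) bounded_linear_lRe, of _ 1]
        *[OF G(3) bounded_linear_lRe, of _ 2] *[OF G(4) bounded_linear_lIm, of _ 3]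
      by (auto simp: dF weier_vec_nth)
    then have "fderiv (\<lambda>y. fderiv F y lsigma) x lsigma = fderiv (\<lambda>y. fderiv F y 1) x 1"
      by (intro vec4_eqI) auto
    then have "second_fundamental_form F x lsigma lsigma = second_fundamental_form F x 1 1"
      by (simp add: second_fundamental_form_def)
    moreover have "lform 1 1 = 1" "lform lsigma lsigma = - 1" "lform 1 lsigma = 0"
      by (simp_all add: lform_def)
    ultimately show ?thesis
      by (simp add: mean_curvature_def metric[OF x] Let_def)
  qed
qed

lemma signature_1_1_multiple_lform:
  "signature_1_1 (\<lambda>h k. \<mu> * lform h k) \<longleftrightarrow> \<mu> \<noteq> 0"
proof
  assume "\<mu> \<noteq> 0"
  then consider "\<mu> > 0" | "\<mu> < 0" by linarith
  then show "signature_1_1 (\<lambda>h k. \<mu> * lform h k)"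
  proof cases
    case 1
    then have "(1 / sqrt \<mu>) * (1 / sqrt \<mu>) * \<mu> = 1" by (simp add: field_simps)
    then show ?thesis unfolding signature_1_1_def lform_def
      by (intro exI[of _ "Lor (1 / sqrt \<mu>) 0"] exI[of _ "Lor 0 (1 / sqrt \<mu>)"]) (auto simp: mult_ac)
  next
    case 2
    then have "(1 / sqrt (- \<mu>)) * (1 / sqrt (- \<mu>)) * \<mu> = - 1" by (simp add: field_simps)
    then show ?thesis unfolding signature_1_1_def lform_def
      by (intro exI[of _ "Lor 0 (1 / sqrt (- \<mu>))"] exI[of _ "Lor (1 / sqrt (- \<mu>)) 0"]) (auto simp: mult_ac)
  qed
qed (auto simp: signature_1_1_def)

section \<open>Surfaces given by the representation formulas\<close>

lemma weierstrass_formulas_exist: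
  assumes conf: "conformal_on UNIV \<psi>1" "conformal_on UNIV \<psi>2"
    "conformal_on UNIV (\<lambda>a. lconj (\<phi>1 a))" "conformal_on UNIV (\<lambda>a. lconj (\<phi>2 a))"
  shows "\<exists>F. weierstrass_formulas UNIV (\<lambda>a. a) a0 \<psi>1 \<psi>2 \<phi>1 \<phi>2 F \<and>
     (\<forall>x. (F has_derivative weier_vec (\<psi>1 x) (\<psi>2 x) (\<phi>1 x) (\<phi>2 x)) (at x))"
proof -
  let ?G0 = "\<lambda>x. weier0 (\<psi>1 x) (\<psi>2 x) (\<phi>1 x) (\<phi>2 x)" and ?G1 = "\<lambda>x. weier1 (\<psi>1 x) (\<psi>2 x) (\<phi>1 x) (\<phi>2 x)"
    and ?G2 = "\<lambda>x. weier2 (\<psi>1 x) (\<psi>2 x) (\<phi>1 x) (\<phi>2 x)" and ?G3 = "\<lambda>x. weier3 (\<psi>1 x) (\<psi>2 x) (\<phi>1 x) (\<phi>2 x)"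
  obtain P0 P1 P2 P3 where P: "\<And>x. (P0 has_derivative (\<lambda>h. ?G0 x * h)) (at x)"
    "\<And>x. (P1 has_derivative (\<lambda>h. ?G1 x * h)) (at x)"
    "\<And>x. (P2 has_derivative (\<lambda>h. ?G2 x * h)) (at x)"
    "\<And>x. (P3 has_derivative (\<lambda>h. ?G3 x * h)) (at x)"
    using conformal_on_weier[OF conf, THEN conformal_primitive[OF _ convex_UNIV]] by blast
  define F :: "lorentz \<Rightarrow> real ^ 4" where "F x = (\<chi> i. if i = 0 then lRe (P0 x - P0 a0) else if i = 1 then lRe (P1 x - P1 a0)
      else if i = 2 then lRe (P2 x - P2 a0) else lIm (P3 x - P3 a0))" for x
  have F_nth: "F x $ 0 = lRe (P0 x - P0 a0)" "F x $ 1 = lRe (P1 x - P1 a0)"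
    "F x $ 2 = lRe (P2 x - P2 a0)" "F x $ 3 = lIm (P3 x - P3 a0)" for x
    by (simp_all add: F_def)
  have int: "has_line_integral G (\<lambda>a. a) \<Gamma> (P (pathfinish \<Gamma>) - P a0)"
    if "\<And>x. (P has_derivative (\<lambda>h. G x * h)) (at x)" "valid_path ((\<lambda>a. a) \<circ> \<Gamma>)" "pathstart \<Gamma> = a0" for P G \<Gamma>
    using path_integral_primitive[of \<Gamma> 0 1 P "\<lambda>t h. G (\<Gamma> t) * h"] that
    by (simp add: has_line_integral_def o_def pathfinish_def pathstart_def)
  have "weierstrass_formulas UNIV (\<lambda>a. a) a0 \<psi>1 \<psi>2 \<phi>1 \<phi>2 F"
    unfolding weierstrass_formulas_iff F_nth
    using int[of P0 ?G0, OF P(1)] int[of P1 ?G1, OF P(2)] int[of P2 ?G2, OF P(3)] int[of P3 ?G3, OF P(4)] by blast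
  moreover have "(F has_derivative weier_vec (\<psi>1 x) (\<psi>2 x) (\<phi>1 x) (\<phi>2 x)) (at x)" for x
  proof -
    have d: "((\<lambda>x. L (P x - P a0)) has_derivative (\<lambda>h. L (G x * h))) (at x)"
      if "bounded_linear L" "(P has_derivative (\<lambda>h. G x * h)) (at x)" for L :: "lorentz \<Rightarrow> real" and P G
      by (rule bounded_linear.has_derivative[OF that(1)]) (use that(2) in \<open>auto intro!: derivative_eq_intros\<close>)
    have "\<forall>i. ((\<lambda>x. F x $ i) has_derivative (\<lambda>h. weier_vec (\<psi>1 x) (\<psi>2 x) (\<phi>1 x) (\<phi>2 x) h $ i)) (at x)"
      unfolding forall_index4 weier_vec_nth F_nth
      by (intro conjI d bounded_linear_lRe bounded_linear_lIm P)
    then show ?thesis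
      by (subst has_derivative_componentwise_within) (auto simp: Basis_vec_def inner_axis)
  qed
  ultimately show ?thesis by blast
qed

text \<open>Every point is the end of a segment that starts at the base point.\<close>

lemma weierstrass_formulas_unique:
  assumes "weierstrass_formulas UNIV (\<lambda>a. a) a0 \<psi>1 \<psi>2 \<phi>1 \<phi>2 F"
    "weierstrass_formulas UNIV (\<lambda>a. a) a0 \<psi>1 \<psi>2 \<phi>1 \<phi>2 F'"
  shows "F = F'"
proof
  fix x
  let ?\<Gamma> = "linepath a0 x"
  have pre: "path ?\<Gamma> \<and> path_image ?\<Gamma> \<subseteq> UNIV \<and> valid_path ((\<lambda>a. a) \<circ> ?\<Gamma>) \<and> pathstart ?\<Gamma> = a0"
    by (simp add: o_def)
  have uniq: "has_line_integral g a \<Gamma> I \<Longrightarrow> has_line_integral g a \<Gamma> J \<Longrightarrow> I = J"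
    for g a and \<Gamma> :: "real \<Rightarrow> lorentz" and I J
    unfolding has_line_integral_def by (rule has_integral_unique)
  obtain I0 I1 I2 I3 where I:
    "has_line_integral (\<lambda>p. weier0 (\<psi>1 p) (\<psi>2 p) (\<phi>1 p) (\<phi>2 p)) (\<lambda>a. a) ?\<Gamma> I0"
    "has_line_integral (\<lambda>p. weier1 (\<psi>1 p) (\<psi>2 p) (\<phi>1 p) (\<phi>2 p)) (\<lambda>a. a) ?\<Gamma> I1"
    "has_line_integral (\<lambda>p. weier2 (\<psi>1 p) (\<psi>2 p) (\<phi>1 p) (\<phi>2 p)) (\<lambda>a. a) ?\<Gamma> I2"
    "has_line_integral (\<lambda>p. weier3 (\<psi>1 p) (\<psi>2 p) (\<phi>1 p) (\<phi>2 p)) (\<lambda>a. a) ?\<Gamma> I3"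
    "F x $ 0 = lRe I0" "F x $ 1 = lRe I1" "F x $ 2 = lRe I2" "F x $ 3 = lIm I3"
    using assms(1)[unfolded weierstrass_formulas_iff, rule_format, OF pre] by auto
  obtain J0 J1 J2 J3 where J:
    "has_line_integral (\<lambda>p. weier0 (\<psi>1 p) (\<psi>2 p) (\<phi>1 p) (\<phi>2 p)) (\<lambda>a. a) ?\<Gamma> J0"
    "has_line_integral (\<lambda>p. weier1 (\<psi>1 p) (\<psi>2 p) (\<phi>1 p) (\<phi>2 p)) (\<lambda>a. a) ?\<Gamma> J1"
    "has_line_integral (\<lambda>p. weier2 (\<psi>1 p) (\<psi>2 p) (\<phi>1 p) (\<phi>2 p)) (\<lambda>a. a) ?\<Gamma> J2"
    "has_line_integral (\<lambda>p. weier3 (\<psi>1 p) (\<psi>2 p) (\<phi>1 p) (\<phi>2 p)) (\<lambda>a. a) ?\<Gamma> J3"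
    "F' x $ 0 = lRe J0" "F' x $ 1 = lRe J1" "F' x $ 2 = lRe J2" "F' x $ 3 = lIm J3"
    using assms(2)[unfolded weierstrass_formulas_iff, rule_format, OF pre] by auto
  show "F x = F' x"
    by (rule vec4_eqI) (simp_all add: I(5-8) J(5-8) uniq[OF I(1) J(1)] uniq[OF I(2) J(2)]
        uniq[OF I(3) J(3)] uniq[OF I(4) J(4)])
qed

theorem weierstrass_conformal_minimal:
  assumes conf: "conformal_on UNIV \<psi>1" "conformal_on UNIV \<psi>2"
    "conformal_on UNIV (\<lambda>a. lconj (\<phi>1 a))" "conformal_on UNIV (\<lambda>a. lconj (\<phi>2 a))"
    and F: "weierstrass_formulas UNIV (\<lambda>a. a) a0 \<psi>1 \<psi>2 \<phi>1 \<phi>2 F"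
    and \<Omega>: "\<Omega> = {a. (\<psi>1 a * \<phi>2 a - \<psi>2 a * \<phi>1 a) * lconj (\<psi>1 a * \<phi>2 a - \<psi>2 a * \<phi>1 a) \<noteq> 0}"
  shows "\<Omega> = {a. signature_1_1 (pullback_metric F a)}" "lorentz_surface \<Omega> {(\<Omega>, \<lambda>a. a)}"
    "conformal_immersion {(\<Omega>, \<lambda>a. a)} F" "minimal {(\<Omega>, \<lambda>a. a)} F"
proof -
  let ?N = "\<lambda>a. weier_det (\<psi>1 a) (\<psi>2 a) (\<phi>1 a) (\<phi>2 a)"
  have \<Omega>N: "\<Omega> = {a. ?N a \<noteq> 0}" unfolding \<Omega> weier_det_eq ..
  have dF: "(F has_derivative weier_vec (\<psi>1 x) (\<psi>2 x) (\<phi>1 x) (\<phi>2 x)) (at x)" for x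
    using weierstrass_formulas_exist[OF conf, of a0] weierstrass_formulas_unique[OF F] by blast
  note W = weierstrass_surface[OF conf dF]
  have metric: "pullback_metric F a = (\<lambda>h k. - ?N a * lform h k)" for a
    using W(2) by blast
  show "\<Omega> = {a. signature_1_1 (pullback_metric F a)}"
    unfolding \<Omega>N metric signature_1_1_multiple_lform by simp
  have open\<Omega>: "open \<Omega>"
  proof -
    have sm: "smooth_on UNIV \<psi>1" "smooth_on UNIV \<psi>2" "smooth_on UNIV (\<lambda>a. lconj (\<phi>1 a))"
      "smooth_on UNIV (\<lambda>a. lconj (\<phi>2 a))"
      using conf conformal_on_smooth_on by auto
    have ll: "lconj (lconj a) = a" for a by (simp add: lorentz_eq_iff)
    have "smooth_on UNIV \<phi>1" "smooth_on UNIV \<phi>2"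
      using smooth_on_lconj[OF sm(3)] smooth_on_lconj[OF sm(4)] by (simp_all add: ll)
    then have "smooth_on UNIV ?N"
      unfolding weier_det_def lform_def
      by (intro smooth_on_lRe smooth_on_ltimes smooth_on_lconj smooth_on_diff sm)
    then have "continuous_on UNIV ?N" by (rule smooth_on_continuous_on)
    then show ?thesis unfolding \<Omega>N
      using open_Collect_neq continuous_on_const by blast
  qed
  have inv: "inv_into \<Omega> (\<lambda>a. a) x = x" if "x \<in> \<Omega>" for x
    using that by (metis f_inv_into_f image_ident)
  show "lorentz_surface \<Omega> {(\<Omega>, \<lambda>a. a)}"
    unfolding lorentz_surface_def atlas_def
  proof (intro conjI ballI)
    show "\<Omega> = (\<Union>(U, c)\<in>{(\<Omega>, \<lambda>a. a)}. U)" by simp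
    have "homeomorphism \<Omega> \<Omega> (\<lambda>a. a) (inv_into \<Omega> (\<lambda>a. a))"
      by (rule homeomorphismI) (auto simp: inv image_def cong: continuous_on_cong)
    then show "case x of (U, c) \<Rightarrow> openin (top_of_set \<Omega>) U \<and> open (c ` U) \<and> homeomorphism U (c ` U) c (inv_into U c)"
      if "x \<in> {(\<Omega>, \<lambda>a. a)}" for x
      using that open\<Omega> by simp
    have "conformal_on \<Omega> ((\<lambda>a. a) \<circ> inv_into \<Omega> (\<lambda>a. a))"
      by (rule conformal_on_cong[OF conformal_on_id[OF open\<Omega>]]) (simp add: inv)
    then show "case x of (U, c) \<Rightarrow> \<forall>(V, d)\<in>{(\<Omega>, \<lambda>a. a)}. conformal_on (c ` (U \<inter> V)) (d \<circ> inv_into U c)"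
      if "x \<in> {(\<Omega>, \<lambda>a. a)}" for x
      using that by simp
  qed
  have eq: "F y = (F \<circ> inv_into \<Omega> (\<lambda>a. a)) y" if "y \<in> \<Omega>" for y
    using that by (simp add: inv)
  have fd: "fderiv (F \<circ> inv_into \<Omega> (\<lambda>a. a)) x = fderiv F x" if "x \<in> \<Omega>" for x
    by (rule fderiv_cong_open[OF open\<Omega> that eq, symmetric])
  have pm: "pullback_metric (F \<circ> inv_into \<Omega> (\<lambda>a. a)) x = pullback_metric F x"
    and mc: "mean_curvature (F \<circ> inv_into \<Omega> (\<lambda>a. a)) x = mean_curvature F x" if "x \<in> \<Omega>" for x
    by (rule mean_curvature_cong(2)[OF open\<Omega> that eq, symmetric], assumption,
        rule mean_curvature_cong(1)[OF open\<Omega> that eq, symmetric], assumption)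
  have "smooth_on \<Omega> (F \<circ> inv_into \<Omega> (\<lambda>a. a))"
    by (rule smooth_on_cong[OF smooth_on_subset[OF W(1) open\<Omega>] eq]) auto
  moreover have "\<exists>\<mu>. \<mu> \<noteq> 0 \<and> (\<forall>X Y. pullback_metric F x X Y = \<mu> * lform X Y)" if "x \<in> \<Omega>" for x
    using that unfolding metric \<Omega>N by (intro exI[of _ "- ?N x"]) simp
  ultimately show "conformal_immersion {(\<Omega>, \<lambda>a. a)} F"
    using W(3) unfolding conformal_immersion_def immersion_def \<Omega>N
    by (simp add: pm fd \<Omega>N[symmetric]) (simp add: \<Omega>N)
  show "minimal {(\<Omega>, \<lambda>a. a)} F"
    unfolding minimal_def using W(4) by (simp add: mc)
qed

section \<open>Null vectors and null waves\<close>

text \<open>The vectors with coordinates \<open>x0, x1, x2, x3\<close> correspond to the pairs of complex numbers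
  \<open>\<xi> = - x0 + \<i> x2\<close> and \<open>\<zeta> = - x1 - \<i> x3\<close>, and the quadratic form is \<open>|\<zeta>|\<^sup>2 - |\<xi>|\<^sup>2\<close>.  Here
  \<open>\<xi> = e f\<close> and \<open>\<zeta> = e (cnj f)\<close>, which have equal modulus.\<close>

definition null_vec :: "complex \<Rightarrow> complex \<Rightarrow> real ^ 4" where
  "null_vec e f = (\<chi> i. if i = 0 then - Re (e * f) else if i = 1 then - Re (e * cnj f)
     else if i = 2 then Im (e * f) else - Im (e * cnj f))"

lemma null_vec_nth:
  "null_vec e f $ 0 = - Re (e * f)" "null_vec e f $ 1 = - Re (e * cnj f)"
  "null_vec e f $ 2 = Im (e * f)" "null_vec e f $ 3 = - Im (e * cnj f)"
  by (simp_all add: null_vec_def)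

lemma null_vec_minner:
  "minner (null_vec e1 f1) (null_vec e2 f2) = 2 * Im (e1 * cnj e2) * Im (f1 * cnj f2)"
  unfolding minner_def null_vec_nth by (simp add: algebra_simps)

lemma null_vec_scale: "null_vec (a *\<^sub>R e) (b *\<^sub>R f) = (a * b) *\<^sub>R null_vec e f"
  by (rule vec4_eqI) (simp_all add: null_vec_nth algebra_simps)

text \<open>A wave consists of a null coordinate \<open>s\<close> and of the factors \<open>e\<close>, \<open>f\<close> of the null vector
  that \<open>dF\<close> takes as value in the direction of \<open>s\<close>.\<close>

type_synonym wave = "real \<times> complex \<times> complex"

definition direction :: "wave \<Rightarrow> real ^ 4" where
  "direction w = null_vec (fst (snd w)) (snd (snd w))"

text \<open>By \<open>null_vec_minner\<close> two waves are transversal if and only if their directions are not orthogonal.\<close>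

definition transversal :: "wave \<Rightarrow> wave \<Rightarrow> bool" where
  "transversal w1 w2 \<longleftrightarrow> Im (fst (snd w1) * cnj (fst (snd w2))) \<noteq> 0 \<and> Im (snd (snd w1) * cnj (snd (snd w2))) \<noteq> 0"

text \<open>The last condition says that \<open>w\<close> is locally a function of its null coordinate, wherever the latter is
  regular.\<close>

definition null_wave :: "lorentz set \<Rightarrow> (lorentz \<Rightarrow> wave) \<Rightarrow> bool" where
  "null_wave B w \<longleftrightarrow> smooth_on B w \<and>
     (\<forall>x\<in>B. norm (fst (snd (w x))) = 1 \<and> norm (snd (snd (w x))) = 1 \<and>
        (\<forall>h. fst (fderiv w x h) = 0 \<longrightarrow> fderiv w x h = 0))"

text \<open>This is the local problem: \<open>f\<close> is the sum of two null curves.  Its parameters, the null coordinates of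
  \<open>w1\<close> and \<open>w2\<close>, are arc lengths up to a factor, since \<open>null_vec e f\<close> has Euclidean length
  \<open>sqrt 2\<close> for unit \<open>e\<close> and \<open>f\<close>.\<close>

definition null_frame :: "lorentz set \<Rightarrow> (lorentz \<Rightarrow> real ^ 4) \<Rightarrow> (lorentz \<Rightarrow> wave) \<Rightarrow> (lorentz \<Rightarrow> wave) \<Rightarrow> bool" where
  "null_frame B f w1 w2 \<longleftrightarrow> null_wave B w1 \<and> null_wave B w2 \<and>
     (\<forall>x\<in>B. transversal (w1 x) (w2 x) \<and>
        (\<forall>h. fderiv f x h = fst (fderiv w1 x h) *\<^sub>R direction (w1 x) + fst (fderiv w2 x h) *\<^sub>R direction (w2 x)) \<and>
        (\<forall>h. fst (fderiv w1 x h) = 0 \<and> fst (fderiv w2 x h) = 0 \<longrightarrow> h = 0))"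

text \<open>The factors of \<open>v\<close> must satisfy \<open>e\<^sup>2 = \<xi> \<zeta>\<close> and \<open>f = \<xi> (cnj e)\<close>, so that they are smooth functions
  of \<open>v\<close> wherever a smooth square root of \<open>\<xi> \<zeta>\<close> is available.\<close>

lemma null_vec_section:
  fixes v0 :: "real ^ 4"
  assumes "minner v0 v0 = 0" "v0 \<bullet> v0 = 2"
  shows "\<exists>T \<Psi>. open T \<and> v0 \<in> T \<and> smooth_on T \<Psi> \<and>
     (\<forall>v\<in>T. minner v v = 0 \<and> v \<bullet> v = 2 \<longrightarrow>
        norm (fst (\<Psi> v)) = 1 \<and> norm (snd (\<Psi> v)) = 1 \<and> null_vec (fst (\<Psi> v)) (snd (\<Psi> v)) = v)"
proof -
  define X where "X v = Complex (- (v $ 0)) (v $ 2)" for v :: "real ^ 4"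
  define Z where "Z v = Complex (- (v $ 1)) (- (v $ 3))" for v :: "real ^ 4"
  have sum4: "v \<bullet> v = (v $ 0)\<^sup>2 + (v $ 1)\<^sup>2 + (v $ 2)\<^sup>2 + (v $ 3)\<^sup>2" for v :: "real ^ 4"
  proof -
    have four: "(4::4) = 0" by simp
    have "sum g UNIV = g 0 + g 1 + g 2 + g 3" for g :: "4 \<Rightarrow> real"
      using sum_4[of g] unfolding four by (simp add: add_ac)
    then show ?thesis by (simp add: inner_vec_def power2_eq_square)
  qed
  have unit: "norm (X v) = 1 \<and> norm (Z v) = 1" if "minner v v = 0" "v \<bullet> v = 2" for v
  proof -
    have "(v $ 0)\<^sup>2 + (v $ 2)\<^sup>2 = 1" "(v $ 1)\<^sup>2 + (v $ 3)\<^sup>2 = 1"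
      using that unfolding minner_def sum4 by (simp_all add: power2_eq_square)
    then show ?thesis by (simp add: X_def Z_def cmod_def)
  qed
  define z0 where "z0 = X v0 * Z v0"
  define e0 where "e0 = csqrt z0"
  have z0: "norm z0 = 1" using unit[OF assms] by (simp add: z0_def norm_mult)
  have e0: "e0 * e0 = z0" by (simp add: e0_def power2_eq_square[symmetric])
  have ne0: "norm e0 = 1" using z0 by (simp add: e0_def norm_csqrt)
  \<comment> \<open>For unit numbers \<open>u\<close> and \<open>z0\<close> the square of \<open>u + z0\<close> is a positive multiple of \<open>u * z0\<close>; so the
    normalization of \<open>(u + z0) * cnj e0\<close> is a square root of \<open>u\<close>.\<close>
  define z where "z v = X v * Z v + z0" for v
  define T where "T = {v. z v \<noteq> 0}"
  define e where "e v = inverse (sqrt (z v \<bullet> z v)) *\<^sub>R (z v * cnj e0)" for v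
  define f where "f v = X v * cnj (e v)" for v
  have smX: "smooth_on UNIV X" and smZ: "smooth_on UNIV Z"
    unfolding X_def Z_def
    by (intro smooth_on_Complex smooth_on_minus smooth_on_vec_nth smooth_on_id open_UNIV)+
  have smz: "smooth_on UNIV z" unfolding z_def
    by (intro smooth_on_add smooth_on_bilinear[OF bounded_bilinear_mult] smX smZ smooth_on_const open_UNIV)
  have opT: "open T"
    unfolding T_def using smooth_on_continuous_on[OF smz] by (intro open_Collect_neq continuous_on_const) auto
  have smT: "smooth_on T z" "smooth_on T X" using smz smX smooth_on_subset opT by auto
  have sme: "smooth_on T e" unfolding e_def
    by (intro smooth_on_scaleR smooth_on_inverse smooth_on_sqrt smooth_on_inner smT
        smooth_on_bilinear[OF bounded_bilinear_mult] smooth_on_const opT) (auto simp: T_def)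
  have smf: "smooth_on T f" unfolding f_def
    by (intro smooth_on_bilinear[OF bounded_bilinear_mult] smT
        smooth_on_linear_compose[OF bounded_linear_cnj] sme)
  have v0T: "v0 \<in> T" using z0 by (auto simp: T_def z_def z0_def[symmetric])
  have main: "norm (e v) = 1 \<and> norm (f v) = 1 \<and> null_vec (e v) (f v) = v"
    if v: "v \<in> T" "minner v v = 0" "v \<bullet> v = 2" for v
  proof -
    have nX: "norm (X v) = 1" and nZ: "norm (Z v) = 1" using unit[OF v(2,3)] by auto
    define u where "u = X v * Z v"
    have nu: "norm u = 1" using nX nZ by (simp add: u_def norm_mult)
    have cc: "w * cnj w = 1" if "norm w = 1" for w using that by (simp add: complex_norm_square[symmetric])
    have zne: "z v \<noteq> 0" using v(1) by (simp add: T_def)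
    have sq: "sqrt (z v \<bullet> z v) = norm (z v)" by (simp add: norm_eq_sqrt_inner)
    have ne: "norm (e v) = 1"
      using zne ne0 by (simp add: e_def sq norm_mult)
    have zz: "z v * z v = u * z0 * (z v * cnj (z v))"
    proof -
      have "u * z0 * ((u + z0) * (cnj u + cnj z0)) = (u * cnj u) * z0 * (u + z0) + (z0 * cnj z0) * u * (u + z0)"
        by (simp add: algebra_simps)
      then show ?thesis
        unfolding z_def u_def[symmetric] using cc[OF nu] cc[OF z0] by (simp add: algebra_simps)
    qed
    have ee: "e v * e v = u"
    proof -
      have n2: "z v * cnj (z v) = complex_of_real ((norm (z v))\<^sup>2)" by (simp only: complex_norm_square)
      have "e v * e v = (inverse (norm (z v)) * inverse (norm (z v))) *\<^sub>R (z v * z v * cnj (e0 * e0))"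
        by (simp add: e_def sq)
      also have "\<dots> = (inverse (norm (z v)) * inverse (norm (z v))) *\<^sub>R (u * (z0 * cnj z0) * complex_of_real ((norm (z v))\<^sup>2))"
        by (simp only: zz e0 n2) (simp only: mult_ac)
      also have "\<dots> = u" using zne cc[OF z0] by (simp add: scaleR_conv_of_real power2_eq_square field_simps)
      finally show ?thesis .
    qed
    have "e v * cnj (f v) = (e v * e v) * cnj (X v)" by (simp add: f_def mult_ac)
    also have "\<dots> = Z v * (X v * cnj (X v))" unfolding ee u_def by (simp only: mult_ac)
    finally have ec: "e v * cnj (f v) = Z v" using cc[OF nX] by simp
    have "e v * f v = X v * (e v * cnj (e v))" by (simp add: f_def mult_ac)
    then have ef: "e v * f v = X v" using cc[OF ne] by simp
    have "norm (f v) = 1" using nX ne by (simp add: f_def norm_mult)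
    moreover have "null_vec (e v) (f v) = v"
      by (rule vec4_eqI) (simp_all only: null_vec_nth ec ef, simp_all add: X_def Z_def)
    ultimately show ?thesis using ne by blast
  qed
  show ?thesis
    by (rule exI[of _ T], rule exI[of _ "\<lambda>v. (e v, f v)"])
      (use opT v0T smooth_on_Pair[OF sme smf] main in auto)
qed

lemma bounded_bilinear_minner: "bounded_bilinear minner"
  unfolding bilinear_conv_bounded_bilinear[symmetric] bilinear_def
  by (auto intro!: linearI simp: minner_def algebra_simps)

text \<open>The assumption \<open>rank\<close>, the vanishing of all minors, says that the values of \<open>\<omega>\<close> at a point lie on a
  line.  So \<open>\<omega> = \<eta> v\<close> with \<open>v \<bullet> v = 2\<close>.  As \<open>v\<close> is orthogonal to its derivatives, pairing the
  closed form \<open>\<omega>\<close> with \<open>v\<close> shows that \<open>\<eta>\<close> is closed, whence \<open>\<eta> = ds\<close>.  Then \<open>d\<omega> = 0\<close> reduces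
  to \<open>dv \<and> ds = 0\<close>, which means that \<open>v\<close> depends on \<open>s\<close> only.\<close>

lemma null_wave_of_closed_form:
  fixes \<omega> :: "lorentz \<Rightarrow> lorentz \<Rightarrow> real ^ 4"
  assumes \<Omega>: "open \<Omega>" "x0 \<in> \<Omega>"
    and lin: "\<And>x. x \<in> \<Omega> \<Longrightarrow> linear (\<omega> x)"
    and sm: "\<And>h. smooth_on \<Omega> (\<lambda>x. \<omega> x h)"
    and closed: "\<And>x h k. x \<in> \<Omega> \<Longrightarrow> fderiv (\<lambda>y. \<omega> y h) x k = fderiv (\<lambda>y. \<omega> y k) x h"
    and rank: "\<And>x h k i j. x \<in> \<Omega> \<Longrightarrow> \<omega> x h $ i * \<omega> x k $ j = \<omega> x h $ j * \<omega> x k $ i"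
    and null: "\<And>x h. x \<in> \<Omega> \<Longrightarrow> minner (\<omega> x h) (\<omega> x h) = 0"
    and ne: "\<omega> x0 h0 \<noteq> 0"
  shows "\<exists>B w. open B \<and> x0 \<in> B \<and> B \<subseteq> \<Omega> \<and> null_wave B w \<and>
     (\<forall>x\<in>B. \<forall>h. \<omega> x h = fst (fderiv w x h) *\<^sub>R direction (w x))"
proof -
  define n where "n x = \<omega> x h0" for x
  have smn: "smooth_on \<Omega> n" unfolding n_def by (rule sm)
  have "\<forall>\<^sub>F x in nhds x0. x \<in> \<Omega> \<and> n x \<noteq> 0"
  proof -
    have "open {x \<in> \<Omega>. n x \<noteq> 0}"
    proof -
      have "{x \<in> \<Omega>. n x \<noteq> 0} = \<Omega> \<inter> n -` (- {0})" by auto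
      then show ?thesis
        using continuous_open_preimage[OF smooth_on_continuous_on[OF smn] \<Omega>(1), of "- {0}"] by (simp add: open_Compl)
    qed
    from eventually_nhds_in_open[OF this, of x0] show ?thesis using \<Omega>(2) ne by (simp add: n_def)
  qed
  then obtain r where r: "r > 0" "\<And>x. x \<in> ball x0 r \<Longrightarrow> x \<in> \<Omega> \<and> n x \<noteq> 0"
    unfolding eventually_nhds_metric by (auto simp: dist_commute)
  define B where "B = ball x0 r"
  have B: "open B" "convex B" "x0 \<in> B" "B \<subseteq> \<Omega>" "\<And>x. x \<in> B \<Longrightarrow> n x \<noteq> 0"
    using r by (auto simp: B_def)
  have smB: "smooth_on B n" "\<And>h. smooth_on B (\<lambda>x. \<omega> x h)"
    using smn sm smooth_on_subset B by blast+
  \<comment> \<open>The length is normalized to \<open>sqrt 2\<close> because this is the length of \<open>null_vec e f\<close> for unit \<open>e\<close>, \<open>f\<close>.\<close>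
  define v where "v x = (sqrt 2 * inverse (sqrt (n x \<bullet> n x))) *\<^sub>R n x" for x
  have smv: "smooth_on B v" unfolding v_def
    by (intro smooth_on_scaleR smooth_on_mult smooth_on_inverse smooth_on_sqrt smooth_on_inner smB
        smooth_on_const B(1)) (use B(5) in auto)
  have vv: "v x \<bullet> v x = 2" if "x \<in> B" for x
  proof -
    have pos: "n x \<bullet> n x > 0" using B(5)[OF that] by simp
    then have "inverse (sqrt (n x \<bullet> n x)) * inverse (sqrt (n x \<bullet> n x)) * (n x \<bullet> n x) = 1"
      by (metis abs_of_pos inverse_mult_distrib less_numeral_extra(3) left_inverse real_sqrt_mult_self)
    then show ?thesis by (simp add: v_def) (simp add: mult_ac)
  qed
  have nullv: "minner (v x) (v x) = 0" if "x \<in> B" for x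
  proof -
    have "minner (n x) (n x) = 0" unfolding n_def using null that B(4) by blast
    then show ?thesis
      unfolding v_def bounded_bilinear.scaleR_left[OF bounded_bilinear_minner]
        bounded_bilinear.scaleR_right[OF bounded_bilinear_minner] by simp
  qed
  define \<eta> where "\<eta> x h = (v x \<bullet> \<omega> x h) * (1/2)" for x h
  have \<omega>: "\<omega> x h = \<eta> x h *\<^sub>R v x" if x: "x \<in> B" for x h
  proof -
    have minor: "v x $ j * \<omega> x h $ i = v x $ i * \<omega> x h $ j" for i j
      using rank[of x h0 j h i] x B(4) by (auto simp: v_def n_def)
    have "2 * \<omega> x h $ i = 2 * (\<eta> x h * v x $ i)" for i
    proof -
      have "2 * \<omega> x h $ i = (\<Sum>j\<in>UNIV. v x $ j * v x $ j) * \<omega> x h $ i"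
        using vv[OF x] by (simp add: inner_vec_def)
      also have "\<dots> = (\<Sum>j\<in>UNIV. v x $ j * (v x $ j * \<omega> x h $ i))"
        by (simp add: sum_distrib_right mult.assoc)
      also have "\<dots> = (\<Sum>j\<in>UNIV. v x $ j * \<omega> x h $ j) * v x $ i"
      proof -
        have "v x $ j * (v x $ j * \<omega> x h $ i) = v x $ j * \<omega> x h $ j * v x $ i" for j
          unfolding mult.assoc by (simp only: minor[of j]) (simp only: mult_ac)
        then show ?thesis by (simp only: sum_distrib_right)
      qed
      also have "\<dots> = 2 * (\<eta> x h * v x $ i)" by (simp add: \<eta>_def inner_vec_def)
      finally show ?thesis .
    qed
    then show ?thesis by (simp add: vec_eq_iff)
  qed
  have sm\<eta>: "smooth_on B (\<lambda>x. \<eta> x h)" for h unfolding \<eta>_def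
    by (intro smooth_on_mult smooth_on_inner smv smB smooth_on_const B(1))
  have diffv: "v differentiable at x" and diff\<eta>: "\<And>h. (\<lambda>y. \<eta> y h) differentiable at x"
    and diff\<omega>: "\<And>h. (\<lambda>y. \<omega> y h) differentiable at x" if "x \<in> B" for x
    using that smv sm\<eta> smB smooth_on_differentiable by blast+
  have dv: "v x \<bullet> fderiv v x k = 0" if x: "x \<in> B" for x k
  proof -
    have "fderiv (\<lambda>y. v y \<bullet> v y) x = fderiv (\<lambda>y. 2 :: real) x"
      by (rule fderiv_cong_open[OF B(1) x vv])
    moreover have "fderiv (\<lambda>y. 2 :: real) x k = 0" by simp
    ultimately have "v x \<bullet> fderiv v x k + fderiv v x k \<bullet> v x = 0"
      using fderiv_inner[OF diffv[OF x] diffv[OF x], of k] by simp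
    then show ?thesis by (simp add: inner_commute)
  qed
  have \<eta>closed: "fderiv (\<lambda>y. \<eta> y h) x k = fderiv (\<lambda>y. \<eta> y k) x h" if x: "x \<in> B" for x h k
  proof -
    have "fderiv (\<lambda>y. \<eta> y h) x k = (v x \<bullet> fderiv (\<lambda>y. \<omega> y h) x k) * (1/2)" for h k
    proof -
      have d: "(\<lambda>y. v y \<bullet> \<omega> y h) differentiable at x"
        using smooth_on_differentiable[OF smooth_on_inner[OF smv smB(2)] x] .
      have "fderiv (\<lambda>y. \<eta> y h) x k = fderiv (\<lambda>y. v y \<bullet> \<omega> y h) x k * (1/2)"
        unfolding \<eta>_def by (subst fderiv_linear_compose[OF bounded_linear_mult_left d]) simp
      also have "\<dots> = (v x \<bullet> fderiv (\<lambda>y. \<omega> y h) x k + fderiv v x k \<bullet> \<omega> x h) * (1/2)"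
        by (simp add: fderiv_inner[OF diffv[OF x] diff\<omega>[OF x]])
      also have "fderiv v x k \<bullet> \<omega> x h = 0"
        using dv[OF x, of k] by (simp add: \<omega>[OF x] inner_commute)
      finally show ?thesis by simp
    qed
    then show ?thesis using closed x B(4) by (metis subsetD)
  qed
  have "\<exists>s. \<forall>x\<in>B. (s has_derivative \<eta> x) (at x)"
  proof (rule poincare_lemma[OF B(1,2), where \<omega>'="\<lambda>x h k. fderiv (\<lambda>y. \<eta> y h) x k"])
    show "linear (\<eta> x)" if "x \<in> B" for x
    proof -
      have "linear (\<omega> x)" using lin that B(4) by blast
      then show ?thesis unfolding \<eta>_def
        by (auto intro!: linearI simp: linear_add linear_cmul inner_add_right algebra_simps)
    qed
    show "((\<lambda>y. \<eta> y h) has_derivative fderiv (\<lambda>y. \<eta> y h) x) (at x)" if "x \<in> B" for x h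
      using smooth_on_has_derivative[OF sm\<eta> that] .
    show "continuous_on B (\<lambda>x. fderiv (\<lambda>y. \<eta> y h) x k)" for h k
      by (rule smooth_on_continuous_on[OF smooth_on_fderiv[OF sm\<eta>]])
  qed (rule \<eta>closed)
  then obtain s where s: "\<And>x. x \<in> B \<Longrightarrow> (s has_derivative \<eta> x) (at x)" by blast
  have sms: "smooth_on B s" by (rule smooth_on_if_derivative[OF B(1) s sm\<eta>])
  have kill: "fderiv v x k = 0" if x: "x \<in> B" and k: "\<eta> x k = 0" for x k
  proof -
    have "fderiv (\<lambda>y. \<omega> y h) x k = \<eta> x h *\<^sub>R fderiv v x k + fderiv (\<lambda>y. \<eta> y h) x k *\<^sub>R v x" for h k
    proof -
      have "fderiv (\<lambda>y. \<omega> y h) x = fderiv (\<lambda>y. \<eta> y h *\<^sub>R v y) x"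
        by (rule fderiv_cong_open[OF B(1) x \<omega>])
      then show ?thesis by (simp add: fderiv_scaleR[OF diff\<eta>[OF x] diffv[OF x]])
    qed
    from this[of h0 k] this[of k h0] have "\<eta> x h0 *\<^sub>R fderiv v x k = \<eta> x k *\<^sub>R fderiv v x h0"
      using closed[of x h0 k] \<eta>closed[OF x, of h0 k] x B(4) by auto
    then have "\<eta> x h0 = 0 \<or> fderiv v x k = 0" using k by simp
    moreover have "\<eta> x h0 \<noteq> 0"
      using \<omega>[OF x, of h0] B(5)[OF x] by (auto simp: n_def)
    ultimately show ?thesis by blast
  qed
  obtain T \<Psi> where T: "open T" "v x0 \<in> T" "smooth_on T \<Psi>"
    "\<And>u. u \<in> T \<Longrightarrow> minner u u = 0 \<Longrightarrow> u \<bullet> u = 2 \<Longrightarrow>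
        norm (fst (\<Psi> u)) = 1 \<and> norm (snd (\<Psi> u)) = 1 \<and> null_vec (fst (\<Psi> u)) (snd (\<Psi> u)) = u"
    using null_vec_section[OF nullv[OF B(3)] vv[OF B(3)]] by metis
  define B' where "B' = B \<inter> v -` T"
  have B': "open B'" "x0 \<in> B'" "B' \<subseteq> B" "v ` B' \<subseteq> T"
    using continuous_open_preimage[OF smooth_on_continuous_on[OF smv] B(1) T(1)] B(3) T(2) by (auto simp: B'_def)
  define w where "w x = (s x, \<Psi> (v x))" for x
  have sm\<Psi>: "smooth_on B' (\<lambda>x. \<Psi> (v x))"
    by (rule smooth_on_compose[OF T(3) smooth_on_subset[OF smv B'(1,3)] B'(4)])
  have smw: "smooth_on B' w" unfolding w_def
    by (intro smooth_on_Pair sm\<Psi> smooth_on_subset[OF sms B'(1,3)])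
  have dw: "fderiv w x = (\<lambda>h. (\<eta> x h, fderiv \<Psi> (v x) (fderiv v x h)))" if "x \<in> B'" for x
    unfolding w_def
  proof (rule fderiv_eqI, rule has_derivative_Pair)
    show "(s has_derivative \<eta> x) (at x)" using s that B'(3) by blast
    show "((\<lambda>x. \<Psi> (v x)) has_derivative (\<lambda>h. fderiv \<Psi> (v x) (fderiv v x h))) (at x)"
    proof (rule has_derivative_compose[of v _ x UNIV \<Psi>])
      show "(v has_derivative fderiv v x) (at x)"
        using smooth_on_has_derivative[OF smv] that B'(3) by blast
      show "(\<Psi> has_derivative fderiv \<Psi> (v x)) (at (v x))"
        using smooth_on_has_derivative[OF T(3)] that B'(4) by blast
    qed
  qed
  have "null_wave B' w"
    unfolding null_wave_def
  proof (intro conjI ballI allI impI smw)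
    fix x assume x: "x \<in> B'"
    then have xB: "x \<in> B" "v x \<in> T" using B' by auto
    show "norm (fst (snd (w x))) = 1" "norm (snd (snd (w x))) = 1"
      using T(4)[OF xB(2) nullv[OF xB(1)] vv[OF xB(1)]] by (auto simp: w_def)
    fix h assume "fst (fderiv w x h) = 0"
    then have "\<eta> x h = 0" by (simp add: dw[OF x])
    moreover have "linear (fderiv \<Psi> (v x))" using smooth_on_linear_fderiv[OF T(3) xB(2)] .
    ultimately show "fderiv w x h = 0" by (simp add: dw[OF x] kill[OF xB(1)] linear_0 zero_prod_def)
  qed
  moreover have "\<omega> x h = fst (fderiv w x h) *\<^sub>R direction (w x)" if x: "x \<in> B'" for x h
  proof -
    have xB: "x \<in> B" "v x \<in> T" using B' x by auto
    have "direction (w x) = v x"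
      using T(4)[OF xB(2) nullv[OF xB(1)] vv[OF xB(1)]] by (simp add: direction_def w_def)
    then show ?thesis by (simp add: dw[OF x] \<omega>[OF xB(1)])
  qed
  ultimately show ?thesis using B' B(4) by (intro exI[of _ B'] exI[of _ w]) auto
qed

lemma null_wave_subset: "null_wave B w \<Longrightarrow> open B' \<Longrightarrow> B' \<subseteq> B \<Longrightarrow> null_wave B' w"
  unfolding null_wave_def using smooth_on_subset by blast

section \<open>Null frames of a minimal Lorentzian surface\<close>

lemmas minner_linear =
  bounded_bilinear.add_left[OF bounded_bilinear_minner] bounded_bilinear.add_right[OF bounded_bilinear_minner]
  bounded_bilinear.diff_left[OF bounded_bilinear_minner] bounded_bilinear.diff_right[OF bounded_bilinear_minner]
  bounded_bilinear.scaleR_left[OF bounded_bilinear_minner] bounded_bilinear.scaleR_right[OF bounded_bilinear_minner]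
  bounded_bilinear.minus_left[OF bounded_bilinear_minner] bounded_bilinear.minus_right[OF bounded_bilinear_minner]

lemma minner_zero [simp]: "minner 0 x = 0" "minner x 0 = 0"
  by (simp_all add: minner_def)

lemma minner_commute: "minner x y = minner y x"
  by (simp add: minner_def)

lemmas fderiv_minner = fderiv_bilinear[OF bounded_bilinear_minner]
lemmas smooth_on_minner = smooth_on_bilinear[OF bounded_bilinear_minner]

lemma pullback_metric_components:
  assumes "linear (fderiv f x)"
  shows "pullback_metric f x h k =
    lRe h * lRe k * pullback_metric f x 1 1 + (lRe h * lIm k + lIm h * lRe k) * pullback_metric f x 1 lsigma
     + lIm h * lIm k * pullback_metric f x lsigma lsigma"
  unfolding pullback_metric_def linear_lorentz_expand[OF assms, of h] linear_lorentz_expand[OF assms, of k]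
  by (simp add: minner_linear minner_commute[of "fderiv f x lsigma" "fderiv f x 1"] algebra_simps)

lemma signature_1_1_discriminant:
  assumes lin: "linear (fderiv f x)" and sig: "signature_1_1 (pullback_metric f x)"
  shows "(pullback_metric f x 1 lsigma)\<^sup>2 - pullback_metric f x 1 1 * pullback_metric f x lsigma lsigma > 0"
proof -
  obtain e1 e2 where e: "pullback_metric f x e1 e1 = 1" "pullback_metric f x e2 e2 = - 1" "pullback_metric f x e1 e2 = 0"
    using sig by (auto simp: signature_1_1_def)
  define E F G where "E = pullback_metric f x 1 1" and "F = pullback_metric f x 1 lsigma"
    and "G = pullback_metric f x lsigma lsigma"
  define d where "d = lRe e1 * lIm e2 - lIm e1 * lRe e2"
  have "(F\<^sup>2 - E * G) * d\<^sup>2 = (pullback_metric f x e1 e2)\<^sup>2 - pullback_metric f x e1 e1 * pullback_metric f x e2 e2"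
    unfolding pullback_metric_components[OF lin, of e1 e2] pullback_metric_components[OF lin, of e1 e1]
      pullback_metric_components[OF lin, of e2 e2] E_def[symmetric] F_def[symmetric] G_def[symmetric] d_def
    by algebra
  also have "\<dots> = 1" by (simp add: e)
  finally have "(F\<^sup>2 - E * G) * d\<^sup>2 > 0" by simp
  then show ?thesis
    unfolding E_def F_def G_def by (simp add: zero_less_mult_iff)
qed

lemma gram_solve:
  fixes u v :: "real ^ 4"
  assumes det: "(minner u v)\<^sup>2 - minner u u * minner v v \<noteq> 0"
    and "minner (a *\<^sub>R u + b *\<^sub>R v) u = 0" "minner (a *\<^sub>R u + b *\<^sub>R v) v = 0"
  shows "a = 0 \<and> b = 0"
proof -
  have 1: "a * minner u u + b * minner u v = 0" "a * minner u v + b * minner v v = 0"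
    using assms(2,3) by (simp_all add: minner_linear minner_commute[of v u])
  have "a * ((minner u v)\<^sup>2 - minner u u * minner v v) = 0"
    "b * ((minner u v)\<^sup>2 - minner u u * minner v v) = 0"
    using 1 by algebra+
  then show ?thesis using det by simp
qed

text \<open>On a nondegenerate tangent plane the Gram matrix is invertible, so that the tangential coefficients
  of \<open>X\<close> are products of \<open>X\<close> with fixed vectors \<open>a\<close> and \<open>b\<close>.\<close>

lemma normal_part_eq:
  assumes lin: "linear (fderiv f x)"
    and det: "(minner (fderiv f x 1) (fderiv f x lsigma))\<^sup>2
      - minner (fderiv f x 1) (fderiv f x 1) * minner (fderiv f x lsigma) (fderiv f x lsigma) \<noteq> 0"
  shows "\<exists>a b. \<forall>X. normal_part f x X = X - (minner X a *\<^sub>R fderiv f x 1 + minner X b *\<^sub>R fderiv f x lsigma)"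
proof -
  define u v where "u = fderiv f x 1" and "v = fderiv f x lsigma"
  define E F G where "E = minner u u" and "F = minner u v" and "G = minner v v"
  define D where "D = F\<^sup>2 - E * G"
  have D: "D \<noteq> 0" using det by (simp add: D_def E_def F_def G_def u_def v_def)
  have exp: "fderiv f x h = lRe h *\<^sub>R u + lIm h *\<^sub>R v" for h
    unfolding u_def v_def by (rule linear_lorentz_expand[OF lin])
  define a where "a = (1 / D) *\<^sub>R (F *\<^sub>R v - G *\<^sub>R u)"
  define b where "b = (1 / D) *\<^sub>R (F *\<^sub>R u - E *\<^sub>R v)"
  have "normal_part f x X = X - (minner X a *\<^sub>R u + minner X b *\<^sub>R v)" for X
    unfolding normal_part_def
  proof (rule the_equality)
    define n where "n = X - (minner X a *\<^sub>R u + minner X b *\<^sub>R v)"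
    have Xa: "D * minner X a = F * minner X v - G * minner X u"
      and Xb: "D * minner X b = F * minner X u - E * minner X v"
      using D by (simp_all add: a_def b_def minner_linear)
    have "D * minner n u = D * minner X u - (D * minner X a * E + D * minner X b * F)"
      "D * minner n v = D * minner X v - (D * minner X a * F + D * minner X b * G)"
      by (simp_all add: n_def minner_linear E_def F_def G_def minner_commute[of v u] algebra_simps)
    then have "D * minner n u = 0" "D * minner n v = 0"
      unfolding Xa Xb unfolding D_def by algebra+
    then have nn: "minner n u = 0" "minner n v = 0" using D by auto
    have "X - n = fderiv f x (Lor (minner X a) (minner X b))" by (simp add: n_def exp)
    then have "X - n \<in> range (fderiv f x)" by (metis rangeI)
    then show conj: "X - n \<in> range (fderiv f x) \<and> (\<forall>Y. minner n (fderiv f x Y) = 0)"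
      using nn by (simp add: exp minner_linear)
    fix m assume m: "X - m \<in> range (fderiv f x) \<and> (\<forall>Y. minner m (fderiv f x Y) = 0)"
    obtain h k where hk: "X - m = fderiv f x h" "X - n = fderiv f x k" using m conj by blast
    have "n - m = fderiv f x h - fderiv f x k" using hk by (simp add: algebra_simps)
    then have nm: "n - m = (lRe h - lRe k) *\<^sub>R u + (lIm h - lIm k) *\<^sub>R v"
      unfolding exp by (simp add: algebra_simps)
    have "minner (n - m) u = 0" "minner (n - m) v = 0"
      using m nn by (simp_all add: minner_linear u_def v_def)
    then have "lRe h - lRe k = 0 \<and> lIm h - lIm k = 0"
      unfolding nm by (intro gram_solve) (use D in \<open>auto simp: D_def E_def F_def G_def\<close>)
    then show "m = n" using nm by simp
  qed
  then show ?thesis unfolding u_def v_def by blast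
qed

lemma minimal_tangential:
  assumes lin: "linear (fderiv f x)" and sig: "signature_1_1 (pullback_metric f x)"
    and H: "mean_curvature f x = 0"
  shows "\<exists>a b. pullback_metric f x lsigma lsigma *\<^sub>R fderiv (\<lambda>y. fderiv f y 1) x 1
      - (2 * pullback_metric f x 1 lsigma) *\<^sub>R fderiv (\<lambda>y. fderiv f y lsigma) x 1
      + pullback_metric f x 1 1 *\<^sub>R fderiv (\<lambda>y. fderiv f y lsigma) x lsigma
      = a *\<^sub>R fderiv f x 1 + b *\<^sub>R fderiv f x lsigma"
proof -
  define u v where "u = fderiv f x 1" and "v = fderiv f x lsigma"
  define E F G where "E = pullback_metric f x 1 1" and "F = pullback_metric f x 1 lsigma"
    and "G = pullback_metric f x lsigma lsigma"
  define P where "P = fderiv (\<lambda>y. fderiv f y 1) x 1"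
  define Q where "Q = fderiv (\<lambda>y. fderiv f y lsigma) x 1"
  define R where "R = fderiv (\<lambda>y. fderiv f y lsigma) x lsigma"
  have det: "F\<^sup>2 - E * G > 0" using signature_1_1_discriminant[OF lin sig] by (simp add: E_def F_def G_def)
  then obtain a b where ab: "\<And>X. normal_part f x X = X - (minner X a *\<^sub>R u + minner X b *\<^sub>R v)"
    using normal_part_eq[OF lin] unfolding E_def F_def G_def u_def v_def pullback_metric_def by force
  have "(1 / (2 * (E * G - F\<^sup>2))) *\<^sub>R (G *\<^sub>R normal_part f x P - (2 * F) *\<^sub>R normal_part f x Q
      + E *\<^sub>R normal_part f x R) = 0"
    using H by (simp add: mean_curvature_def second_fundamental_form_def Let_def E_def F_def G_def P_def Q_def R_def)
  then have "G *\<^sub>R normal_part f x P - (2 * F) *\<^sub>R normal_part f x Q + E *\<^sub>R normal_part f x R = 0"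
    using det by simp
  then have "G *\<^sub>R P - (2 * F) *\<^sub>R Q + E *\<^sub>R R
     = (G * minner P a - 2 * F * minner Q a + E * minner R a) *\<^sub>R u
       + (G * minner P b - 2 * F * minner Q b + E * minner R b) *\<^sub>R v"
    unfolding ab by (simp add: algebra_simps)
  then show ?thesis unfolding P_def Q_def R_def u_def v_def E_def F_def G_def by blast
qed

text \<open>In the coordinates \<open>u + \<sigma>v\<close> let \<open>E, F, G\<close> be the coefficients of the induced metric and
  \<open>r\<^sup>2 = F\<^sup>2 - E G\<close>.  The endomorphism \<open>J\<close> that is \<open>1\<close> on one null line and \<open>-1\<close> on the other maps
  \<open>\<partial>\<^sub>u\<close> to \<open>(E \<partial>\<^sub>v - F \<partial>\<^sub>u) / r\<close> and \<open>\<partial>\<^sub>v\<close> to \<open>(F \<partial>\<^sub>v - G \<partial>\<^sub>u) / r\<close>; the fields \<open>A\<close> and \<open>C\<close> below are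
  \<open>df (J \<partial>\<^sub>u)\<close> and \<open>df (J \<partial>\<^sub>v)\<close>.  The exterior derivative of \<open>df \<circ> J\<close> is the Laplacian of \<open>f\<close> up to a
  factor.  It is tangential by minimality.  It is also normal, as one sees by differentiating the products of
  \<open>A\<close> and \<open>C\<close> with \<open>df \<partial>\<^sub>u\<close> and \<open>df \<partial>\<^sub>v\<close>, which are \<open>0\<close> or \<open>\<plusminus> r\<close>.  So it vanishes, and the forms \<open>(df \<plusminus> df \<circ> J) / 2\<close>
  are closed with values in the two null lines.\<close>

lemma minimal_null_frame_exists:
  assumes sm: "smooth_on \<Omega> f" and x0: "x0 \<in> \<Omega>"
    and sig: "\<And>x. x \<in> \<Omega> \<Longrightarrow> signature_1_1 (pullback_metric f x)"
    and H: "\<And>x. x \<in> \<Omega> \<Longrightarrow> mean_curvature f x = 0"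
  shows "\<exists>B w1 w2. open B \<and> x0 \<in> B \<and> B \<subseteq> \<Omega> \<and> null_frame B f w1 w2"
proof -
  have op: "open \<Omega>" using smooth_on_open[OF sm] .
  have lin: "linear (fderiv f x)" if "x \<in> \<Omega>" for x using smooth_on_linear_fderiv[OF sm that] .
  define u where "u x = fderiv f x 1" for x
  define v where "v x = fderiv f x lsigma" for x
  define E where "E x = minner (u x) (u x)" for x
  define F where "F x = minner (u x) (v x)" for x
  define G where "G x = minner (v x) (v x)" for x
  have exp: "fderiv f x h = lRe h *\<^sub>R u x + lIm h *\<^sub>R v x" if "x \<in> \<Omega>" for x h
    unfolding u_def v_def by (rule linear_lorentz_expand[OF lin[OF that]])
  have disc: "(F x)\<^sup>2 - E x * G x > 0" if "x \<in> \<Omega>" for x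
    using signature_1_1_discriminant[OF lin[OF that] sig[OF that]]
    by (simp add: E_def F_def G_def u_def v_def pullback_metric_def)
  define r where "r x = sqrt (F x * F x - E x * G x)" for x
  have rpos: "r x > 0" and rr: "r x * r x = F x * F x - E x * G x" if "x \<in> \<Omega>" for x
    using disc[OF that] by (auto simp: r_def power2_eq_square)
  have smu: "smooth_on \<Omega> u" and smv: "smooth_on \<Omega> v"
    unfolding u_def v_def by (intro smooth_on_fderiv sm)+
  have smE: "smooth_on \<Omega> E" and smF: "smooth_on \<Omega> F" and smG: "smooth_on \<Omega> G"
    unfolding E_def F_def G_def by (intro smooth_on_minner smu smv)+
  have smr: "smooth_on \<Omega> r" unfolding r_def
    by (intro smooth_on_sqrt smooth_on_diff smooth_on_mult smE smF smG)
      (use disc in \<open>auto simp: power2_eq_square\<close>)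
  define ir where "ir x = inverse (r x)" for x
  have smir: "smooth_on \<Omega> ir" unfolding ir_def
    by (intro smooth_on_inverse smr) (use rpos in force)
  have ir: "r x * ir x = 1" if "x \<in> \<Omega>" for x using rpos[OF that] by (simp add: ir_def)
  define a1 where "a1 x = - (F x * ir x)" for x
  define a2 where "a2 x = E x * ir x" for x
  define c1 where "c1 x = - (G x * ir x)" for x
  define c2 where "c2 x = F x * ir x" for x
  have smc: "smooth_on \<Omega> a1" "smooth_on \<Omega> a2" "smooth_on \<Omega> c1" "smooth_on \<Omega> c2"
    unfolding a1_def a2_def c1_def c2_def by (intro smooth_on_minus smooth_on_mult smE smF smG smir)+
  define A where "A x = a1 x *\<^sub>R u x + a2 x *\<^sub>R v x" for x
  define C where "C x = c1 x *\<^sub>R u x + c2 x *\<^sub>R v x" for x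
  have smA: "smooth_on \<Omega> A" and smC: "smooth_on \<Omega> C" unfolding A_def C_def
    by (intro smooth_on_add smooth_on_scaleR smc smu smv)+
  have closed: "fderiv C x 1 = fderiv A x lsigma" if x: "x \<in> \<Omega>" for x
  proof -
    note diff = smooth_on_differentiable[OF _ x]
    note df = diff[OF smu] diff[OF smv] diff[OF smE] diff[OF smF] diff[OF smG] diff[OF smr]
      diff[OF smc(1)] diff[OF smc(2)] diff[OF smc(3)] diff[OF smc(4)] diff[OF smA] diff[OF smC]
    define uu where "uu = fderiv u x 1"
    define uv where "uv = fderiv v x 1"
    define vv where "vv = fderiv v x lsigma"
    have vu: "fderiv u x lsigma = uv"
      unfolding uv_def u_def v_def using second_derivative_symmetric[OF sm x, of 1 lsigma] .
    obtain \<alpha> \<beta> where \<alpha>\<beta>: "G x *\<^sub>R uu - (2 * F x) *\<^sub>R uv + E x *\<^sub>R vv = \<alpha> *\<^sub>R u x + \<beta> *\<^sub>R v x"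
      using minimal_tangential[OF lin[OF x] sig[OF x] H[OF x]]
      unfolding uu_def uv_def vv_def u_def v_def E_def F_def G_def pullback_metric_def by blast
    \<comment> \<open>\<open>K\<close> is tangential by \<open>\<alpha>\<beta>\<close>, and normal by the derivatives of the relations
      \<open>Cu\<close>, \<open>Cv\<close>, \<open>Au\<close> and \<open>Av\<close> below.\<close>
    define K where "K = fderiv C x 1 - fderiv A x lsigma"
    have dC: "fderiv C x 1 = c1 x *\<^sub>R uu + fderiv c1 x 1 *\<^sub>R u x + (c2 x *\<^sub>R uv + fderiv c2 x 1 *\<^sub>R v x)"
      unfolding C_def uu_def uv_def
      by (simp add: fderiv_add fderiv_scaleR df smooth_on_differentiable[OF smooth_on_scaleR x] smc smu smv)
    have dA: "fderiv A x lsigma = a1 x *\<^sub>R uv + fderiv a1 x lsigma *\<^sub>R u x + (a2 x *\<^sub>R vv + fderiv a2 x lsigma *\<^sub>R v x)"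
      unfolding A_def vu[symmetric] vv_def
      by (simp add: fderiv_add fderiv_scaleR df smooth_on_differentiable[OF smooth_on_scaleR x] smc smu smv)
    have K_tan: "K = (fderiv c1 x 1 - fderiv a1 x lsigma - ir x * \<alpha>) *\<^sub>R u x
        + (fderiv c2 x 1 - fderiv a2 x lsigma - ir x * \<beta>) *\<^sub>R v x"
    proof -
      have "K = - (ir x *\<^sub>R (G x *\<^sub>R uu - (2 * F x) *\<^sub>R uv + E x *\<^sub>R vv))
          + (fderiv c1 x 1 - fderiv a1 x lsigma) *\<^sub>R u x + (fderiv c2 x 1 - fderiv a2 x lsigma) *\<^sub>R v x"
        unfolding K_def dC dA a1_def a2_def c1_def c2_def by (simp add: vec_eq_iff algebra_simps)
      then show ?thesis unfolding \<alpha>\<beta> by (simp add: algebra_simps)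
    qed
    have dE: "fderiv E x 1 = 2 * minner uu (u x)" "fderiv E x lsigma = 2 * minner uv (u x)"
      and dF: "fderiv F x 1 = minner uu (v x) + minner uv (u x)" "fderiv F x lsigma = minner uv (v x) + minner vv (u x)"
      and dG: "fderiv G x 1 = 2 * minner uv (v x)" "fderiv G x lsigma = 2 * minner vv (v x)"
      unfolding E_def F_def G_def
      by (simp_all add: fderiv_minner df vu uu_def[symmetric] uv_def[symmetric] vv_def[symmetric] minner_commute)
    have dr: "2 * r x * fderiv r x k = 2 * F x * fderiv F x k - (fderiv E x k * G x + E x * fderiv G x k)" for k
    proof -
      have eq: "fderiv (\<lambda>y. r y * r y) x = fderiv (\<lambda>y. F y * F y - E y * G y) x"
        by (rule fderiv_cong_open[OF op x rr])
      have "((\<lambda>y. F y * F y - E y * G y) has_derivative (\<lambda>k. (F x * fderiv F x k + fderiv F x k * F x)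
          - (E x * fderiv G x k + fderiv E x k * G x))) (at x)"
        by (intro has_derivative_diff has_derivative_mult)
          (use df frechet_derivative_works in blast)+
      from fderiv_eqI[OF this] have "fderiv (\<lambda>y. r y * r y) x k =
         (F x * fderiv F x k + fderiv F x k * F x) - (E x * fderiv G x k + fderiv E x k * G x)"
        unfolding eq by simp
      moreover have "fderiv (\<lambda>y. r y * r y) x k = r x * fderiv r x k + fderiv r x k * r x"
        by (rule fderiv_bilinear[OF bounded_bilinear_mult diff[OF smr] diff[OF smr]])
      ultimately show ?thesis by (simp add: algebra_simps)
    qed
    have prod: "minner (fderiv W x k) (z x) + minner (W x) (fderiv z x k) = fderiv (\<lambda>y. q y) x k"
      if "smooth_on \<Omega> W" "smooth_on \<Omega> z" "\<And>y. y \<in> \<Omega> \<Longrightarrow> minner (W y) (z y) = q y" for W z q k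
    proof -
      have "fderiv (\<lambda>y. minner (W y) (z y)) x k = fderiv q x k"
        by (rule fun_cong[OF fderiv_cong_open[OF op x that(3)]])
      then show ?thesis using fderiv_minner[OF diff[OF that(1)] diff[OF that(2)], of k] by simp
    qed
    have Cu: "minner (C y) (u y) = r y" and Cv: "minner (C y) (v y) = 0"
      and Au: "minner (A y) (u y) = 0" and Av: "minner (A y) (v y) = - r y" if y: "y \<in> \<Omega>" for y
    proof -
      have e: "minner (C y) (u y) = (F y * F y - E y * G y) * ir y" "minner (C y) (v y) = 0"
        "minner (A y) (u y) = 0" "minner (A y) (v y) = - ((F y * F y - E y * G y) * ir y)"
        by (simp_all add: C_def A_def c1_def c2_def a1_def a2_def minner_linear E_def F_def G_def
            minner_commute[of "v y" "u y"] algebra_simps)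
      have "(F y * F y - E y * G y) * ir y = r y"
        unfolding rr[OF y, symmetric] using ir[OF y] by (simp add: mult.assoc)
      then show "minner (C y) (u y) = r y" "minner (C y) (v y) = 0"
        "minner (A y) (u y) = 0" "minner (A y) (v y) = - r y" using e by simp_all
    qed
    have dm: "fderiv (\<lambda>y. - r y) x k = - fderiv r x k" for k
      using fderiv_linear_compose[OF bounded_linear_minus[OF bounded_linear_ident] diff[OF smr]] by simp
    have 1: "minner (fderiv C x 1) (u x) + minner (C x) uu = fderiv r x 1"
      using prod[OF smC smu Cu, of 1] by (simp add: uu_def)
    have 2: "minner (fderiv C x 1) (v x) + minner (C x) uv = 0"
      using prod[OF smC smv Cv, of 1] by (simp add: uv_def)
    have 3: "minner (fderiv A x lsigma) (u x) + minner (A x) uv = 0"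
      using prod[OF smA smu Au, of lsigma] by (simp add: vu)
    have 4: "minner (fderiv A x lsigma) (v x) + minner (A x) vv = - fderiv r x lsigma"
      using prod[OF smA smv Av, of lsigma] by (simp add: vv_def dm)
    have rC: "r x * minner (C x) X = - G x * minner X (u x) + F x * minner X (v x)" for X
    proof -
      have "r x * minner (C x) X = (r x * ir x) * (- G x * minner X (u x) + F x * minner X (v x))"
        by (simp add: C_def c1_def c2_def minner_linear minner_commute algebra_simps)
      then show ?thesis by (simp add: ir[OF x])
    qed
    have rA: "r x * minner (A x) X = - F x * minner X (u x) + E x * minner X (v x)" for X
    proof -
      have "r x * minner (A x) X = (r x * ir x) * (- F x * minner X (u x) + E x * minner X (v x))"
        by (simp add: A_def a1_def a2_def minner_linear minner_commute algebra_simps)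
      then show ?thesis by (simp add: ir[OF x])
    qed
    have "r x * minner K (u x) = r x * fderiv r x 1 - r x * minner (C x) uu + r x * minner (A x) uv"
    proof -
      have "minner K (u x) = fderiv r x 1 - minner (C x) uu + minner (A x) uv"
        using 1 3 unfolding K_def minner_linear by linarith
      then show ?thesis by (simp only: distrib_left right_diff_distrib)
    qed
    also have "\<dots> = 0" using dr[of 1] unfolding rC rA dE dF dG by (simp add: algebra_simps)
    finally have Ku: "minner K (u x) = 0" using rpos[OF x] by simp
    have "r x * minner K (v x) = r x * fderiv r x lsigma - r x * minner (C x) uv + r x * minner (A x) vv"
    proof -
      have "minner K (v x) = fderiv r x lsigma - minner (C x) uv + minner (A x) vv"
        using 2 4 unfolding K_def minner_linear by linarith
      then show ?thesis by (simp only: distrib_left right_diff_distrib)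
    qed
    also have "\<dots> = 0" using dr[of lsigma] unfolding rC rA dE dF dG by (simp add: algebra_simps)
    finally have Kv: "minner K (v x) = 0" using rpos[OF x] by simp
    have "fderiv c1 x 1 - fderiv a1 x lsigma - ir x * \<alpha> = 0 \<and> fderiv c2 x 1 - fderiv a2 x lsigma - ir x * \<beta> = 0"
      using Ku Kv unfolding K_tan
      by (intro gram_solve) (use disc[OF x] in \<open>auto simp: E_def F_def G_def\<close>)
    then have "K = 0" unfolding K_tan by simp
    then show ?thesis by (simp add: K_def)
  qed
  define \<omega> where "\<omega> \<epsilon> x h = (1/2) *\<^sub>R (fderiv f x h + \<epsilon> *\<^sub>R (lRe h *\<^sub>R A x + lIm h *\<^sub>R C x))" for \<epsilon> :: real and x h
  have wave: "\<exists>B w. open B \<and> x0 \<in> B \<and> B \<subseteq> \<Omega> \<and> null_wave B w \<and>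
      (\<forall>x\<in>B. \<forall>h. \<omega> \<epsilon> x h = fst (fderiv w x h) *\<^sub>R direction (w x))" if \<epsilon>: "\<epsilon> * \<epsilon> = 1" for \<epsilon>
  proof -
    \<comment> \<open>\<open>p\<close> and \<open>q\<close> are twice the components of the projection \<open>(1 + \<epsilon> J) / 2\<close>; it has rank one because
      \<open>\<epsilon> J\<close> has square \<open>1\<close> and trace \<open>0\<close>.\<close>
    define p where "p x h = lRe h * (1 + \<epsilon> * a1 x) + lIm h * (\<epsilon> * c1 x)" for x h
    define q where "q x h = lRe h * (\<epsilon> * a2 x) + lIm h * (1 + \<epsilon> * c2 x)" for x h
    have \<omega>pq: "\<omega> \<epsilon> x h = (1/2) *\<^sub>R (p x h *\<^sub>R u x + q x h *\<^sub>R v x)" if "x \<in> \<Omega>" for x h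
      by (simp add: \<omega>_def exp[OF that] p_def q_def A_def C_def algebra_simps)
    have ne: "\<exists>h0. \<omega> \<epsilon> x0 h0 \<noteq> 0"
    proof (rule ccontr)
      assume "\<nexists>h0. \<omega> \<epsilon> x0 h0 \<noteq> 0"
      then have z: "p x0 h *\<^sub>R u x0 + q x0 h *\<^sub>R v x0 = 0" for h using \<omega>pq[OF x0, of h] by simp
      have "p x0 h = 0 \<and> q x0 h = 0" for h
        by (rule gram_solve[of "u x0" "v x0"]) (use disc[OF x0] z in \<open>auto simp: E_def F_def G_def\<close>)
      from this[of 1] this[of lsigma] have "1 + \<epsilon> * a1 x0 = 0" "1 + \<epsilon> * c2 x0 = 0"
        by (simp_all add: p_def q_def)
      moreover have "a1 x0 = - c2 x0" by (simp add: a1_def c2_def)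
      ultimately show False by simp
    qed
    then obtain h0 where h0: "\<omega> \<epsilon> x0 h0 \<noteq> 0" by blast
    show ?thesis
    proof (rule null_wave_of_closed_form[where \<omega>="\<omega> \<epsilon>", OF op x0 _ _ _ _ _ h0])
      fix x assume x: "x \<in> \<Omega>"
      show "linear (\<omega> \<epsilon> x)"
        unfolding \<omega>_def using lin[OF x]
        by (auto intro!: linearI simp: linear_add linear_cmul vec_eq_iff field_simps)
    next
      fix h show "smooth_on \<Omega> (\<lambda>x. \<omega> \<epsilon> x h)"
        unfolding \<omega>_def
        by (intro smooth_on_scaleR smooth_on_add smooth_on_fderiv sm smA smC smooth_on_const op)
    next
      fix x h k assume x: "x \<in> \<Omega>"
      have d: "fderiv (\<lambda>y. \<omega> \<epsilon> y h) x k = (1/2) *\<^sub>R (fderiv (\<lambda>y. fderiv f y h) x k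
           + \<epsilon> *\<^sub>R (lRe h *\<^sub>R fderiv A x k + lIm h *\<^sub>R fderiv C x k))" for h k
      proof -
        have "((\<lambda>y. \<omega> \<epsilon> y h) has_derivative (\<lambda>k. (1/2) *\<^sub>R (fderiv (\<lambda>y. fderiv f y h) x k
           + \<epsilon> *\<^sub>R (lRe h *\<^sub>R fderiv A x k + lIm h *\<^sub>R fderiv C x k)))) (at x)"
          unfolding \<omega>_def
          by (intro has_derivative_add has_derivative_scaleR_right smooth_on_has_derivative[OF _ x]
              smooth_on_fderiv sm smA smC)
        from fderiv_eqI[OF this] show ?thesis by simp
      qed
      have k: "fderiv W x k = lRe k *\<^sub>R fderiv W x 1 + lIm k *\<^sub>R fderiv W x lsigma"
        if "smooth_on \<Omega> W" for W :: "lorentz \<Rightarrow> real ^ 4" and k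
        by (rule linear_lorentz_expand[OF smooth_on_linear_fderiv[OF that x]])
      show "fderiv (\<lambda>y. \<omega> \<epsilon> y h) x k = fderiv (\<lambda>y. \<omega> \<epsilon> y k) x h"
        unfolding d second_derivative_symmetric[OF sm x, of h k] k[OF smA, of k] k[OF smC, of k]
          k[OF smA, of h] k[OF smC, of h] closed[OF x] by (simp add: algebra_simps)
    next
      fix x h k i j assume x: "x \<in> \<Omega>"
      have "p x h * q x k - q x h * p x k
          = (lRe h * lIm k - lIm h * lRe k) * (1 - (\<epsilon> * \<epsilon>) * (ir x * ir x) * (F x * F x - E x * G x))"
        unfolding p_def q_def a1_def a2_def c1_def c2_def by algebra
      also have "\<dots> = (lRe h * lIm k - lIm h * lRe k) * (1 - (r x * ir x) * (r x * ir x))"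
        unfolding rr[OF x, symmetric] \<epsilon> by (simp add: mult_ac)
      also have "\<dots> = 0" by (simp add: ir[OF x])
      finally have pq: "p x h * q x k = q x h * p x k" by simp
      have "(p x h *\<^sub>R u x + q x h *\<^sub>R v x) $ i * (p x k *\<^sub>R u x + q x k *\<^sub>R v x) $ j
         = (p x h *\<^sub>R u x + q x h *\<^sub>R v x) $ j * (p x k *\<^sub>R u x + q x k *\<^sub>R v x) $ i"
        using pq by simp algebra
      then show "\<omega> \<epsilon> x h $ i * \<omega> \<epsilon> x k $ j = \<omega> \<epsilon> x h $ j * \<omega> \<epsilon> x k $ i"
        by (simp add: \<omega>pq[OF x])
    next
      fix x h assume x: "x \<in> \<Omega>"
      have i1: "ir x * ir x * (F x * F x - E x * G x) = 1"
        using ir[OF x] rr[OF x] by (metis mult.assoc mult.commute mult_1)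
      have "minner (p x h *\<^sub>R u x + q x h *\<^sub>R v x) (p x h *\<^sub>R u x + q x h *\<^sub>R v x)
          = p x h * p x h * E x + 2 * (p x h * q x h) * F x + q x h * q x h * G x"
        by (simp add: minner_linear E_def F_def G_def minner_commute[of "v x" "u x"] algebra_simps)
      also have "\<dots> = 0"
        using i1 \<epsilon> unfolding p_def q_def a1_def a2_def c1_def c2_def by algebra
      finally show "minner (\<omega> \<epsilon> x h) (\<omega> \<epsilon> x h) = 0"
        by (simp add: \<omega>pq[OF x] bounded_bilinear.scaleR_left[OF bounded_bilinear_minner]
            bounded_bilinear.scaleR_right[OF bounded_bilinear_minner])
    qed
  qed
  obtain B1 w1 where B1: "open B1" "x0 \<in> B1" "B1 \<subseteq> \<Omega>" "null_wave B1 w1"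
     "\<And>x h. x \<in> B1 \<Longrightarrow> \<omega> 1 x h = fst (fderiv w1 x h) *\<^sub>R direction (w1 x)"
    using wave[of 1] by auto
  obtain B2 w2 where B2: "open B2" "x0 \<in> B2" "B2 \<subseteq> \<Omega>" "null_wave B2 w2"
     "\<And>x h. x \<in> B2 \<Longrightarrow> \<omega> (-1) x h = fst (fderiv w2 x h) *\<^sub>R direction (w2 x)"
    using wave[of "-1"] by auto
  define B where "B = B1 \<inter> B2"
  have nw: "null_wave B w1" "null_wave B w2"
    using null_wave_subset[OF B1(4), of B] null_wave_subset[OF B2(4), of B] B1(1) B2(1) by (auto simp: B_def)
  have "null_frame B f w1 w2"
    unfolding null_frame_def
  proof (intro conjI ballI allI impI nw)
    fix x assume xB: "x \<in> B"
    then have x: "x \<in> \<Omega>" using B1 by (auto simp: B_def)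
    show df: "fderiv f x h = fst (fderiv w1 x h) *\<^sub>R direction (w1 x) + fst (fderiv w2 x h) *\<^sub>R direction (w2 x)" for h
    proof -
      have "fderiv f x h = \<omega> 1 x h + \<omega> (-1) x h"
        by (simp add: \<omega>_def algebra_simps flip: scaleR_left_distrib)
      then show ?thesis using B1(5) B2(5) xB by (simp add: B_def)
    qed
    have "minner (direction (w1 x)) (direction (w2 x)) \<noteq> 0"
    proof
      assume 0: "minner (direction (w1 x)) (direction (w2 x)) = 0"
      have "minner (direction w) (direction w) = 0" for w
        by (simp add: direction_def null_vec_minner)
      then have "minner (fderiv f x h) (fderiv f x k) = 0" for h k
        unfolding df using 0 by (simp add: minner_linear minner_commute[of "direction (w2 x)" "direction (w1 x)"])
      then show False using disc[OF x] by (simp add: E_def F_def G_def u_def v_def)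
    qed
    then show "transversal (w1 x) (w2 x)"
      by (auto simp: transversal_def direction_def null_vec_minner)
    fix h assume "fst (fderiv w1 x h) = 0 \<and> fst (fderiv w2 x h) = 0"
    then have "lRe h *\<^sub>R u x + lIm h *\<^sub>R v x = 0" using df[of h] exp[OF x, of h] by simp
    then have "lRe h = 0 \<and> lIm h = 0"
      by (intro gram_solve[of "u x" "v x"]) (use disc[OF x] in \<open>auto simp: E_def F_def G_def\<close>)
    then show "h = 0" by (simp add: lorentz_eq_iff)
  qed
  then show ?thesis using B1 B2 unfolding B_def by (intro exI[of _ "B1 \<inter> B2"]) auto
qed

section \<open>Symmetries and uniqueness of null frames\<close>

text \<open>If the signs of \<open>e\<close> and \<open>f\<close> change by \<open>\<epsilon>\<close> and \<open>\<delta>\<close>, then the direction changes by \<open>\<epsilon> * \<delta>\<close>,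
  which the null coordinate has to compensate.\<close>

definition wave_sym :: "(wave \<Rightarrow> wave) set" where
  "wave_sym = {\<lambda>w. ((\<epsilon> * \<delta>) * fst w + c, \<epsilon> *\<^sub>R fst (snd w), \<delta> *\<^sub>R snd (snd w)) | \<epsilon> \<delta> c :: real.
     \<epsilon> \<in> {1, -1} \<and> \<delta> \<in> {1, -1}}"

text \<open>The second set exchanges the two null lines; on a surface without a chosen orientation they
  cannot be told apart.\<close>

definition frame_sym :: "(wave \<times> wave \<Rightarrow> wave \<times> wave) set" where
  "frame_sym = {\<lambda>w. (g (fst w), h (snd w)) | g h. g \<in> wave_sym \<and> h \<in> wave_sym}
     \<union> {\<lambda>w. (g (snd w), h (fst w)) | g h. g \<in> wave_sym \<and> h \<in> wave_sym}"

lemma frame_symI: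
  assumes "g \<in> wave_sym" "h \<in> wave_sym"
  shows "(\<lambda>w. (g (fst w), h (snd w))) \<in> frame_sym" "(\<lambda>w. (g (snd w), h (fst w))) \<in> frame_sym"
  using assms unfolding frame_sym_def by blast+

definition frame_values :: "(wave \<times> wave) set" where
  "frame_values = {w. norm (fst (snd (fst w))) = 1 \<and> norm (snd (snd (fst w))) = 1 \<and>
     norm (fst (snd (snd w))) = 1 \<and> norm (snd (snd (snd w))) = 1 \<and> transversal (fst w) (snd w)}"

lemma null_frame_swap:
  assumes "null_frame B f w1 w2"
  shows "null_frame B f w2 w1"
proof -
  have "Im (cnj x * y) = - Im (x * cnj y)" for x y by simp
  then have "transversal (w2 x) (w1 x)" if "transversal (w1 x) (w2 x)" for x
    using that by (simp add: transversal_def mult.commute)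
  then show ?thesis using assms unfolding null_frame_def by (auto simp: add.commute)
qed

lemma wave_sym_fderiv:
  assumes "w differentiable at x"
  shows "fderiv (\<lambda>y. ((\<epsilon> * \<delta>) * fst (w y) + c, \<epsilon> *\<^sub>R fst (snd (w y)), \<delta> *\<^sub>R snd (snd (w y)))) x
     = (\<lambda>h. ((\<epsilon> * \<delta>) * fst (fderiv w x h), \<epsilon> *\<^sub>R fst (snd (fderiv w x h)), \<delta> *\<^sub>R snd (snd (fderiv w x h))))"
proof -
  have w: "(w has_derivative fderiv w x) (at x)" using assms by (simp add: frechet_derivative_works)
  have "((\<lambda>y. (\<epsilon> * \<delta>) * fst (w y) + c) has_derivative (\<lambda>h. (\<epsilon> * \<delta>) * fst (fderiv w x h))) (at x)"
    using has_derivative_add[OF has_derivative_mult_right[OF has_derivative_fst[OF w]] has_derivative_const, of "\<epsilon> * \<delta>" c]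
    by simp
  then show ?thesis
    by (intro fderiv_eqI has_derivative_Pair has_derivative_scaleR_right has_derivative_fst has_derivative_snd w)
qed

lemma null_wave_sym:
  assumes "null_wave B w" "g \<in> wave_sym"
  shows "null_wave B (\<lambda>x. g (w x))"
    and "\<exists>\<epsilon>\<in>{1,-1}. \<forall>x\<in>B. direction (g (w x)) = \<epsilon> *\<^sub>R direction (w x) \<and>
       (\<forall>h. fst (fderiv (\<lambda>x. g (w x)) x h) = \<epsilon> * fst (fderiv w x h))"
    and "\<exists>\<epsilon>\<in>{1,-1}. \<exists>\<delta>\<in>{1,-1}. \<forall>x. fst (snd (g x)) = \<epsilon> *\<^sub>R fst (snd x) \<and> snd (snd (g x)) = \<delta> *\<^sub>R snd (snd x)"
proof -
  obtain \<epsilon> \<delta> c where g: "g = (\<lambda>w. ((\<epsilon> * \<delta>) * fst w + c, \<epsilon> *\<^sub>R fst (snd w), \<delta> *\<^sub>R snd (snd w)))"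
    and ed: "\<epsilon> \<in> {1,-1}" "\<delta> \<in> {1,-1}"
    using assms(2) unfolding wave_sym_def by blast
  have sm: "smooth_on B w" using assms(1) by (simp add: null_wave_def)
  have d: "fderiv (\<lambda>x. g (w x)) x = (\<lambda>h. ((\<epsilon> * \<delta>) * fst (fderiv w x h),
       \<epsilon> *\<^sub>R fst (snd (fderiv w x h)), \<delta> *\<^sub>R snd (snd (fderiv w x h))))" if "x \<in> B" for x
    unfolding g by (rule wave_sym_fderiv[OF smooth_on_differentiable[OF sm that]])
  have nz: "\<epsilon> * \<delta> \<noteq> 0" "\<bar>\<epsilon>\<bar> = 1" "\<bar>\<delta>\<bar> = 1" using ed by auto
  have "smooth_on B (\<lambda>x. g (w x))" unfolding g
    by (intro smooth_on_Pair smooth_on_add smooth_on_scaleR smooth_on_mult smooth_on_fst smooth_on_snd sm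
        smooth_on_const smooth_on_open[OF sm])
  then show "null_wave B (\<lambda>x. g (w x))"
    unfolding null_wave_def
  proof (intro conjI ballI allI impI)
    fix x assume x: "x \<in> B"
    show "norm (fst (snd (g (w x)))) = 1" "norm (snd (snd (g (w x)))) = 1"
      using assms(1) x nz(2,3) by (simp_all add: g null_wave_def)
    fix h assume "fst (fderiv (\<lambda>x. g (w x)) x h) = 0"
    then have "fst (fderiv w x h) = 0" using nz(1) by (simp add: d[OF x])
    then have "fderiv w x h = 0" using assms(1) x by (simp add: null_wave_def)
    then show "fderiv (\<lambda>x. g (w x)) x h = 0" by (simp add: d[OF x] zero_prod_def)
  qed
  show "\<exists>\<epsilon>\<in>{1,-1}. \<forall>x\<in>B. direction (g (w x)) = \<epsilon> *\<^sub>R direction (w x) \<and>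
       (\<forall>h. fst (fderiv (\<lambda>x. g (w x)) x h) = \<epsilon> * fst (fderiv w x h))"
  proof (rule bexI[of _ "\<epsilon> * \<delta>"])
    show "\<epsilon> * \<delta> \<in> {1, -1}" using ed by auto
    show "\<forall>x\<in>B. direction (g (w x)) = (\<epsilon> * \<delta>) *\<^sub>R direction (w x) \<and>
       (\<forall>h. fst (fderiv (\<lambda>x. g (w x)) x h) = (\<epsilon> * \<delta>) * fst (fderiv w x h))"
      using d by (simp add: g direction_def null_vec_scale)
  qed
  show "\<exists>\<epsilon>\<in>{1,-1}. \<exists>\<delta>\<in>{1,-1}. \<forall>x. fst (snd (g x)) = \<epsilon> *\<^sub>R fst (snd x) \<and> snd (snd (g x)) = \<delta> *\<^sub>R snd (snd x)"
    using ed by (intro bexI[of _ \<epsilon>] bexI[of _ \<delta>]) (auto simp: g)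
qed

lemma null_frame_wave_sym:
  assumes nf: "null_frame B f w1 w2" and g: "g \<in> wave_sym" and h: "h \<in> wave_sym"
  shows "null_frame B f (\<lambda>x. g (w1 x)) (\<lambda>x. h (w2 x))"
proof -
  have w: "null_wave B w1" "null_wave B w2" using nf by (auto simp: null_frame_def)
  obtain a where a: "a \<in> {1,-1}" "\<And>x. x \<in> B \<Longrightarrow> direction (g (w1 x)) = a *\<^sub>R direction (w1 x) \<and>
       (\<forall>h. fst (fderiv (\<lambda>x. g (w1 x)) x h) = a * fst (fderiv w1 x h))"
    using null_wave_sym(2)[OF w(1) g] by blast
  obtain b where b: "b \<in> {1,-1}" "\<And>x. x \<in> B \<Longrightarrow> direction (h (w2 x)) = b *\<^sub>R direction (w2 x) \<and>
       (\<forall>k. fst (fderiv (\<lambda>x. h (w2 x)) x k) = b * fst (fderiv w2 x k))"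
    using null_wave_sym(2)[OF w(2) h] by blast
  obtain \<epsilon>1 \<delta>1 where 1: "\<epsilon>1 \<in> {1,-1::real}" "\<delta>1 \<in> {1,-1::real}"
    "\<And>x. fst (snd (g x)) = \<epsilon>1 *\<^sub>R fst (snd x)" "\<And>x. snd (snd (g x)) = \<delta>1 *\<^sub>R snd (snd x)"
    using null_wave_sym(3)[OF w(1) g] by blast
  obtain \<epsilon>2 \<delta>2 where 2: "\<epsilon>2 \<in> {1,-1::real}" "\<delta>2 \<in> {1,-1::real}"
    "\<And>x. fst (snd (h x)) = \<epsilon>2 *\<^sub>R fst (snd x)" "\<And>x. snd (snd (h x)) = \<delta>2 *\<^sub>R snd (snd x)"
    using null_wave_sym(3)[OF w(2) h] by blast
  have tr: "transversal (g p) (h q)" if "transversal p q" for p q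
    using that 1(1,2) 2(1,2) unfolding transversal_def 1(3,4) 2(3,4) by auto
  have aa: "a * a = 1" "b * b = 1" using a(1) b(1) by auto
  show ?thesis
    unfolding null_frame_def
  proof (intro conjI ballI allI impI null_wave_sym(1)[OF w(1) g] null_wave_sym(1)[OF w(2) h])
    fix x assume x: "x \<in> B"
    show "transversal (g (w1 x)) (h (w2 x))" using nf x tr unfolding null_frame_def by blast
    show "fderiv f x k = fst (fderiv (\<lambda>x. g (w1 x)) x k) *\<^sub>R direction (g (w1 x))
         + fst (fderiv (\<lambda>x. h (w2 x)) x k) *\<^sub>R direction (h (w2 x))" for k
    proof -
      have "fderiv f x k = fst (fderiv w1 x k) *\<^sub>R direction (w1 x) + fst (fderiv w2 x k) *\<^sub>R direction (w2 x)"
        using nf x unfolding null_frame_def by blast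
      moreover have "(a * fst (fderiv w1 x k)) * a = fst (fderiv w1 x k)" "(b * fst (fderiv w2 x k)) * b = fst (fderiv w2 x k)"
        using aa by (metis mult.assoc mult.commute mult_1)+
      ultimately show ?thesis
        by (simp only: a(2)[OF x, THEN conjunct1] a(2)[OF x, THEN conjunct2, rule_format]
            b(2)[OF x, THEN conjunct1] b(2)[OF x, THEN conjunct2, rule_format] scaleR_scaleR)
    qed
    fix k assume "fst (fderiv (\<lambda>x. g (w1 x)) x k) = 0 \<and> fst (fderiv (\<lambda>x. h (w2 x)) x k) = 0"
    then have "fst (fderiv w1 x k) = 0 \<and> fst (fderiv w2 x k) = 0"
      using a(2)[OF x] b(2)[OF x] a(1) b(1) by auto
    then show "k = 0" using nf x unfolding null_frame_def by blast
  qed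
qed

lemma null_frame_sym:
  assumes nf: "null_frame B f (\<lambda>x. fst (w x)) (\<lambda>x. snd (w x))" and g: "g \<in> frame_sym"
  shows "null_frame B f (\<lambda>x. fst (g (w x))) (\<lambda>x. snd (g (w x)))"
proof -
  obtain g1 g2 where g12: "g1 \<in> wave_sym" "g2 \<in> wave_sym"
    and "g = (\<lambda>w. (g1 (fst w), g2 (snd w))) \<or> g = (\<lambda>w. (g1 (snd w), g2 (fst w)))"
    using g unfolding frame_sym_def by blast
  then show ?thesis
    using null_frame_wave_sym[OF nf g12] null_frame_wave_sym[OF null_frame_swap[OF nf] g12] by auto
qed

lemma null_frame_compose:
  assumes nf: "null_frame B f w1 w2" and f: "smooth_on B f"
    and \<theta>: "smooth_on B' \<theta>" "\<theta> ` B' \<subseteq> B" "\<And>x h. x \<in> B' \<Longrightarrow> fderiv \<theta> x h = 0 \<Longrightarrow> h = 0"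
  shows "null_frame B' (\<lambda>x. f (\<theta> x)) (\<lambda>x. w1 (\<theta> x)) (\<lambda>x. w2 (\<theta> x))"
proof -
  have chain: "fderiv (\<lambda>x. g (\<theta> x)) x = (\<lambda>h. fderiv g (\<theta> x) (fderiv \<theta> x h))"
    if g: "smooth_on B g" and x: "x \<in> B'" for x and g :: "lorentz \<Rightarrow> 'z::euclidean_space"
  proof (rule fderiv_eqI, rule has_derivative_compose[of \<theta> _ x UNIV g])
    show "(\<theta> has_derivative fderiv \<theta> x) (at x)" by (rule smooth_on_has_derivative[OF \<theta>(1) x])
    show "(g has_derivative fderiv g (\<theta> x)) (at (\<theta> x))"
      by (rule smooth_on_has_derivative[OF g]) (use \<theta>(2) x in blast)
  qed
  have w: "null_wave B w1" "null_wave B w2" using nf by (auto simp: null_frame_def)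
  then have sm: "smooth_on B w1" "smooth_on B w2" by (auto simp: null_wave_def)
  have nw: "null_wave B' (\<lambda>x. w (\<theta> x))" if "null_wave B w" for w
  proof -
    have s: "smooth_on B w" using that by (simp add: null_wave_def)
    show ?thesis using that \<theta>(2) smooth_on_compose[OF s \<theta>(1,2)]
      unfolding null_wave_def by (auto simp: chain[OF s] image_subset_iff)
  qed
  show ?thesis
    using nf \<theta>(2,3) nw[OF w(1)] nw[OF w(2)]
    unfolding null_frame_def by (auto simp: chain[OF f] chain[OF sm(1)] chain[OF sm(2)] image_subset_iff)
qed

lemma null_frame_cong:
  assumes "open B" "\<And>x. x \<in> B \<Longrightarrow> f x = f' x" "\<And>x. x \<in> B \<Longrightarrow> w1 x = w1' x"
    "\<And>x. x \<in> B \<Longrightarrow> w2 x = w2' x" and nf: "null_frame B f w1 w2"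
  shows "null_frame B f' w1' w2'"
proof -
  have 1: "fderiv f x = fderiv f' x" "fderiv w1 x = fderiv w1' x" "fderiv w2 x = fderiv w2' x" if "x \<in> B" for x
    using fderiv_cong_open[OF assms(1) that assms(2)] fderiv_cong_open[OF assms(1) that assms(3)]
      fderiv_cong_open[OF assms(1) that assms(4)] by auto
  have sm: "smooth_on B w1'" "smooth_on B w2'"
    using nf smooth_on_cong[of B w1 w1', OF _ assms(3)] smooth_on_cong[of B w2 w2', OF _ assms(4)]
    unfolding null_frame_def null_wave_def by auto
  show ?thesis
    using nf unfolding null_frame_def null_wave_def by (simp add: 1 assms(3,4) sm)
qed

lemma null_frame_subset:
  assumes "null_frame B f w1 w2" "open B'" "B' \<subseteq> B"
  shows "null_frame B' f w1 w2"
  using assms null_wave_subset unfolding null_frame_def by blast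

lemma unit_square_eq:
  assumes "norm e = 1" "e * e = e' * e'" shows "e = (e'::complex) \<or> e = - e'"
  using assms by (metis power2_eq_iff power2_eq_square)

text \<open>The product of \<open>e f\<close> and \<open>e (cnj f)\<close> is \<open>e\<^sup>2\<close> for unit \<open>f\<close>; hence the direction determines \<open>e\<close> up to
  sign, and then \<open>f\<close>.\<close>

lemma direction_parallel:
  assumes w: "norm (fst (snd w)) = 1" "norm (snd (snd w)) = 1"
    and w': "norm (fst (snd w')) = 1" "norm (snd (snd w')) = 1"
    and par: "direction w = a *\<^sub>R direction w'"
  shows "\<exists>\<epsilon>\<in>{1,-1}. \<exists>\<delta>\<in>{1,-1}. fst (snd w) = \<epsilon> *\<^sub>R fst (snd w') \<and> snd (snd w) = \<delta> *\<^sub>R snd (snd w')"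
proof -
  define e f e' f' where "e = fst (snd w)" and "f = snd (snd w)" and "e' = fst (snd w')" and "f' = snd (snd w')"
  have nv: "null_vec e f $ i = a * null_vec e' f' $ i" for i
    using par by (simp add: direction_def e_def f_def e'_def f'_def)
  have ef: "e * f = of_real a * (e' * f')"
    using nv[of 0] nv[of 2] unfolding null_vec_nth by (simp add: complex_eq_iff algebra_simps)
  have ecf: "e * cnj f = of_real a * (e' * cnj f')"
    using nv[of 1] nv[of 3] unfolding null_vec_nth by (simp add: complex_eq_iff algebra_simps)
  have n: "norm e = 1" "norm f = 1" "norm e' = 1" "norm f' = 1"
    using w w' by (simp_all add: e_def f_def e'_def f'_def)
  have "norm (e * f) = \<bar>a\<bar> * norm (e' * f')" unfolding ef norm_mult by simp
  then have a: "a = 1 \<or> a = -1" using n by (simp add: norm_mult abs_if split: if_splits)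
  have c: "f * cnj f = 1" "f' * cnj f' = 1" using n by (simp_all add: complex_norm_square[symmetric])
  have "(e * f) * (e * cnj f) = e * e * (f * cnj f)" by (simp only: mult_ac)
  moreover have "(e * f) * (e * cnj f) = of_real (a * a) * (e' * e') * (f' * cnj f')"
    unfolding ef ecf of_real_mult by (simp only: mult_ac)
  ultimately have "e * e = e' * e'" using a by (auto simp: c)
  then have e: "e = e' \<or> e = - e'" using unit_square_eq n by blast
  have e0: "e' \<noteq> 0" using n by auto
  obtain s :: complex where s: "s = 1 \<or> s = - 1" "e = s * e'" using e by force
  have "e' * (s * f) = e' * (of_real a * f')" using ef unfolding s(2) by (simp only: mult_ac)
  then have "s * f = of_real a * f'" using e0 by simp
  then have "f = f' \<or> f = - f'" using s(1) a by (auto simp: minus_equation_iff)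
  then show ?thesis using e unfolding e_def f_def e'_def f'_def by fastforce
qed

lemma Im_unit:
  assumes "norm e = 1" "\<epsilon> \<in> {1,-1::real}" shows "Im ((\<epsilon> *\<^sub>R e) * cnj e) = 0" "Im (e * cnj (\<epsilon> *\<^sub>R e)) = 0"
  using assms by auto

text \<open>On the vector with \<open>ds = 1\<close> and \<open>dt = 0\<close> the differential of \<open>f\<close> takes the null value
  \<open>direction (w1 x)\<close>.  A combination of two null vectors that are not orthogonal is null only if it is a
  multiple of one of them.\<close>

lemma null_frame_directions:
  assumes nf: "null_frame B f w1 w2" and nf': "null_frame B f w1' w2'" and x: "x \<in> B"
  shows "\<exists>a. direction (w1 x) = a *\<^sub>R direction (w1' x) \<or> direction (w1 x) = a *\<^sub>R direction (w2' x)"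
proof -
  have dir: "linear (fderiv w1 x)" "linear (fderiv w2 x)"
    using nf x smooth_on_linear_fderiv unfolding null_frame_def null_wave_def by blast+
  define L where "L h = Lor (fst (fderiv w1 x h)) (fst (fderiv w2 x h))" for h
  have linL: "linear L"
    unfolding L_def using dir by (auto intro!: linearI simp: lorentz_eq_iff linear_add linear_cmul)
  have "inj L"
    unfolding linear_injective_0[OF linL]
    using nf x by (auto simp: L_def null_frame_def lorentz_eq_iff)
  then have "surj L" using linear_injective_imp_surjective[OF linL] by blast
  then obtain h where h: "Lor 1 0 = L h" by (metis surjD)
  then have h1: "fst (fderiv w1 x h) = 1" "fst (fderiv w2 x h) = 0" by (simp_all add: L_def)
  define a b where "a = fst (fderiv w1' x h)" and "b = fst (fderiv w2' x h)"
  have eq: "direction (w1 x) = a *\<^sub>R direction (w1' x) + b *\<^sub>R direction (w2' x)"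
    using nf nf' x h1 unfolding null_frame_def a_def b_def by (metis add.right_neutral scaleR_one scaleR_zero_left)
  have n0: "minner (direction w) (direction w) = 0" for w by (simp add: direction_def null_vec_minner)
  have "minner (direction (w1' x)) (direction (w2' x)) \<noteq> 0"
    using nf' x by (auto simp: null_frame_def transversal_def direction_def null_vec_minner)
  moreover have "2 * a * b * minner (direction (w1' x)) (direction (w2' x)) = 0"
    using n0[of "w1 x"] unfolding eq
    by (simp add: minner_linear n0 minner_commute[of "direction (w2' x)" "direction (w1' x)"])
  ultimately have "a = 0 \<or> b = 0" by simp
  then show ?thesis using eq by auto
qed

text \<open>The last assumption says that near \<open>x0\<close> the first direction of one frame is not the second one of the
  other frame.  So the directions match in the given order, their signs are locally constant by
  continuity, and the null coordinates have equal differentials up to these signs.\<close>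

lemma null_frame_unique_in_order:
  assumes nf: "null_frame B f w1 w2" and nf': "null_frame B f w1' w2'"
    and B: "open B" "x0 \<in> B"
    and ne: "Im (fst (snd (w1 x0)) * cnj (fst (snd (w2' x0)))) \<noteq> 0"
  shows "\<exists>g\<in>wave_sym. \<exists>h\<in>wave_sym. \<forall>\<^sub>F x in nhds x0. w1' x = g (w1 x) \<and> w2' x = h (w2 x)"
proof -
  have w: "null_wave B w1" "null_wave B w2" "null_wave B w1'" "null_wave B w2'"
    using nf nf' by (auto simp: null_frame_def)
  have sm: "smooth_on B w1" "smooth_on B w2" "smooth_on B w1'" "smooth_on B w2'"
    using w by (auto simp: null_wave_def)
  define e1 e2 e1' e2' where "e1 x = fst (snd (w1 x))" and "e2 x = fst (snd (w2 x))"
    and "e1' x = fst (snd (w1' x))" and "e2' x = fst (snd (w2' x))" for x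
  define f1 f2 f1' f2' where "f1 x = snd (snd (w1 x))" and "f2 x = snd (snd (w2 x))"
    and "f1' x = snd (snd (w1' x))" and "f2' x = snd (snd (w2' x))" for x
  have unit: "norm (e1 x) = 1" "norm (f1 x) = 1" "norm (e2 x) = 1" "norm (f2 x) = 1"
     "norm (e1' x) = 1" "norm (f1' x) = 1" "norm (e2' x) = 1" "norm (f2' x) = 1" if "x \<in> B" for x
    using w that by (auto simp: null_wave_def e1_def f1_def e2_def f2_def e1'_def f1'_def e2'_def f2'_def)
  have cont: "continuous_on B e1" "continuous_on B e2" "continuous_on B e1'" "continuous_on B e2'"
    "continuous_on B f1" "continuous_on B f2" "continuous_on B f1'" "continuous_on B f2'"
    unfolding e1_def e2_def e1'_def e2'_def f1_def f2_def f1'_def f2'_def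
    by (intro smooth_on_continuous_on smooth_on_fst smooth_on_snd sm)+
  have straight: "(\<exists>\<epsilon>\<in>{1,-1}. \<exists>\<delta>\<in>{1,-1}. e1 x = \<epsilon> *\<^sub>R e1' x \<and> f1 x = \<delta> *\<^sub>R f1' x) \<and>
      (\<exists>\<epsilon>\<in>{1,-1}. \<exists>\<delta>\<in>{1,-1}. e2 x = \<epsilon> *\<^sub>R e2' x \<and> f2 x = \<delta> *\<^sub>R f2' x)"
    if x: "x \<in> B" and nz: "Im (e1 x * cnj (e2' x)) \<noteq> 0" for x
  proof -
    note par = direction_parallel[of "w1 x"] direction_parallel[of "w2 x"]
    have not: "\<not> (e1 x = \<epsilon> *\<^sub>R e2' x)" if "\<epsilon> \<in> {1,-1}" for \<epsilon> :: real
      using nz Im_unit[OF unit(7)[OF x] that] by auto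
    have s1: "\<exists>\<epsilon>\<in>{1,-1}. \<exists>\<delta>\<in>{1,-1}. e1 x = \<epsilon> *\<^sub>R e1' x \<and> f1 x = \<delta> *\<^sub>R f1' x"
      using null_frame_directions[OF nf nf' x] direction_parallel[of "w1 x" "w1' x"]
        direction_parallel[of "w1 x" "w2' x"] unit[OF x] not
      unfolding e1_def f1_def e1'_def f1'_def e2'_def f2'_def by metis
    then obtain \<epsilon> \<delta> where ed: "\<epsilon> \<in> {1,-1::real}" "e1 x = \<epsilon> *\<^sub>R e1' x" by blast
    have tr: "Im (e1 x * cnj (e2 x)) \<noteq> 0"
      using nf x by (auto simp: null_frame_def transversal_def e1_def e2_def)
    have not2: "\<not> (e2 x = \<epsilon>' *\<^sub>R e1' x)" if "\<epsilon>' \<in> {1,-1}" for \<epsilon>' :: real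
    proof
      assume "e2 x = \<epsilon>' *\<^sub>R e1' x"
      then have "e2 x = (\<epsilon>' * \<epsilon>) *\<^sub>R e1 x" using ed by auto
      moreover have "\<epsilon>' * \<epsilon> \<in> {1,-1}" using that ed by auto
      ultimately show False using tr Im_unit(2)[OF unit(1)[OF x]] by metis
    qed
    have s2: "\<exists>\<epsilon>\<in>{1,-1}. \<exists>\<delta>\<in>{1,-1}. e2 x = \<epsilon> *\<^sub>R e2' x \<and> f2 x = \<delta> *\<^sub>R f2' x"
      using null_frame_directions[OF null_frame_swap[OF nf] nf' x] direction_parallel[of "w2 x" "w1' x"]
        direction_parallel[of "w2 x" "w2' x"] unit[OF x] not2
      unfolding e2_def f2_def e1'_def f1'_def e2'_def f2'_def by metis
    show ?thesis using s1 s2 by blast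
  qed
  have locally_const: "\<exists>\<epsilon>\<in>{1,-1}. \<forall>\<^sub>F x in nhds x0. x \<in> B \<and> (\<forall>\<delta>\<in>{1,-1}. y x = \<delta> *\<^sub>R z x \<longrightarrow> z x = \<epsilon> *\<^sub>R y x)"
    if c: "continuous_on B y" "continuous_on B z" and u: "\<And>x. x \<in> B \<Longrightarrow> norm (y x) = 1"
      and ex: "\<exists>\<epsilon>\<in>{1,-1}. y x0 = \<epsilon> *\<^sub>R z x0" for y z :: "lorentz \<Rightarrow> complex"
  proof -
    obtain \<epsilon> where \<epsilon>: "\<epsilon> \<in> {1,-1::real}" "y x0 = \<epsilon> *\<^sub>R z x0" using ex by blast
    then have ze: "z x0 = \<epsilon> *\<^sub>R y x0" by auto
    have uc: "y x \<bullet> y x = 1" if "x \<in> B" for x using u[OF that] by (simp add: norm_eq_1)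
    have "continuous_on B (\<lambda>x. \<epsilon> * (y x \<bullet> z x))" by (intro continuous_intros c)
    then have "open (B \<inter> (\<lambda>x. \<epsilon> * (y x \<bullet> z x)) -` {0<..})"
      by (rule continuous_open_preimage[OF _ B(1) open_greaterThan])
    moreover have "\<epsilon> * (y x0 \<bullet> z x0) = 1"
      using uc[OF B(2)] \<epsilon>(1) by (auto simp: ze)
    ultimately have ev: "\<forall>\<^sub>F x in nhds x0. x \<in> B \<and> \<epsilon> * (y x \<bullet> z x) > 0"
      using eventually_nhds_in_open[of "B \<inter> (\<lambda>x. \<epsilon> * (y x \<bullet> z x)) -` {0<..}" x0] B(2) by simp
    have "\<forall>\<^sub>F x in nhds x0. x \<in> B \<and> (\<forall>\<delta>\<in>{1,-1}. y x = \<delta> *\<^sub>R z x \<longrightarrow> z x = \<epsilon> *\<^sub>R y x)"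
      using ev
    proof eventually_elim
      case (elim x)
      have "z x = \<epsilon> *\<^sub>R y x" if "\<delta> \<in> {1,-1}" "y x = \<delta> *\<^sub>R z x" for \<delta> :: real
      proof -
        have zy: "z x = \<delta> *\<^sub>R y x" using that by auto
        then have "\<epsilon> * \<delta> > 0" using elim uc[of x] by simp
        then have "\<delta> = \<epsilon>" using that(1) \<epsilon>(1) by auto
        then show ?thesis using zy by simp
      qed
      then show ?case using elim by blast
    qed
    then show ?thesis using \<epsilon>(1) by blast
  qed
  have s0: "(\<exists>\<epsilon>\<in>{1,-1}. \<exists>\<delta>\<in>{1,-1}. e1 x0 = \<epsilon> *\<^sub>R e1' x0 \<and> f1 x0 = \<delta> *\<^sub>R f1' x0) \<and>
      (\<exists>\<epsilon>\<in>{1,-1}. \<exists>\<delta>\<in>{1,-1}. e2 x0 = \<epsilon> *\<^sub>R e2' x0 \<and> f2 x0 = \<delta> *\<^sub>R f2' x0)"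
    using straight[OF B(2)] ne by (simp add: e1_def e2'_def)
  obtain \<epsilon>1 where E1: "\<epsilon>1 \<in> {1,-1::real}"
     "\<forall>\<^sub>F x in nhds x0. x \<in> B \<and> (\<forall>\<delta>\<in>{1,-1}. e1 x = \<delta> *\<^sub>R e1' x \<longrightarrow> e1' x = \<epsilon>1 *\<^sub>R e1 x)"
    using locally_const[OF cont(1,3) unit(1)] s0 by blast
  obtain \<epsilon>2 where E2: "\<epsilon>2 \<in> {1,-1::real}"
     "\<forall>\<^sub>F x in nhds x0. x \<in> B \<and> (\<forall>\<delta>\<in>{1,-1}. e2 x = \<delta> *\<^sub>R e2' x \<longrightarrow> e2' x = \<epsilon>2 *\<^sub>R e2 x)"
    using locally_const[OF cont(2,4) unit(3)] s0 by blast
  obtain \<delta>1 where D1: "\<delta>1 \<in> {1,-1::real}"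
     "\<forall>\<^sub>F x in nhds x0. x \<in> B \<and> (\<forall>\<delta>\<in>{1,-1}. f1 x = \<delta> *\<^sub>R f1' x \<longrightarrow> f1' x = \<delta>1 *\<^sub>R f1 x)"
    using locally_const[OF cont(5,7) unit(2)] s0 by blast
  obtain \<delta>2 where D2: "\<delta>2 \<in> {1,-1::real}"
     "\<forall>\<^sub>F x in nhds x0. x \<in> B \<and> (\<forall>\<delta>\<in>{1,-1}. f2 x = \<delta> *\<^sub>R f2' x \<longrightarrow> f2' x = \<delta>2 *\<^sub>R f2 x)"
    using locally_const[OF cont(6,8) unit(4)] s0 by blast
  have evne: "\<forall>\<^sub>F x in nhds x0. x \<in> B \<and> Im (e1 x * cnj (e2' x)) \<noteq> 0"
  proof -
    have "continuous_on B (\<lambda>x. Im (e1 x * cnj (e2' x)))" by (intro continuous_intros cont)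
    then have "open (B \<inter> (\<lambda>x. Im (e1 x * cnj (e2' x))) -` (- {0}))"
      using continuous_open_preimage[OF _ B(1)] open_Compl closed_singleton by blast
    from eventually_nhds_in_open[OF this, of x0] show ?thesis
      using B(2) ne by (simp add: e1_def e2'_def)
  qed
  have "\<forall>\<^sub>F x in nhds x0. x \<in> B \<and> e1' x = \<epsilon>1 *\<^sub>R e1 x \<and> e2' x = \<epsilon>2 *\<^sub>R e2 x \<and> f1' x = \<delta>1 *\<^sub>R f1 x \<and> f2' x = \<delta>2 *\<^sub>R f2 x"
    using E1(2) E2(2) D1(2) D2(2) evne
  proof eventually_elim
    case (elim x)
    then show ?case using straight[of x] by blast
  qed
  then obtain \<rho> where \<rho>: "\<rho> > 0" "\<And>x. dist x x0 < \<rho> \<Longrightarrow> x \<in> B \<and> e1' x = \<epsilon>1 *\<^sub>R e1 x \<and> e2' x = \<epsilon>2 *\<^sub>R e2 x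
      \<and> f1' x = \<delta>1 *\<^sub>R f1 x \<and> f2' x = \<delta>2 *\<^sub>R f2 x"
    unfolding eventually_nhds_metric by blast
  define D where "D = ball x0 \<rho>"
  have D: "open D" "convex D" "x0 \<in> D" "D \<subseteq> B" "\<And>x. x \<in> D \<Longrightarrow> e1' x = \<epsilon>1 *\<^sub>R e1 x \<and> e2' x = \<epsilon>2 *\<^sub>R e2 x
      \<and> f1' x = \<delta>1 *\<^sub>R f1 x \<and> f2' x = \<delta>2 *\<^sub>R f2 x"
    using \<rho> by (auto simp: D_def dist_commute)
  have ds: "fst (fderiv w1' x h) = (\<epsilon>1 * \<delta>1) * fst (fderiv w1 x h) \<and> fst (fderiv w2' x h) = (\<epsilon>2 * \<delta>2) * fst (fderiv w2 x h)"
    if x: "x \<in> D" for x h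
  proof -
    have xB: "x \<in> B" using D(4) x by blast
    have d1: "direction (w1' x) = (\<epsilon>1 * \<delta>1) *\<^sub>R direction (w1 x)" "direction (w2' x) = (\<epsilon>2 * \<delta>2) *\<^sub>R direction (w2 x)"
      using D(5)[OF x] by (simp_all add: direction_def e1_def e2_def e1'_def e2'_def f1_def f2_def f1'_def f2'_def null_vec_scale)
    define a b where "a = fst (fderiv w1 x h) - (\<epsilon>1 * \<delta>1) * fst (fderiv w1' x h)"
      and "b = fst (fderiv w2 x h) - (\<epsilon>2 * \<delta>2) * fst (fderiv w2' x h)"
    have "fst (fderiv w1 x h) *\<^sub>R direction (w1 x) + fst (fderiv w2 x h) *\<^sub>R direction (w2 x)
        = fst (fderiv w1' x h) *\<^sub>R direction (w1' x) + fst (fderiv w2' x h) *\<^sub>R direction (w2' x)"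
      using nf nf' xB unfolding null_frame_def by metis
    then have z: "a *\<^sub>R direction (w1 x) + b *\<^sub>R direction (w2 x) = 0"
      unfolding d1 a_def b_def by (simp add: algebra_simps)
    have n0: "minner (direction w) (direction w) = 0" for w by (simp add: direction_def null_vec_minner)
    have n12: "minner (direction (w1 x)) (direction (w2 x)) \<noteq> 0"
      using nf xB by (auto simp: null_frame_def transversal_def direction_def null_vec_minner)
    have "a * minner (direction (w1 x)) (direction (w2 x)) = minner (a *\<^sub>R direction (w1 x) + b *\<^sub>R direction (w2 x)) (direction (w2 x))"
      "b * minner (direction (w1 x)) (direction (w2 x)) = minner (direction (w1 x)) (a *\<^sub>R direction (w1 x) + b *\<^sub>R direction (w2 x))"
      by (simp_all add: minner_linear n0)
    then have "a = 0" "b = 0" unfolding z using n12 by simp_all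
    then show ?thesis using E1(1) E2(1) D1(1) D2(1) by (auto simp: a_def b_def)
  qed
  have shift: "\<exists>c. \<forall>x\<in>D. fst (w' x) = \<kappa> * fst (w x) + c"
    if sw: "smooth_on B w" "smooth_on B w'" and dw: "\<And>x h. x \<in> D \<Longrightarrow> fst (fderiv w' x h) = \<kappa> * fst (fderiv w x h)"
    for w w' :: "lorentz \<Rightarrow> wave" and \<kappa>
  proof -
    have zero: "((\<lambda>x. fst (w' x) - \<kappa> * fst (w x)) has_derivative (\<lambda>h. 0)) (at x within D)" if x: "x \<in> D" for x
    proof -
      have xB: "x \<in> B" using D(4) x by blast
      have "((\<lambda>x. fst (w' x) - \<kappa> * fst (w x)) has_derivative (\<lambda>h. fst (fderiv w' x h) - \<kappa> * fst (fderiv w x h))) (at x)"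
        by (intro has_derivative_diff has_derivative_mult_right has_derivative_fst
            smooth_on_has_derivative[OF sw(1) xB] smooth_on_has_derivative[OF sw(2) xB])
      then show ?thesis by (simp add: dw[OF x] has_derivative_at_withinI)
    qed
    have "\<exists>c. \<forall>x\<in>D. fst (w' x) - \<kappa> * fst (w x) = c"
      by (rule has_derivative_zero_constant[OF D(2) zero])
    then obtain c where "\<And>x. x \<in> D \<Longrightarrow> fst (w' x) - \<kappa> * fst (w x) = c" by blast
    then show ?thesis by (intro exI[of _ c]) (auto simp: algebra_simps)
  qed
  obtain c1 where c1: "\<And>x. x \<in> D \<Longrightarrow> fst (w1' x) = (\<epsilon>1 * \<delta>1) * fst (w1 x) + c1"
    using shift[OF sm(1,3), of "\<epsilon>1 * \<delta>1"] ds by blast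
  obtain c2 where c2: "\<And>x. x \<in> D \<Longrightarrow> fst (w2' x) = (\<epsilon>2 * \<delta>2) * fst (w2 x) + c2"
    using shift[OF sm(2,4), of "\<epsilon>2 * \<delta>2"] ds by blast
  define g where "g w = ((\<epsilon>1 * \<delta>1) * fst w + c1, \<epsilon>1 *\<^sub>R fst (snd w), \<delta>1 *\<^sub>R snd (snd w))" for w :: wave
  define h where "h w = ((\<epsilon>2 * \<delta>2) * fst w + c2, \<epsilon>2 *\<^sub>R fst (snd w), \<delta>2 *\<^sub>R snd (snd w))" for w :: wave
  have "g \<in> wave_sym" "h \<in> wave_sym"
    unfolding wave_sym_def g_def[abs_def] h_def[abs_def] using E1(1) E2(1) D1(1) D2(1) by blast+
  moreover have "w1' x = g (w1 x) \<and> w2' x = h (w2 x)" if "x \<in> D" for x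
    using D(5)[OF that] c1[OF that] c2[OF that]
    by (simp add: g_def h_def prod_eq_iff e1_def e2_def e1'_def e2'_def f1_def f2_def f1'_def f2'_def)
  then have "\<forall>\<^sub>F x in nhds x0. w1' x = g (w1 x) \<and> w2' x = h (w2 x)"
    using eventually_nhds_in_open[OF D(1,3)] by (auto elim: eventually_mono)
  ultimately show ?thesis by blast
qed

lemma null_frame_unique:
  assumes nf: "null_frame B f (\<lambda>x. fst (w x)) (\<lambda>x. snd (w x))"
    and nf': "null_frame B f (\<lambda>x. fst (w' x)) (\<lambda>x. snd (w' x))" and B: "open B" "x0 \<in> B"
  shows "\<exists>g\<in>frame_sym. \<forall>\<^sub>F x in nhds x0. w' x = g (w x)"
proof -
  have w: "null_wave B (\<lambda>x. fst (w x))" "null_wave B (\<lambda>x. fst (w' x))" "null_wave B (\<lambda>x. snd (w' x))"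
    using nf nf' by (auto simp: null_frame_def)
  have tr: "Im (fst (snd (fst (w' x0))) * cnj (fst (snd (snd (w' x0))))) \<noteq> 0"
    using nf' B(2) by (auto simp: null_frame_def transversal_def)
  obtain a where "direction (fst (w x0)) = a *\<^sub>R direction (fst (w' x0)) \<or> direction (fst (w x0)) = a *\<^sub>R direction (snd (w' x0))"
    using null_frame_directions[OF nf nf' B(2)] by blast
  then obtain \<epsilon> where \<epsilon>: "\<epsilon> \<in> {1,-1::real}"
    "fst (snd (fst (w x0))) = \<epsilon> *\<^sub>R fst (snd (fst (w' x0))) \<or> fst (snd (fst (w x0))) = \<epsilon> *\<^sub>R fst (snd (snd (w' x0)))"
    using direction_parallel[of "fst (w x0)" "fst (w' x0)" a] direction_parallel[of "fst (w x0)" "snd (w' x0)" a]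
      w B(2) unfolding null_wave_def by metis
  from \<epsilon>(2) show ?thesis
  proof
    assume "fst (snd (fst (w x0))) = \<epsilon> *\<^sub>R fst (snd (fst (w' x0)))"
    then have "Im (fst (snd (fst (w x0))) * cnj (fst (snd (snd (w' x0))))) \<noteq> 0"
      using tr \<epsilon>(1) by auto
    from null_frame_unique_in_order[OF nf nf' B this]
    obtain g h where gh: "g \<in> wave_sym" "h \<in> wave_sym"
      "\<forall>\<^sub>F x in nhds x0. fst (w' x) = g (fst (w x)) \<and> snd (w' x) = h (snd (w x))" by blast
    then have "\<forall>\<^sub>F x in nhds x0. w' x = (\<lambda>w. (g (fst w), h (snd w))) (w x)"
      by (auto elim!: eventually_mono simp: prod_eq_iff)
    then show ?thesis using frame_symI(1)[OF gh(1,2)] by (rule bexI)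
  next
    assume "fst (snd (fst (w x0))) = \<epsilon> *\<^sub>R fst (snd (snd (w' x0)))"
    then have "Im (fst (snd (fst (w x0))) * cnj (fst (snd (fst (w' x0))))) \<noteq> 0"
      using tr \<epsilon>(1) by (auto simp: mult.commute)
    from null_frame_unique_in_order[OF nf null_frame_swap[OF nf'] B this]
    obtain g h where gh: "g \<in> wave_sym" "h \<in> wave_sym"
      "\<forall>\<^sub>F x in nhds x0. snd (w' x) = g (fst (w x)) \<and> fst (w' x) = h (snd (w x))" by blast
    then have "\<forall>\<^sub>F x in nhds x0. w' x = (\<lambda>w. (h (snd w), g (fst w))) (w x)"
      by (auto elim!: eventually_mono simp: prod_eq_iff)
    then show ?thesis using frame_symI(2)[OF gh(2,1)] by (rule bexI)
  qed
qed

text \<open>The signs can be read off from the unit numbers \<open>e\<close> and \<open>f\<close>, and an exchange of the two waves is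
  excluded because \<open>e1 = \<plusminus> e2\<close> contradicts transversality.\<close>

lemma frame_sym_free:
  assumes g: "g \<in> frame_sym" and h: "h \<in> frame_sym" and x: "x \<in> frame_values" and eq: "g x = h x"
  shows "g y = h y"
proof -
  have scale: "\<epsilon> = \<epsilon>'" if "norm e = 1" "\<epsilon> *\<^sub>R e = \<epsilon>' *\<^sub>R e" for \<epsilon> \<epsilon>' :: real and e :: complex
    using that by auto
  have same: "g1 = g2" if s: "g1 \<in> wave_sym" "g2 \<in> wave_sym" "norm (fst (snd z)) = 1" "norm (snd (snd z)) = 1" "g1 z = g2 z"
    for g1 g2 z
  proof -
    obtain \<epsilon> \<delta> c where 1: "g1 = (\<lambda>w. ((\<epsilon> * \<delta>) * fst w + c, \<epsilon> *\<^sub>R fst (snd w), \<delta> *\<^sub>R snd (snd w)))"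
      using s(1) unfolding wave_sym_def by blast
    obtain \<epsilon>' \<delta>' c' where 2: "g2 = (\<lambda>w. ((\<epsilon>' * \<delta>') * fst w + c', \<epsilon>' *\<^sub>R fst (snd w), \<delta>' *\<^sub>R snd (snd w)))"
      using s(2) unfolding wave_sym_def by blast
    have "\<epsilon> = \<epsilon>'" "\<delta> = \<delta>'"
      using scale[OF s(3), of \<epsilon> \<epsilon>'] scale[OF s(4), of \<delta> \<delta>'] s(5) unfolding 1 2 by simp_all
    moreover from this have "c = c'" using s(5) unfolding 1 2 by simp
    ultimately show ?thesis unfolding 1 2 by simp
  qed
  have cross: "False" if s: "g1 \<in> wave_sym" "g2 \<in> wave_sym" "g1 (fst x) = g2 (snd x)" for g1 g2
  proof -
    obtain \<epsilon> \<delta> c where 1: "g1 = (\<lambda>w. ((\<epsilon> * \<delta>) * fst w + c, \<epsilon> *\<^sub>R fst (snd w), \<delta> *\<^sub>R snd (snd w)))" "\<epsilon> \<in> {1,-1}"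
      using s(1) unfolding wave_sym_def by blast
    obtain \<epsilon>' \<delta>' c' where 2: "g2 = (\<lambda>w. ((\<epsilon>' * \<delta>') * fst w + c', \<epsilon>' *\<^sub>R fst (snd w), \<delta>' *\<^sub>R snd (snd w)))" "\<epsilon>' \<in> {1,-1}"
      using s(2) unfolding wave_sym_def by blast
    have "\<epsilon> *\<^sub>R fst (snd (fst x)) = \<epsilon>' *\<^sub>R fst (snd (snd x))" using s(3) unfolding 1(1) 2(1) by simp
    then have "fst (snd (fst x)) = fst (snd (snd x)) \<or> fst (snd (fst x)) = - fst (snd (snd x))"
      using 1(2) 2(2) by (auto simp: minus_equation_iff[of "fst (snd (fst x))"])
    then have "Im (fst (snd (fst x)) * cnj (fst (snd (snd x)))) = 0" by auto
    then show False using x by (simp add: frame_values_def transversal_def)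
  qed
  obtain g1 g2 where g12: "g1 \<in> wave_sym" "g2 \<in> wave_sym"
    and gg: "g = (\<lambda>w. (g1 (fst w), g2 (snd w))) \<or> g = (\<lambda>w. (g1 (snd w), g2 (fst w)))"
    using g unfolding frame_sym_def by blast
  obtain h1 h2 where h12: "h1 \<in> wave_sym" "h2 \<in> wave_sym"
    and hh: "h = (\<lambda>w. (h1 (fst w), h2 (snd w))) \<or> h = (\<lambda>w. (h1 (snd w), h2 (fst w)))"
    using h unfolding frame_sym_def by blast
  have n: "norm (fst (snd (fst x))) = 1" "norm (snd (snd (fst x))) = 1" "norm (fst (snd (snd x))) = 1" "norm (snd (snd (snd x))) = 1"
    using x by (auto simp: frame_values_def)
  from gg hh show ?thesis
  proof (elim disjE)
    assume e: "g = (\<lambda>w. (g1 (fst w), g2 (snd w)))" "h = (\<lambda>w. (h1 (fst w), h2 (snd w)))"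
    show ?thesis using eq same[OF g12(1) h12(1) n(1,2)] same[OF g12(2) h12(2) n(3,4)] unfolding e by simp
  next
    assume e: "g = (\<lambda>w. (g1 (snd w), g2 (fst w)))" "h = (\<lambda>w. (h1 (snd w), h2 (fst w)))"
    show ?thesis using eq same[OF g12(1) h12(1) n(3,4)] same[OF g12(2) h12(2) n(1,2)] unfolding e by simp
  next
    assume e: "g = (\<lambda>w. (g1 (fst w), g2 (snd w)))" "h = (\<lambda>w. (h1 (snd w), h2 (fst w)))"
    show ?thesis using eq cross[OF g12(1) h12(1)] unfolding e by simp
  next
    assume e: "g = (\<lambda>w. (g1 (snd w), g2 (fst w)))" "h = (\<lambda>w. (h1 (fst w), h2 (snd w)))"
    show ?thesis using eq cross[OF h12(1) g12(1)] unfolding e by simp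
  qed
qed

section \<open>Charts of an atlas\<close>

lemma atlas_chart:
  assumes "atlas P M \<A>" "(U, c) \<in> \<A>"
  shows "U \<subseteq> M" "openin (top_of_set M) U" "open (c ` U)" "continuous_on U c" "continuous_on (c ` U) (inv_into U c)"
    "\<And>p. p \<in> U \<Longrightarrow> inv_into U c (c p) = p"
    "\<And>y. y \<in> c ` U \<Longrightarrow> inv_into U c y \<in> U" "\<And>y. y \<in> c ` U \<Longrightarrow> c (inv_into U c y) = y"
proof -
  have *: "openin (top_of_set M) U \<and> open (c ` U) \<and> homeomorphism U (c ` U) c (inv_into U c)"
    using assms unfolding atlas_def by blast
  then show "openin (top_of_set M) U" "open (c ` U)" "continuous_on U c" "continuous_on (c ` U) (inv_into U c)"
    "\<And>p. p \<in> U \<Longrightarrow> inv_into U c (c p) = p"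
    by (auto simp: homeomorphism_def)
  then show "U \<subseteq> M" using openin_imp_subset by blast
  show "\<And>y. y \<in> c ` U \<Longrightarrow> inv_into U c y \<in> U" by (rule inv_into_into)
  show "\<And>y. y \<in> c ` U \<Longrightarrow> c (inv_into U c y) = y" by (rule f_inv_into_f)
qed

lemma atlas_cover: "atlas P M \<A> \<Longrightarrow> p \<in> M \<Longrightarrow> \<exists>U c. (U, c) \<in> \<A> \<and> p \<in> U"
  unfolding atlas_def by blast

lemma atlas_transition: "atlas P M \<A> \<Longrightarrow> (U, c) \<in> \<A> \<Longrightarrow> (V, d) \<in> \<A> \<Longrightarrow> P (c ` (U \<inter> V)) (d \<circ> inv_into U c)"
  unfolding atlas_def by blast

lemma atlas_openin_preimage:
  assumes "atlas P M \<A>" "(U, c) \<in> \<A>" "open B"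
  shows "openin (top_of_set M) (U \<inter> c -` B)"
  using continuous_openin_preimage_gen[OF atlas_chart(4)[OF assms(1,2)] assms(3)]
    atlas_chart(2)[OF assms(1,2)] openin_trans by blast

lemma atlas_near:
  assumes "atlas P M \<A>" "(U, c) \<in> \<A>" "open B" "p \<in> U" "c p \<in> B"
  shows "\<forall>\<^sub>F q in near M p. q \<in> U \<and> c q \<in> B"
proof -
  obtain T where "open T" "U \<inter> c -` B = M \<inter> T"
    using atlas_openin_preimage[OF assms(1-3)] by (auto simp: openin_open)
  then show ?thesis unfolding eventually_near using assms(4,5) by (intro exI[of _ T]) blast
qed

lemma atlas_near_coordinates:
  assumes "atlas P M \<A>" "(U, c) \<in> \<A>" "p \<in> U" "eventually Q (near M p)"
  shows "\<exists>B. open B \<and> c p \<in> B \<and> B \<subseteq> c ` U \<and> (\<forall>y\<in>B. Q (inv_into U c y))"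
proof -
  note ch = atlas_chart[OF assms(1,2)]
  have "eventually (\<lambda>y. Q (inv_into U c y)) (near (c ` U) (c p))"
    by (rule eventually_near_compose[OF ch(5), of M]) (use ch assms(3,4) in auto)
  then obtain T where T: "open T" "c p \<in> T" "\<forall>y\<in>T \<inter> c ` U. Q (inv_into U c y)"
    unfolding eventually_near by blast
  then show ?thesis using ch(3) assms(3) by (intro exI[of _ "T \<inter> c ` U"]) auto
qed

text \<open>Balls in the coordinates provide path connected neighbourhoods.\<close>

lemma atlas_locally_path_connected:
  assumes "atlas P M \<A>"
  shows "locally path_connected M"
proof (rule locallyI)
  fix w p assume w: "openin (top_of_set M) w" "p \<in> w"
  then have p: "p \<in> M" using openin_imp_subset by blast
  then obtain U c where Uc: "(U, c) \<in> \<A>" "p \<in> U" using atlas_cover[OF assms] by blast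
  note ch = atlas_chart[OF assms Uc(1)]
  have "\<forall>\<^sub>F q in near M p. q \<in> w"
    using w unfolding openin_open eventually_near by blast
  then obtain B where B: "open B" "c p \<in> B" "B \<subseteq> c ` U" "\<forall>y\<in>B. inv_into U c y \<in> w"
    using atlas_near_coordinates[OF assms Uc] by blast
  then obtain r where r: "r > 0" "ball (c p) r \<subseteq> B" using open_contains_ball by blast
  define V where "V = U \<inter> c -` ball (c p) r"
  have "V = inv_into U c ` ball (c p) r"
  proof
    show "V \<subseteq> inv_into U c ` ball (c p) r"
      unfolding V_def using ch(6) by (metis (no_types, lifting) IntE image_eqI subsetI vimageE)
    show "inv_into U c ` ball (c p) r \<subseteq> V"
      unfolding V_def using ch(7,8) r(2) B(3) by auto
  qed
  moreover have "path_connected (inv_into U c ` ball (c p) r)"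
    using ch(5) r(2) B(3) by (intro path_connected_continuous_image)
      (auto intro: continuous_on_subset convex_imp_path_connected)
  ultimately have "path_connected V" "V \<subseteq> w" using B(4) r(2) by auto
  moreover have "openin (top_of_set M) V" unfolding V_def
    by (rule atlas_openin_preimage[OF assms Uc(1) open_ball])
  moreover have "p \<in> V" using Uc(2) r(1) by (simp add: V_def)
  ultimately show "\<exists>U V. openin (top_of_set M) U \<and> path_connected V \<and> p \<in> U \<and> U \<subseteq> V \<and> V \<subseteq> w" by blast
qed

lemma atlasI:
  assumes cover: "\<And>p. p \<in> M \<Longrightarrow> \<exists>U c. (U, c) \<in> \<A> \<and> p \<in> U"
    and chart: "\<And>U c. (U, c) \<in> \<A> \<Longrightarrow> openin (top_of_set M) U \<and> open (c ` U) \<and> homeomorphism U (c ` U) c (inv_into U c)"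
    and trans: "\<And>U c V d. (U, c) \<in> \<A> \<Longrightarrow> (V, d) \<in> \<A> \<Longrightarrow> P (c ` (U \<inter> V)) (d \<circ> inv_into U c)"
  shows "atlas P M \<A>"
  unfolding atlas_def
proof (intro conjI)
  have "U \<subseteq> M" if "(U, c) \<in> \<A>" for U c using chart[OF that] openin_imp_subset by blast
  then show "M = (\<Union>(U, c)\<in>\<A>. U)" using cover by fast
  show "\<forall>(U, c)\<in>\<A>. openin (top_of_set M) U \<and> open (c ` U) \<and> homeomorphism U (c ` U) c (inv_into U c)"
    using chart by fast
  show "\<forall>(U, c)\<in>\<A>. \<forall>(V, d)\<in>\<A>. P (c ` (U \<inter> V)) (d \<circ> inv_into U c)"
    using trans by fast
qed

lemma atlas_open_image:
  assumes "atlas P M \<A>" "(U, c) \<in> \<A>" "openin (top_of_set M) T"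
  shows "open (c ` (U \<inter> T))"
proof -
  obtain O' where O': "open O'" "T = M \<inter> O'" using assms(3) by (auto simp: openin_open)
  note ch = atlas_chart[OF assms(1,2)]
  have "c ` (U \<inter> T) = c ` U \<inter> inv_into U c -` O'"
    using ch(1,6) O'(2) by (auto simp: image_iff)
  then show ?thesis using continuous_open_preimage[OF ch(5,3) O'(1)] by simp
qed

section \<open>The global null frame of a simply connected minimal surface\<close>

locale minimal_surface =
  fixes M :: "'m::{t2_space, second_countable_topology} set" and \<A> :: "'m chart set" and g :: "'m metric"
    and F :: "'m \<Rightarrow> real ^ 4"
  assumes surface: "lorentzian_surface M \<A> g" and immersion: "isometric_immersion \<A> g F"
    and minimal: "minimal \<A> F"
begin

lemma smooth_atlas: "atlas smooth_on M \<A>"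
  using surface by (simp add: lorentzian_surface_def smooth_surface_def)

lemmas chart = atlas_chart[OF smooth_atlas]

lemma smooth_F: "(U, c) \<in> \<A> \<Longrightarrow> smooth_on (c ` U) (F \<circ> inv_into U c)"
  using immersion unfolding isometric_immersion_def immersion_def by blast

lemma signature_F:
  assumes "(U, c) \<in> \<A>" "x \<in> c ` U"
  shows "signature_1_1 (pullback_metric (F \<circ> inv_into U c) x)"
proof -
  have "pullback_metric (F \<circ> inv_into U c) x = g (U, c) x"
    using immersion assms unfolding isometric_immersion_def by blast
  moreover have "signature_1_1 (g (U, c) x)"
    using surface assms unfolding lorentzian_surface_def lorentzian_metric_def by blast
  ultimately show ?thesis by simp
qed

lemma mean_curvature_F: "(U, c) \<in> \<A> \<Longrightarrow> x \<in> c ` U \<Longrightarrow> mean_curvature (F \<circ> inv_into U c) x = 0"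
  using minimal unfolding minimal_def by blast

definition frame_on :: "'m set \<Rightarrow> ('m \<Rightarrow> lorentz) \<Rightarrow> ('m \<Rightarrow> wave \<times> wave) \<Rightarrow> lorentz set \<Rightarrow> bool" where
  "frame_on U c \<sigma> B \<longleftrightarrow> open B \<and> B \<subseteq> c ` U \<and>
     null_frame B (F \<circ> inv_into U c) (\<lambda>x. fst (\<sigma> (inv_into U c x))) (\<lambda>x. snd (\<sigma> (inv_into U c x)))"

definition frame_at :: "'m \<Rightarrow> ('m \<Rightarrow> wave \<times> wave) \<Rightarrow> bool" where
  "frame_at p \<sigma> \<longleftrightarrow> (\<exists>U c B. (U, c) \<in> \<A> \<and> p \<in> U \<and> frame_on U c \<sigma> B \<and> c p \<in> B)"

lemma frame_on_subset: "frame_on U c \<sigma> B \<Longrightarrow> open B' \<Longrightarrow> B' \<subseteq> B \<Longrightarrow> frame_on U c \<sigma> B'"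
  unfolding frame_on_def using null_frame_subset by blast

lemma frame_on_cong:
  assumes "frame_on U c \<sigma> B" "\<And>y. y \<in> B \<Longrightarrow> \<sigma> (inv_into U c y) = \<tau> (inv_into U c y)"
  shows "frame_on U c \<tau> B"
  using assms null_frame_cong[of B "F \<circ> inv_into U c" "F \<circ> inv_into U c" "\<lambda>x. fst (\<sigma> (inv_into U c x))"
      "\<lambda>x. fst (\<tau> (inv_into U c x))" "\<lambda>x. snd (\<sigma> (inv_into U c x))" "\<lambda>x. snd (\<tau> (inv_into U c x))"]
  unfolding frame_on_def by simp

text \<open>The definition of \<open>frame_at\<close> mentions one chart; by invariance under changes of coordinates, a
  frame may be examined in every chart around the point.\<close>

lemma frame_at_chart:
  assumes "frame_at p \<sigma>" and Vd: "(V, d) \<in> \<A>" "p \<in> V"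
  shows "\<exists>B. frame_on V d \<sigma> B \<and> d p \<in> B"
proof -
  obtain U c B where Uc: "(U, c) \<in> \<A>" "p \<in> U" and B: "frame_on U c \<sigma> B" "c p \<in> B"
    using assms(1) unfolding frame_at_def by blast
  note cU = chart[OF Uc(1)] and cV = chart[OF Vd(1)]
  define \<theta> where "\<theta> = c \<circ> inv_into V d"
  define \<eta> where "\<eta> = d \<circ> inv_into U c"
  have \<theta>: "smooth_on (d ` (V \<inter> U)) \<theta>" and \<eta>: "smooth_on (c ` (U \<inter> V)) \<eta>"
    unfolding \<theta>_def \<eta>_def using atlas_transition[OF smooth_atlas] Uc Vd by blast+
  have \<theta>im: "\<theta> ` (d ` (V \<inter> U)) \<subseteq> c ` (U \<inter> V)" by (auto simp: \<theta>_def cV(6))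
  have \<eta>\<theta>: "\<eta> (\<theta> y) = y" if "y \<in> d ` (V \<inter> U)" for y
    using that by (auto simp: \<theta>_def \<eta>_def cV(6) cU(6))
  define B' where "B' = d ` (V \<inter> U) \<inter> \<theta> -` B"
  have opB: "open B" "B \<subseteq> c ` U" using B(1) by (auto simp: frame_on_def)
  have opB': "open B'" unfolding B'_def
    by (rule continuous_open_preimage[OF smooth_on_continuous_on[OF \<theta>] smooth_on_open[OF \<theta>] opB(1)])
  have "null_frame B' (\<lambda>x. (F \<circ> inv_into U c) (\<theta> x)) (\<lambda>x. fst (\<sigma> (inv_into U c (\<theta> x)))) (\<lambda>x. snd (\<sigma> (inv_into U c (\<theta> x))))"
  proof (rule null_frame_compose)
    show "null_frame B (F \<circ> inv_into U c) (\<lambda>x. fst (\<sigma> (inv_into U c x))) (\<lambda>x. snd (\<sigma> (inv_into U c x)))"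
      using B(1) by (simp add: frame_on_def)
    show "smooth_on B (F \<circ> inv_into U c)" by (rule smooth_on_subset[OF smooth_F[OF Uc(1)] opB])
    show "smooth_on B' \<theta>" by (rule smooth_on_subset[OF \<theta> opB']) (auto simp: B'_def)
    show "\<theta> ` B' \<subseteq> B" by (auto simp: B'_def)
    fix x h assume x: "x \<in> B'" and 0: "fderiv \<theta> x h = 0"
    have x': "x \<in> d ` (V \<inter> U)" using x by (simp add: B'_def)
    have "linear (fderiv \<eta> (\<theta> x))" by (rule smooth_on_linear_fderiv[OF \<eta>]) (use \<theta>im x' in blast)
    then show "h = 0" using fderiv_left_inverse[OF \<theta> \<eta> \<theta>im \<eta>\<theta> x', of h] 0 by (simp add: linear_0)
  qed
  moreover have "inv_into U c (\<theta> x) = inv_into V d x" if "x \<in> B'" for x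
    using that by (auto simp: B'_def \<theta>_def cV(6) cU(6))
  ultimately have "null_frame B' (F \<circ> inv_into V d) (\<lambda>x. fst (\<sigma> (inv_into V d x))) (\<lambda>x. snd (\<sigma> (inv_into V d x)))"
    by (intro null_frame_cong[OF opB' _ _ _ \<open>null_frame B' _ _ _\<close>]) auto
  moreover have "B' \<subseteq> d ` V" by (auto simp: B'_def)
  moreover have "d p \<in> B'" using Uc(2) Vd(2) B(2) by (auto simp: B'_def \<theta>_def cV(6))
  ultimately show ?thesis using opB' unfolding frame_on_def by blast
qed

lemma frame_at_cong:
  assumes "p \<in> M" "frame_at p \<sigma>" "\<forall>\<^sub>F q in near M p. \<sigma> q = \<tau> q"
  shows "frame_at p \<tau>"
proof -
  obtain U c B where Uc: "(U, c) \<in> \<A>" "p \<in> U" and B: "frame_on U c \<sigma> B" "c p \<in> B"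
    using assms(2) unfolding frame_at_def by blast
  obtain B' where B': "open B'" "c p \<in> B'" "\<forall>y\<in>B'. \<sigma> (inv_into U c y) = \<tau> (inv_into U c y)"
    using atlas_near_coordinates[OF smooth_atlas Uc assms(3)] by blast
  have "frame_on U c \<sigma> (B \<inter> B')"
    by (rule frame_on_subset[OF B(1)]) (use B(1) B'(1) in \<open>auto simp: frame_on_def\<close>)
  then have "frame_on U c \<tau> (B \<inter> B')" by (rule frame_on_cong) (use B'(3) in blast)
  then show ?thesis unfolding frame_at_def using Uc B(2) B'(2) by blast
qed

sublocale frames: local_problem M frame_values frame_sym frame_at
proof
  fix p \<sigma> assume p: "p \<in> M" and \<sigma>: "frame_at p \<sigma>"
  obtain U c B where Uc: "(U, c) \<in> \<A>" "p \<in> U" and B: "frame_on U c \<sigma> B" "c p \<in> B"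
    using \<sigma> unfolding frame_at_def by blast
  show "\<sigma> p \<in> frame_values"
    using B chart(6)[OF Uc] unfolding frame_on_def null_frame_def null_wave_def frame_values_def by auto
  have "\<forall>\<^sub>F q in near M p. q \<in> U \<and> c q \<in> B"
    by (rule atlas_near[OF smooth_atlas Uc(1) _ Uc(2) B(2)]) (use B(1) in \<open>simp add: frame_on_def\<close>)
  then show "\<forall>\<^sub>F q in near M p. frame_at q \<sigma>"
    by eventually_elim (use Uc B(1) frame_at_def in blast)
  show "frame_at p (\<lambda>x. h (\<sigma> x))" if h: "h \<in> frame_sym" for h
  proof -
    have "frame_on U c (\<lambda>x. h (\<sigma> x)) B"
      using B(1) null_frame_sym[OF _ h, of B "F \<circ> inv_into U c" "\<lambda>x. \<sigma> (inv_into U c x)"]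
      unfolding frame_on_def by blast
    then show ?thesis unfolding frame_at_def using Uc B(2) by blast
  qed
  show "\<exists>h\<in>frame_sym. \<forall>\<^sub>F q in near M p. \<tau> q = h (\<sigma> q)" if \<tau>: "frame_at p \<tau>" for \<tau>
  proof -
    obtain B2 where B2: "frame_on U c \<tau> B2" "c p \<in> B2" using frame_at_chart[OF \<tau> Uc] by blast
    have op: "open (B \<inter> B2)" using B(1) B2(1) by (auto simp: frame_on_def)
    have "\<exists>h\<in>frame_sym. \<forall>\<^sub>F x in nhds (c p). \<tau> (inv_into U c x) = h (\<sigma> (inv_into U c x))"
    proof (rule null_frame_unique[where B="B \<inter> B2" and f="F \<circ> inv_into U c"])
      show "null_frame (B \<inter> B2) (F \<circ> inv_into U c) (\<lambda>x. fst (\<sigma> (inv_into U c x))) (\<lambda>x. snd (\<sigma> (inv_into U c x)))"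
        using frame_on_subset[OF B(1) op] by (simp add: frame_on_def)
      show "null_frame (B \<inter> B2) (F \<circ> inv_into U c) (\<lambda>x. fst (\<tau> (inv_into U c x))) (\<lambda>x. snd (\<tau> (inv_into U c x)))"
        using frame_on_subset[OF B2(1) op] by (simp add: frame_on_def)
    qed (use op B(2) B2(2) in auto)
    then obtain h where h: "h \<in> frame_sym" "\<forall>\<^sub>F x in nhds (c p). \<tau> (inv_into U c x) = h (\<sigma> (inv_into U c x))" by blast
    then obtain T where T: "open T" "c p \<in> T" "\<forall>x\<in>T. \<tau> (inv_into U c x) = h (\<sigma> (inv_into U c x))"
      unfolding eventually_nhds by blast
    have "\<forall>\<^sub>F q in near M p. q \<in> U \<and> c q \<in> T" by (rule atlas_near[OF smooth_atlas Uc(1) T(1) Uc(2) T(2)])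
    then have "\<forall>\<^sub>F q in near M p. \<tau> q = h (\<sigma> q)"
      by eventually_elim (use T(3) chart(6)[OF Uc(1)] in metis)
    then show ?thesis using h(1) by blast
  qed
next
  fix p assume p: "p \<in> M"
  then obtain U c where Uc: "(U, c) \<in> \<A>" "p \<in> U" using atlas_cover[OF smooth_atlas] by blast
  then obtain B w1 w2 where B: "open B" "c p \<in> B" "B \<subseteq> c ` U" "null_frame B (F \<circ> inv_into U c) w1 w2"
    using minimal_null_frame_exists[OF smooth_F[OF Uc(1)] _ signature_F[OF Uc(1)] mean_curvature_F[OF Uc(1)], of "c p"]
    by auto
  have "frame_on U c (\<lambda>q. (w1 (c q), w2 (c q))) B"
    unfolding frame_on_def fst_conv snd_conv
  proof (intro conjI B)
    have "c (inv_into U c x) = x" if "x \<in> B" for x using chart(8)[OF Uc(1)] B(3) that by blast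
    then show "null_frame B (F \<circ> inv_into U c) (\<lambda>x. w1 (c (inv_into U c x))) (\<lambda>x. w2 (c (inv_into U c x)))"
      by (intro null_frame_cong[OF B(1) _ _ _ B(4)]) auto
  qed
  then show "\<exists>\<sigma>. frame_at p \<sigma>" unfolding frame_at_def using Uc B(2) by blast
qed (rule frame_sym_free)

lemma global_frame:
  assumes "simply_connected M"
  shows "\<exists>u. \<forall>p\<in>M. frame_at p u"
proof -
  obtain u where u: "\<forall>p\<in>M. \<exists>\<sigma>. frame_at p \<sigma> \<and> (\<forall>\<^sub>F q in near M p. u q = \<sigma> q)"
    using frames.monodromy[OF assms atlas_locally_path_connected[OF smooth_atlas]] by blast
  have "frame_at p u" if p: "p \<in> M" for p
  proof -
    obtain \<sigma> where "frame_at p \<sigma>" "\<forall>\<^sub>F q in near M p. u q = \<sigma> q" using u p by blast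
    then show ?thesis using frame_at_cong[OF p] by (simp add: eq_commute)
  qed
  then show ?thesis by blast
qed

end

section \<open>Representation of a minimal surface\<close>

text \<open>The Lorentz number with null components \<open>x\<close> and \<open>y\<close>.\<close>

definition lnull :: "real \<Rightarrow> real \<Rightarrow> lorentz" where
  "lnull x y = Lor ((x + y) / 2) ((x - y) / 2)"

lemma lnull_simps [simp]: "lRe (lnull x y) = (x + y) / 2" "lIm (lnull x y) = (x - y) / 2"
  by (simp_all add: lnull_def)

lemma lconj_lnull: "lconj (lnull x y) = lnull y x"
  by (auto simp: lorentz_eq_iff minus_divide_left add.commute)

text \<open>The first null components of \<open>\<psi>1\<close>, \<open>\<psi>2\<close> and of the conjugates of \<open>\<phi>1\<close>, \<open>\<phi>2\<close> are the coordinates of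
  the factors of the first null vector, the second ones those of the second null vector.  In the second component \<open>e\<close> and \<open>f\<close> change places: the last
  coordinate is an imaginary part, on which the second null component enters with a negative sign,
  and this sign is compensated by the exchange.\<close>

lemma weier_vec_lnull:
  "weier_vec (lnull (Re e1) (Re f2)) (lnull (Im e1) (Im f2)) (lnull (Re e2) (Re f1)) (lnull (Im e2) (Im f1)) h
     = ((lRe h + lIm h) / 2) *\<^sub>R null_vec e1 f1 + ((lRe h - lIm h) / 2) *\<^sub>R null_vec e2 f2"
  by (rule vec4_eqI)
    (simp_all add: weier_vec_nth weier_defs null_vec_nth lconj_lnull field_simps)

lemma weier_det_lnull:
  "weier_det (lnull (Re e1) (Re f2)) (lnull (Im e1) (Im f2)) (lnull (Re e2) (Re f1)) (lnull (Im e2) (Im f1))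
     = - Im (e1 * cnj e2) * Im (f1 * cnj f2)"
  by (simp add: weier_det_def lform_def field_simps)

lemma conformal_on_lnull:
  assumes x: "smooth_on S x" "\<And>z. z \<in> S \<Longrightarrow> \<exists>d. (x has_derivative (\<lambda>h. (lRe h + lIm h) * d)) (at z)"
    and y: "smooth_on S y" "\<And>z. z \<in> S \<Longrightarrow> \<exists>d. (y has_derivative (\<lambda>h. (lRe h - lIm h) * d)) (at z)"
  shows "conformal_on S (\<lambda>z. lnull (x z) (y z))"
proof (rule conformal_onI)
  show "smooth_on S (\<lambda>z. lnull (x z) (y z))"
    unfolding lnull_def divide_inverse
    by (intro smooth_on_Lor smooth_on_mult smooth_on_add smooth_on_diff smooth_on_const x(1) y(1) smooth_on_open[OF x(1)])
  fix z assume "z \<in> S"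
  then obtain a b where a: "(x has_derivative (\<lambda>h. (lRe h + lIm h) * a)) (at z)"
    and b: "(y has_derivative (\<lambda>h. (lRe h - lIm h) * b)) (at z)"
    using x(2) y(2) by blast
  have bl: "bounded_linear (\<lambda>p. lnull (fst p) (snd p))"
    unfolding linear_conv_bounded_linear[symmetric] by (auto intro!: linearI simp: lorentz_eq_iff field_simps)
  have "((\<lambda>z. lnull (x z) (y z)) has_derivative (\<lambda>h. lnull ((lRe h + lIm h) * a) ((lRe h - lIm h) * b))) (at z)"
    using bounded_linear.has_derivative[OF bl has_derivative_Pair[OF a b]] by simp
  moreover have "(\<lambda>h. lnull ((lRe h + lIm h) * a) ((lRe h - lIm h) * b)) = (\<lambda>h. lnull a b * h)"
    by (simp add: fun_eq_iff lorentz_eq_iff field_simps)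
  ultimately show "\<exists>d. ((\<lambda>z. lnull (x z) (y z)) has_derivative (\<lambda>h. d * h)) (at z)" by auto
qed

locale framed_surface = minimal_surface +
  fixes u :: "'a \<Rightarrow> wave \<times> wave"
  assumes frame: "p \<in> M \<Longrightarrow> frame_at p u"
begin

text \<open>The null components of \<open>coord\<close> are twice the null coordinates of the frame; this cancels the
  denominators in \<open>weier_vec_lnull\<close>.\<close>

definition coord :: "'a \<Rightarrow> lorentz" where
  "coord p = Lor (fst (fst (u p)) + fst (snd (u p))) (fst (fst (u p)) - fst (snd (u p)))"

definition psi1 :: "'a \<Rightarrow> lorentz" where
  "psi1 p = lnull (Re (fst (snd (fst (u p))))) (Re (snd (snd (snd (u p)))))"

definition psi2 :: "'a \<Rightarrow> lorentz" where
  "psi2 p = lnull (Im (fst (snd (fst (u p))))) (Im (snd (snd (snd (u p)))))"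

definition phi1 :: "'a \<Rightarrow> lorentz" where
  "phi1 p = lnull (Re (fst (snd (snd (u p))))) (Re (snd (snd (fst (u p)))))"

definition phi2 :: "'a \<Rightarrow> lorentz" where
  "phi2 p = lnull (Im (fst (snd (snd (u p))))) (Im (snd (snd (fst (u p)))))"

text \<open>The open sets on which \<open>coord\<close> is a chart, chosen inside one chart of the given atlas so that
  changes of coordinates factor through it.\<close>

definition coord_domain_in :: "'a set \<Rightarrow> 'a set \<Rightarrow> ('a \<Rightarrow> lorentz) \<Rightarrow> bool" where
  "coord_domain_in W U c \<longleftrightarrow> (U, c) \<in> \<A> \<and> W \<subseteq> U \<and> openin (top_of_set M) W \<and> frame_on U c u (c ` W) \<and>
     open (coord ` W) \<and> homeomorphism W (coord ` W) coord (inv_into W coord) \<and>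
     smooth_on (coord ` W) (c \<circ> inv_into W coord)"

definition coord_domain :: "'a set \<Rightarrow> bool" where
  "coord_domain W \<longleftrightarrow> (\<exists>U c. coord_domain_in W U c)"

lemma coord_in_chart:
  assumes B: "frame_on U c u B"
  shows "smooth_on B (coord \<circ> inv_into U c)"
    and "x \<in> B \<Longrightarrow> fderiv (coord \<circ> inv_into U c) x h =
       Lor (fst (fderiv (\<lambda>x. fst (u (inv_into U c x))) x h) + fst (fderiv (\<lambda>x. snd (u (inv_into U c x))) x h))
           (fst (fderiv (\<lambda>x. fst (u (inv_into U c x))) x h) - fst (fderiv (\<lambda>x. snd (u (inv_into U c x))) x h))"
    and "x \<in> B \<Longrightarrow> fderiv (coord \<circ> inv_into U c) x h = 0 \<Longrightarrow> h = 0"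
proof -
  let ?w1 = "\<lambda>x. fst (u (inv_into U c x))" and ?w2 = "\<lambda>x. snd (u (inv_into U c x))"
  have nf: "null_frame B (F \<circ> inv_into U c) ?w1 ?w2" using B by (simp add: frame_on_def)
  then have sm: "smooth_on B ?w1" "smooth_on B ?w2" by (auto simp: null_frame_def null_wave_def)
  have eq: "coord \<circ> inv_into U c = (\<lambda>x. Lor (fst (?w1 x) + fst (?w2 x)) (fst (?w1 x) - fst (?w2 x)))"
    by (simp add: coord_def fun_eq_iff)
  show "smooth_on B (coord \<circ> inv_into U c)" unfolding eq
    by (intro smooth_on_Lor smooth_on_add smooth_on_diff smooth_on_fst sm)
  show d: "fderiv (coord \<circ> inv_into U c) x h =
       Lor (fst (fderiv ?w1 x h) + fst (fderiv ?w2 x h)) (fst (fderiv ?w1 x h) - fst (fderiv ?w2 x h))"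
    if x: "x \<in> B" for x h
  proof -
    have bl: "bounded_linear (\<lambda>p. Lor (fst p + snd p) (fst p - snd p))"
      unfolding linear_conv_bounded_linear[symmetric] by (auto intro!: linearI simp: lorentz_eq_iff algebra_simps)
    have "((\<lambda>x. (fst (?w1 x), fst (?w2 x))) has_derivative (\<lambda>h. (fst (fderiv ?w1 x h), fst (fderiv ?w2 x h)))) (at x)"
      by (intro has_derivative_Pair has_derivative_fst smooth_on_has_derivative[OF sm(1) x] smooth_on_has_derivative[OF sm(2) x])
    from fderiv_eqI[OF bounded_linear.has_derivative[OF bl this]] show ?thesis unfolding eq by simp
  qed
  show "h = 0" if x: "x \<in> B" and 0: "fderiv (coord \<circ> inv_into U c) x h = 0"
  proof -
    have "fst (fderiv ?w1 x h) = 0 \<and> fst (fderiv ?w2 x h) = 0"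
      using 0 unfolding d[OF x] by (simp add: lorentz_eq_iff)
    then show ?thesis using nf x unfolding null_frame_def by blast
  qed
qed

lemma coord_domain_exists:
  assumes p: "p \<in> M"
  shows "\<exists>W. coord_domain W \<and> p \<in> W"
proof -
  obtain U c B where Uc: "(U, c) \<in> \<A>" "p \<in> U" and B: "frame_on U c u B" "c p \<in> B"
    using frame[OF p] unfolding frame_at_def by blast
  note ch = chart[OF Uc(1)] and co = coord_in_chart[OF B(1)]
  define \<alpha> where "\<alpha> = coord \<circ> inv_into U c"
  have "\<exists>B' V \<kappa>. open B' \<and> B' \<subseteq> B \<and> c p \<in> B' \<and> open V \<and> homeomorphism B' V \<alpha> \<kappa> \<and> smooth_on V \<kappa>"
    unfolding \<alpha>_def by (rule smooth_local_inverse[OF co(1) co(3) B(2)])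
  then obtain B' V \<kappa> where inv: "open B'" "B' \<subseteq> B" "c p \<in> B'" "open V" "homeomorphism B' V \<alpha> \<kappa>" "smooth_on V \<kappa>"
    by blast
  have B'U: "B' \<subseteq> c ` U" using inv(2) B(1) by (auto simp: frame_on_def)
  define W where "W = U \<inter> c -` B'"
  have cW: "c ` W = B'" unfolding W_def using B'U by auto
  have coord\<alpha>: "coord q = \<alpha> (c q)" if "q \<in> W" for q using that ch(6) by (simp add: \<alpha>_def W_def)
  have aW: "coord ` W = V"
  proof -
    have "coord ` W = \<alpha> ` (c ` W)" using coord\<alpha> by (auto simp: image_iff)
    then show ?thesis unfolding cW using inv(5) by (simp add: homeomorphism_def)
  qed
  have \<kappa>: "\<kappa> y \<in> B'" "\<alpha> (\<kappa> y) = y" if "y \<in> V" for y using inv(5) that by (auto simp: homeomorphism_def)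
  have \<kappa>\<alpha>: "\<kappa> (\<alpha> x) = x" if "x \<in> B'" for x using inv(5) that by (auto simp: homeomorphism_def)
  have hom: "homeomorphism W V coord (\<lambda>y. inv_into U c (\<kappa> y))"
  proof (rule homeomorphismI)
    have "continuous_on B' \<alpha>" "continuous_on W c" "c ` W \<subseteq> B'"
      using inv(5) continuous_on_subset[OF ch(4)] by (auto simp: homeomorphism_def W_def)
    then have "continuous_on W (\<lambda>q. \<alpha> (c q))" by (rule continuous_on_compose2)
    then show "continuous_on W coord" by (simp add: coord\<alpha> cong: continuous_on_cong)
    show "continuous_on V (\<lambda>y. inv_into U c (\<kappa> y))"
    proof (rule continuous_on_compose2[OF ch(5)])
      show "continuous_on V \<kappa>" using inv(5) by (simp add: homeomorphism_def)
      show "\<kappa> ` V \<subseteq> c ` U" using \<kappa>(1) B'U by auto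
    qed
    show "coord ` W \<subseteq> V" using aW by simp
    show "(\<lambda>y. inv_into U c (\<kappa> y)) ` V \<subseteq> W"
    proof (rule image_subsetI)
      fix y assume "y \<in> V"
      then have "\<kappa> y \<in> B'" "\<kappa> y \<in> c ` U" using \<kappa>(1) B'U by auto
      then show "inv_into U c (\<kappa> y) \<in> W" using ch(7,8) by (simp add: W_def)
    qed
    show "inv_into U c (\<kappa> (coord q)) = q" if "q \<in> W" for q
      using that coord\<alpha>[OF that] \<kappa>\<alpha>[of "c q"] ch(6) by (simp add: W_def)
    show "coord (inv_into U c (\<kappa> y)) = y" if "y \<in> V" for y using \<kappa>(2)[OF that] by (simp add: \<alpha>_def)
  qed
  have inj: "inj_on coord W"
    by (rule inj_on_inverseI[where g="\<lambda>y. inv_into U c (\<kappa> y)"]) (rule homeomorphism_apply1[OF hom])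
  have invW: "inv_into W coord y = inv_into U c (\<kappa> y)" if "y \<in> V" for y
  proof (rule inv_into_f_eq[OF inj])
    show "inv_into U c (\<kappa> y) \<in> W" using hom that by (auto simp: homeomorphism_def)
    show "coord (inv_into U c (\<kappa> y)) = y" by (rule homeomorphism_apply2[OF hom that])
  qed
  have "homeomorphism W V coord (inv_into W coord)"
    by (rule homeomorphism_cong[OF hom]) (simp_all add: invW)
  moreover have "smooth_on V (c \<circ> inv_into W coord)"
  proof (rule smooth_on_cong[OF inv(6)])
    show "\<kappa> y = (c \<circ> inv_into W coord) y" if "y \<in> V" for y
      using \<kappa>(1)[OF that] B'U ch(8) by (auto simp: invW[OF that])
  qed
  moreover have "openin (top_of_set M) W" unfolding W_def by (rule atlas_openin_preimage[OF smooth_atlas Uc(1) inv(1)])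
  moreover have "frame_on U c u (c ` W)" unfolding cW by (rule frame_on_subset[OF B(1) inv(1,2)])
  ultimately have "coord_domain_in W U c"
    unfolding coord_domain_in_def aW using Uc(1) inv(4) by (auto simp: W_def)
  then show ?thesis unfolding coord_domain_def using Uc(2) inv(3) by (auto simp: W_def)
qed

lemma coord_domainD:
  assumes "coord_domain W"
  shows "openin (top_of_set M) W" "W \<subseteq> M" "open (coord ` W)" "continuous_on W coord" "continuous_on (coord ` W) (inv_into W coord)"
    "\<And>q. q \<in> W \<Longrightarrow> inv_into W coord (coord q) = q"
    "\<And>y. y \<in> coord ` W \<Longrightarrow> inv_into W coord y \<in> W" "\<And>y. y \<in> coord ` W \<Longrightarrow> coord (inv_into W coord y) = y"
    "homeomorphism W (coord ` W) coord (inv_into W coord)"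
proof -
  have *: "openin (top_of_set M) W" "open (coord ` W)" "homeomorphism W (coord ` W) coord (inv_into W coord)"
    using assms by (auto simp: coord_domain_def coord_domain_in_def)
  then show "openin (top_of_set M) W" "open (coord ` W)" "homeomorphism W (coord ` W) coord (inv_into W coord)"
    "continuous_on W coord" "continuous_on (coord ` W) (inv_into W coord)"
    "\<And>q. q \<in> W \<Longrightarrow> inv_into W coord (coord q) = q"
    by (auto simp: homeomorphism_def)
  show "W \<subseteq> M" using *(1) openin_imp_subset by blast
  show "\<And>y. y \<in> coord ` W \<Longrightarrow> inv_into W coord y \<in> W" by (rule inv_into_into)
  show "\<And>y. y \<in> coord ` W \<Longrightarrow> coord (inv_into W coord y) = y" by (rule f_inv_into_f)
qed

lemma coord_domain_open_image:
  assumes W: "coord_domain W" and T: "openin (top_of_set M) T"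
  shows "open (coord ` (W \<inter> T))"
proof -
  obtain O' where O': "open O'" "T = M \<inter> O'" using T by (auto simp: openin_open)
  note d = coord_domainD[OF W]
  have "coord ` (W \<inter> T) = coord ` W \<inter> inv_into W coord -` O'"
    using d(2,6) O'(2) by (auto simp: image_iff)
  then show ?thesis using continuous_open_preimage[OF d(5,3) O'(1)] by simp
qed

lemma coord_domain_smooth:
  assumes W: "coord_domain W"
  shows "smooth_on (coord ` W) (\<lambda>y. fst (u (inv_into W coord y)))"
    and "smooth_on (coord ` W) (\<lambda>y. snd (u (inv_into W coord y)))"
proof -
  obtain U c where dom: "coord_domain_in W U c" using W unfolding coord_domain_def by blast
  then have Uc: "(U, c) \<in> \<A>" "W \<subseteq> U" and fr: "frame_on U c u (c ` W)"
    and sm\<kappa>: "smooth_on (coord ` W) (c \<circ> inv_into W coord)"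
    by (auto simp: coord_domain_in_def)
  have sm: "smooth_on (c ` W) (\<lambda>x. fst (u (inv_into U c x)))" "smooth_on (c ` W) (\<lambda>x. snd (u (inv_into U c x)))"
    using fr by (auto simp: frame_on_def null_frame_def null_wave_def)
  have im: "(c \<circ> inv_into W coord) ` (coord ` W) \<subseteq> c ` W" using coord_domainD(6)[OF W] by auto
  have inv: "inv_into U c ((c \<circ> inv_into W coord) z) = inv_into W coord z" if "z \<in> coord ` W" for z
    using chart(6)[OF Uc(1)] coord_domainD(7)[OF W that] Uc(2) by auto
  show "smooth_on (coord ` W) (\<lambda>y. fst (u (inv_into W coord y)))"
    by (rule smooth_on_cong[OF smooth_on_compose[OF sm(1) sm\<kappa> im]]) (simp only: inv)
  show "smooth_on (coord ` W) (\<lambda>y. snd (u (inv_into W coord y)))"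
    by (rule smooth_on_cong[OF smooth_on_compose[OF sm(2) sm\<kappa> im]]) (simp only: inv)
qed

text \<open>The derivatives of the null coordinates with respect to \<open>coord\<close> are the halves of the null
  components of the vector.  A null wave that does not change in the direction of one null component is
  a function of the other one.\<close>

lemma coord_domain_derivatives:
  assumes W: "coord_domain W" and y: "y \<in> coord ` W"
  shows "\<exists>d. ((\<lambda>y. fst (u (inv_into W coord y))) has_derivative (\<lambda>h. (lRe h + lIm h) *\<^sub>R d)) (at y)"
    and "\<exists>d. ((\<lambda>y. snd (u (inv_into W coord y))) has_derivative (\<lambda>h. (lRe h - lIm h) *\<^sub>R d)) (at y)"
    and "((F \<circ> inv_into W coord) has_derivative (\<lambda>h. ((lRe h + lIm h) / 2) *\<^sub>R direction (fst (u (inv_into W coord y)))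
        + ((lRe h - lIm h) / 2) *\<^sub>R direction (snd (u (inv_into W coord y))))) (at y)"
    and "transversal (fst (u (inv_into W coord y))) (snd (u (inv_into W coord y)))"
proof -
  obtain U c where dom: "coord_domain_in W U c" using W unfolding coord_domain_def by blast
  then have Uc: "(U, c) \<in> \<A>" "W \<subseteq> U" and fr: "frame_on U c u (c ` W)"
    and sm\<kappa>: "smooth_on (coord ` W) (c \<circ> inv_into W coord)"
    by (auto simp: coord_domain_in_def)
  note ch = chart[OF Uc(1)] and cd = coord_domainD[OF W] and co = coord_in_chart[OF fr]
  define \<kappa> where "\<kappa> = c \<circ> inv_into W coord"
  define x where "x = \<kappa> y"
  let ?w1 = "\<lambda>x. fst (u (inv_into U c x))" and ?w2 = "\<lambda>x. snd (u (inv_into U c x))"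
  have nf: "null_frame (c ` W) (F \<circ> inv_into U c) ?w1 ?w2" and opW: "open (c ` W)" "c ` W \<subseteq> c ` U"
    using fr by (auto simp: frame_on_def)
  then have sm: "smooth_on (c ` W) ?w1" "smooth_on (c ` W) ?w2" by (auto simp: null_frame_def null_wave_def)
  have smF: "smooth_on (c ` W) (F \<circ> inv_into U c)" by (rule smooth_on_subset[OF smooth_F[OF Uc(1)] opW])
  have im: "\<kappa> ` (coord ` W) \<subseteq> c ` W" using cd(6) by (auto simp: \<kappa>_def)
  have inv: "inv_into U c (\<kappa> z) = inv_into W coord z" if "z \<in> coord ` W" for z
    using ch(6) cd(7)[OF that] Uc(2) by (auto simp: \<kappa>_def)
  have xW: "x \<in> c ` W" using im y by (auto simp: x_def)
  \<comment> \<open>the derivative of the change of coordinates from \<open>coord\<close> to the chart \<open>c\<close>\<close>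
  define K where "K = fderiv \<kappa> y"
  have K: "(\<kappa> has_derivative K) (at y)" unfolding K_def \<kappa>_def by (rule smooth_on_has_derivative[OF sm\<kappa> y])
  have linK: "linear K" using K has_derivative_linear by blast
  have inv\<alpha>: "fderiv (coord \<circ> inv_into U c) (\<kappa> y) (fderiv \<kappa> y h) = h" for h
    by (rule fderiv_left_inverse[OF sm\<kappa>[folded \<kappa>_def] co(1) im _ y]) (simp add: inv cd(8))
  have \<alpha>K: "Lor (fst (fderiv ?w1 x (K h)) + fst (fderiv ?w2 x (K h))) (fst (fderiv ?w1 x (K h)) - fst (fderiv ?w2 x (K h))) = h" for h
    unfolding co(2)[OF xW, symmetric] using inv\<alpha>[of h] by (simp only: x_def K_def)
  have st: "fst (fderiv ?w1 x (K h)) = (lRe h + lIm h) / 2" "fst (fderiv ?w2 x (K h)) = (lRe h - lIm h) / 2" for h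
    using arg_cong[OF \<alpha>K[of h], of lRe] arg_cong[OF \<alpha>K[of h], of lIm] by (simp_all add: field_simps)
  have kill1: "fderiv ?w1 x (K h) = 0" if "lRe h + lIm h = 0" for h
    using nf xW st(1)[of h] that unfolding null_frame_def null_wave_def by auto
  have kill2: "fderiv ?w2 x (K h) = 0" if "lRe h - lIm h = 0" for h
    using nf xW st(2)[of h] that unfolding null_frame_def null_wave_def by auto
  have chain: "((\<lambda>z. f (inv_into W coord z)) has_derivative (\<lambda>h. fderiv (\<lambda>x. f (inv_into U c x)) x (K h))) (at y)"
    if f: "smooth_on (c ` W) (\<lambda>x. f (inv_into U c x))" for f :: "'a \<Rightarrow> 'z::euclidean_space"
  proof -
    have "((\<lambda>z. f (inv_into U c (\<kappa> z))) has_derivative (\<lambda>h. fderiv (\<lambda>x. f (inv_into U c x)) x (K h))) (at y)"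
      unfolding x_def
      by (rule has_derivative_compose[of \<kappa> K y UNIV "\<lambda>x. f (inv_into U c x)", OF K
            smooth_on_has_derivative[OF f xW, unfolded x_def]])
    then show ?thesis
      by (rule has_derivative_transform_within_open[OF _ cd(3) y]) (simp add: inv)
  qed
  have lin: "linear (\<lambda>h. fderiv ?w1 x (K h))" "linear (\<lambda>h. fderiv ?w2 x (K h))"
    using linear_compose[OF linK smooth_on_linear_fderiv[OF sm(1) xW]]
      linear_compose[OF linK smooth_on_linear_fderiv[OF sm(2) xW]] by (simp_all add: o_def)
  have exp1: "fderiv ?w1 x (K h) = (lRe h + lIm h) *\<^sub>R fderiv ?w1 x (K (Lor (1/2) (1/2)))" for h
  proof -
    have "fderiv ?w1 x (K (h - (lRe h + lIm h) *\<^sub>R Lor (1/2) (1/2))) = 0"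
      by (rule kill1) (simp add: field_simps)
    then show ?thesis by (simp only: linear_diff[OF lin(1)] linear_cmul[OF lin(1)] right_minus_eq)
  qed
  show "\<exists>d. ((\<lambda>y. fst (u (inv_into W coord y))) has_derivative (\<lambda>h. (lRe h + lIm h) *\<^sub>R d)) (at y)"
    using chain[OF sm(1)] unfolding ext[of "\<lambda>h. fderiv ?w1 x (K h)", OF exp1] by blast
  have exp2: "fderiv ?w2 x (K h) = (lRe h - lIm h) *\<^sub>R fderiv ?w2 x (K (Lor (1/2) (-1/2)))" for h
  proof -
    have "fderiv ?w2 x (K (h - (lRe h - lIm h) *\<^sub>R Lor (1/2) (-1/2))) = 0"
      by (rule kill2) (simp add: field_simps)
    then show ?thesis by (simp only: linear_diff[OF lin(2)] linear_cmul[OF lin(2)] right_minus_eq)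
  qed
  show "\<exists>d. ((\<lambda>y. snd (u (inv_into W coord y))) has_derivative (\<lambda>h. (lRe h - lIm h) *\<^sub>R d)) (at y)"
    using chain[OF sm(2)] unfolding ext[of "\<lambda>h. fderiv ?w2 x (K h)", OF exp2] by blast
  have u: "inv_into U c x = inv_into W coord y" unfolding x_def by (rule inv[OF y])
  show "transversal (fst (u (inv_into W coord y))) (snd (u (inv_into W coord y)))"
    using nf xW u unfolding null_frame_def by metis
  have "fderiv (F \<circ> inv_into U c) x (K h) = ((lRe h + lIm h) / 2) *\<^sub>R direction (fst (u (inv_into W coord y)))
        + ((lRe h - lIm h) / 2) *\<^sub>R direction (snd (u (inv_into W coord y)))" for h
    using nf xW u st unfolding null_frame_def by metis
  then show "((F \<circ> inv_into W coord) has_derivative (\<lambda>h. ((lRe h + lIm h) / 2) *\<^sub>R direction (fst (u (inv_into W coord y)))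
        + ((lRe h - lIm h) / 2) *\<^sub>R direction (snd (u (inv_into W coord y))))) (at y)"
    using chain[of F] smF by (simp add: o_def)
qed

lemma coord_domain_conformal:
  assumes W: "coord_domain W"
  shows "conformal_on (coord ` W) (psi1 \<circ> inv_into W coord)" "conformal_on (coord ` W) (psi2 \<circ> inv_into W coord)"
    "conformal_on (coord ` W) ((\<lambda>p. lconj (phi1 p)) \<circ> inv_into W coord)"
    "conformal_on (coord ` W) ((\<lambda>p. lconj (phi2 p)) \<circ> inv_into W coord)"
proof -
  have sm: "smooth_on (coord ` W) (\<lambda>y. fst (u (inv_into W coord y)))"
    "smooth_on (coord ` W) (\<lambda>y. snd (u (inv_into W coord y)))"
    using coord_domain_smooth[OF W] by auto
  have 1: "smooth_on (coord ` W) (\<lambda>y. L (fst (u (inv_into W coord y))))"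
    "y \<in> coord ` W \<Longrightarrow> \<exists>d. ((\<lambda>y. L (fst (u (inv_into W coord y)))) has_derivative (\<lambda>h. (lRe h + lIm h) * d)) (at y)"
    if L: "bounded_linear L" for L :: "wave \<Rightarrow> real" and y
  proof -
    show "smooth_on (coord ` W) (\<lambda>y. L (fst (u (inv_into W coord y))))"
      by (rule smooth_on_linear_compose[OF L sm(1)])
    assume "y \<in> coord ` W"
    then obtain d where d: "((\<lambda>y. fst (u (inv_into W coord y))) has_derivative (\<lambda>h. (lRe h + lIm h) *\<^sub>R d)) (at y)"
      using coord_domain_derivatives(1)[OF W] by blast
    from bounded_linear.has_derivative[OF L d]
    show "\<exists>d. ((\<lambda>y. L (fst (u (inv_into W coord y)))) has_derivative (\<lambda>h. (lRe h + lIm h) * d)) (at y)"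
      by (auto simp: linear_cmul[OF bounded_linear.linear[OF L]])
  qed
  have 2: "smooth_on (coord ` W) (\<lambda>y. L (snd (u (inv_into W coord y))))"
    "y \<in> coord ` W \<Longrightarrow> \<exists>d. ((\<lambda>y. L (snd (u (inv_into W coord y)))) has_derivative (\<lambda>h. (lRe h - lIm h) * d)) (at y)"
    if L: "bounded_linear L" for L :: "wave \<Rightarrow> real" and y
  proof -
    show "smooth_on (coord ` W) (\<lambda>y. L (snd (u (inv_into W coord y))))"
      by (rule smooth_on_linear_compose[OF L sm(2)])
    assume "y \<in> coord ` W"
    then obtain d where d: "((\<lambda>y. snd (u (inv_into W coord y))) has_derivative (\<lambda>h. (lRe h - lIm h) *\<^sub>R d)) (at y)"
      using coord_domain_derivatives(2)[OF W] by blast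
    from bounded_linear.has_derivative[OF L d]
    show "\<exists>d. ((\<lambda>y. L (snd (u (inv_into W coord y)))) has_derivative (\<lambda>h. (lRe h - lIm h) * d)) (at y)"
      by (auto simp: linear_cmul[OF bounded_linear.linear[OF L]])
  qed
  have L: "bounded_linear (\<lambda>w::wave. Re (fst (snd w)))" "bounded_linear (\<lambda>w::wave. Im (fst (snd w)))"
    "bounded_linear (\<lambda>w::wave. Re (snd (snd w)))" "bounded_linear (\<lambda>w::wave. Im (snd (snd w)))"
    by (auto simp: linear_conv_bounded_linear[symmetric] intro!: linearI)
  have *: "conformal_on (coord ` W) (\<lambda>y. lnull (L (fst (u (inv_into W coord y)))) (L' (snd (u (inv_into W coord y)))))"
    if "bounded_linear L" "bounded_linear L'" for L L' :: "wave \<Rightarrow> real"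
    by (rule conformal_on_lnull) (use 1[OF that(1)] 2[OF that(2)] in blast)+
  show "conformal_on (coord ` W) (psi1 \<circ> inv_into W coord)" "conformal_on (coord ` W) (psi2 \<circ> inv_into W coord)"
    "conformal_on (coord ` W) ((\<lambda>p. lconj (phi1 p)) \<circ> inv_into W coord)"
    "conformal_on (coord ` W) ((\<lambda>p. lconj (phi2 p)) \<circ> inv_into W coord)"
    using *[OF L(1,3)] *[OF L(2,4)] *[OF L(3,1)] *[OF L(4,2)]
    by (simp_all add: o_def psi1_def psi2_def phi1_def phi2_def lconj_lnull)
qed

lemma coord_domain_F_derivative:
  assumes W: "coord_domain W" and y: "y \<in> coord ` W"
  shows "((F \<circ> inv_into W coord) has_derivative weier_vec (psi1 (inv_into W coord y)) (psi2 (inv_into W coord y))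
       (phi1 (inv_into W coord y)) (phi2 (inv_into W coord y))) (at y)"
    and "weier_det (psi1 (inv_into W coord y)) (psi2 (inv_into W coord y)) (phi1 (inv_into W coord y)) (phi2 (inv_into W coord y)) \<noteq> 0"
proof -
  show "((F \<circ> inv_into W coord) has_derivative weier_vec (psi1 (inv_into W coord y)) (psi2 (inv_into W coord y))
       (phi1 (inv_into W coord y)) (phi2 (inv_into W coord y))) (at y)"
    by (rule has_derivative_eq_rhs[OF coord_domain_derivatives(3)[OF W y]])
      (simp add: fun_eq_iff psi1_def psi2_def phi1_def phi2_def weier_vec_lnull direction_def)
  show "weier_det (psi1 (inv_into W coord y)) (psi2 (inv_into W coord y)) (phi1 (inv_into W coord y)) (phi2 (inv_into W coord y)) \<noteq> 0"
    using coord_domain_derivatives(4)[OF W y]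
    unfolding psi1_def psi2_def phi1_def phi2_def weier_det_lnull transversal_def by simp
qed

definition coord_atlas :: "'a chart set" where
  "coord_atlas = {(W, coord) | W. coord_domain W}"

lemma coord_transition:
  assumes "coord_domain W" "coord_domain W'"
  shows "conformal_on (coord ` (W \<inter> W')) (coord \<circ> inv_into W coord)"
proof (rule conformal_on_cong[OF conformal_on_id])
  show "open (coord ` (W \<inter> W'))"
    by (rule coord_domain_open_image[OF assms(1) coord_domainD(1)[OF assms(2)]])
  show "y = (coord \<circ> inv_into W coord) y" if "y \<in> coord ` (W \<inter> W')" for y
    using that coord_domainD(8)[OF assms(1)] by auto
qed

lemma lorentz_surface_coord_atlas: "lorentz_surface M coord_atlas"
  unfolding lorentz_surface_def
proof (rule atlasI)
  show "\<exists>U c. (U, c) \<in> coord_atlas \<and> p \<in> U" if "p \<in> M" for p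
    using coord_domain_exists[OF that] by (auto simp: coord_atlas_def)
  show "openin (top_of_set M) U \<and> open (c ` U) \<and> homeomorphism U (c ` U) c (inv_into U c)"
    if "(U, c) \<in> coord_atlas" for U c
    using that coord_domainD(1,3,9) by (auto simp: coord_atlas_def)
  show "conformal_on (c ` (U \<inter> V)) (d \<circ> inv_into U c)"
    if "(U, c) \<in> coord_atlas" "(V, d) \<in> coord_atlas" for U c V d
    using that coord_transition by (auto simp: coord_atlas_def)
qed

lemma smooth_surface_coord_atlas: "smooth_surface M (\<A> \<union> coord_atlas)"
proof -
  have LA: "smooth_on (coord ` (W \<inter> U')) (c' \<circ> inv_into W coord)" and AL: "smooth_on (c' ` (U' \<inter> W)) (coord \<circ> inv_into U' c')"
    if W: "coord_domain W" and U': "(U', c') \<in> \<A>" for W U' c'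
  proof -
    obtain U c where dom: "coord_domain_in W U c" using W unfolding coord_domain_def by blast
    then have Uc: "(U, c) \<in> \<A>" "W \<subseteq> U" and fr: "frame_on U c u (c ` W)"
      and sm\<kappa>: "smooth_on (coord ` W) (c \<circ> inv_into W coord)"
      by (auto simp: coord_domain_in_def)
    note ch = chart[OF Uc(1)] and ch' = chart[OF U'] and cd = coord_domainD[OF W]
    have op: "open (coord ` (W \<inter> U'))" by (rule coord_domain_open_image[OF W ch'(2)])
    have 1: "smooth_on (coord ` (W \<inter> U')) (c \<circ> inv_into W coord)"
      by (rule smooth_on_subset[OF sm\<kappa> op]) auto
    have 2: "(c \<circ> inv_into W coord) ` (coord ` (W \<inter> U')) \<subseteq> c ` (U \<inter> U')" using cd(6) Uc(2) by auto
    show "smooth_on (coord ` (W \<inter> U')) (c' \<circ> inv_into W coord)"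
      by (rule smooth_on_cong[OF smooth_on_compose[OF atlas_transition[OF smooth_atlas Uc(1) U'] 1 2]])
        (use ch(6) cd(6) Uc(2) in auto)
    have op': "open (c' ` (U' \<inter> W))" by (rule atlas_open_image[OF smooth_atlas U' cd(1)])
    have 3: "smooth_on (c' ` (U' \<inter> W)) (c \<circ> inv_into U' c')"
      by (rule smooth_on_subset[OF atlas_transition[OF smooth_atlas U' Uc(1)] op']) (use Uc(2) in auto)
    have 4: "(c \<circ> inv_into U' c') ` (c' ` (U' \<inter> W)) \<subseteq> c ` W" using ch'(6) by auto
    show "smooth_on (c' ` (U' \<inter> W)) (coord \<circ> inv_into U' c')"
      by (rule smooth_on_cong[OF smooth_on_compose[OF coord_in_chart(1)[OF fr] 3 4]])
        (use ch(6) ch'(6) Uc(2) in auto)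
  qed
  show ?thesis
    unfolding smooth_surface_def
  proof (rule atlasI)
    show "\<exists>U c. (U, c) \<in> \<A> \<union> coord_atlas \<and> p \<in> U" if "p \<in> M" for p
      using atlas_cover[OF smooth_atlas that] by blast
    show "openin (top_of_set M) U \<and> open (c ` U) \<and> homeomorphism U (c ` U) c (inv_into U c)"
      if "(U, c) \<in> \<A> \<union> coord_atlas" for U c
      using that
    proof
      assume "(U, c) \<in> \<A>"
      then show ?thesis using smooth_atlas unfolding atlas_def by blast
    qed (use coord_domainD(1,3,9) in \<open>auto simp: coord_atlas_def\<close>)
    show "smooth_on (c ` (U \<inter> V)) (d \<circ> inv_into U c)"
      if "(U, c) \<in> \<A> \<union> coord_atlas" "(V, d) \<in> \<A> \<union> coord_atlas" for U c V d
    proof -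
      have LL: "smooth_on (coord ` (W \<inter> W')) (coord \<circ> inv_into W coord)" if "coord_domain W" "coord_domain W'" for W W'
        by (rule conformal_on_smooth_on[OF coord_transition[OF that]])
      show ?thesis
        using that
        by (elim UnE) (auto simp: coord_atlas_def intro: atlas_transition[OF smooth_atlas] LA AL LL)
    qed
  qed
qed

lemma conformal_immersion_coord_atlas: "conformal_immersion coord_atlas F"
proof -
  have "smooth_on (coord ` W) (F \<circ> inv_into W coord)"
    and "x \<in> coord ` W \<Longrightarrow> inj (fderiv (F \<circ> inv_into W coord) x)"
    and "x \<in> coord ` W \<Longrightarrow> \<exists>\<mu>. \<mu> \<noteq> 0 \<and> (\<forall>X Y. pullback_metric (F \<circ> inv_into W coord) x X Y = \<mu> * lform X Y)"
    if W: "coord_domain W" for W x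
  proof -
    note S = weierstrass_surface[OF coord_domain_conformal[OF W, unfolded o_def],
        of "F \<circ> inv_into W coord", OF coord_domain_F_derivative(1)[OF W]]
    show "smooth_on (coord ` W) (F \<circ> inv_into W coord)" by (rule S(1))
    assume x: "x \<in> coord ` W"
    show "inj (fderiv (F \<circ> inv_into W coord) x)" by (rule S(3)[OF _ x coord_domain_F_derivative(2)[OF W x]])
    have "pullback_metric (F \<circ> inv_into W coord) x X Y = - weier_det (psi1 (inv_into W coord x)) (psi2 (inv_into W coord x))
          (phi1 (inv_into W coord x)) (phi2 (inv_into W coord x)) * lform X Y" for X Y
      by (rule S(2)[OF _ x])
    then show "\<exists>\<mu>. \<mu> \<noteq> 0 \<and> (\<forall>X Y. pullback_metric (F \<circ> inv_into W coord) x X Y = \<mu> * lform X Y)"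
      using coord_domain_F_derivative(2)[OF W x]
      by (intro exI[of _ "- weier_det (psi1 (inv_into W coord x)) (psi2 (inv_into W coord x))
          (phi1 (inv_into W coord x)) (phi2 (inv_into W coord x))"]) simp
  qed
  then show ?thesis
    unfolding conformal_immersion_def immersion_def coord_atlas_def by auto
qed

lemma weierstrass_formulas_coord:
  assumes p0: "p0 \<in> M"
  shows "weierstrass_formulas M coord p0 psi1 psi2 phi1 phi2 (\<lambda>p. F p - F p0)"
proof -
  let ?G0 = "\<lambda>p. weier0 (psi1 p) (psi2 p) (phi1 p) (phi2 p)" and ?G1 = "\<lambda>p. weier1 (psi1 p) (psi2 p) (phi1 p) (phi2 p)"
    and ?G2 = "\<lambda>p. weier2 (psi1 p) (psi2 p) (phi1 p) (phi2 p)" and ?G3 = "\<lambda>p. weier3 (psi1 p) (psi2 p) (phi1 p) (phi2 p)"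
  note G = conformal_on_weier[OF coord_domain_conformal[unfolded o_def]]
  have "\<exists>I0 I1 I2 I3. has_line_integral ?G0 coord \<Gamma> I0 \<and> has_line_integral ?G1 coord \<Gamma> I1 \<and>
      has_line_integral ?G2 coord \<Gamma> I2 \<and> has_line_integral ?G3 coord \<Gamma> I3 \<and>
      (F (pathfinish \<Gamma>) - F p0) $ 0 = lRe I0 \<and> (F (pathfinish \<Gamma>) - F p0) $ 1 = lRe I1 \<and>
      (F (pathfinish \<Gamma>) - F p0) $ 2 = lRe I2 \<and> (F (pathfinish \<Gamma>) - F p0) $ 3 = lIm I3"
    if \<Gamma>: "path \<Gamma>" "path_image \<Gamma> \<subseteq> M" "valid_path (coord \<circ> \<Gamma>)" "pathstart \<Gamma> = p0" for \<Gamma>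
  proof -
    have \<Gamma>M: "continuous_on {0..1} \<Gamma>" "\<Gamma> ` {0..1} \<subseteq> M" using \<Gamma>(1,2) by (auto simp: path_def path_image_def)
    have loc: "\<exists>W r d. coord_domain W \<and> r > 0 \<and> ball (coord (\<Gamma> t0)) r \<subseteq> coord ` W \<and> d > 0 \<and>
        (\<forall>t\<in>{0..1}. \<bar>t - t0\<bar> < d \<longrightarrow> \<Gamma> t \<in> W \<and> coord (\<Gamma> t) \<in> ball (coord (\<Gamma> t0)) r)" if t0: "t0 \<in> {0..1}" for t0
    proof -
      have "\<Gamma> t0 \<in> M" using \<Gamma>M(2) t0 by blast
      then obtain W where W: "coord_domain W" "\<Gamma> t0 \<in> W" using coord_domain_exists by blast
      note cd = coord_domainD[OF W(1)]
      obtain r where r: "r > 0" "ball (coord (\<Gamma> t0)) r \<subseteq> coord ` W"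
        using cd(3) W(2) open_contains_ball by (metis image_eqI)
      have "openin (top_of_set M) (W \<inter> coord -` ball (coord (\<Gamma> t0)) r)"
        using continuous_openin_preimage_gen[OF cd(4) open_ball] cd(1) openin_trans by blast
      then obtain T where T: "open T" "W \<inter> coord -` ball (coord (\<Gamma> t0)) r = M \<inter> T" by (auto simp: openin_open)
      have "\<forall>\<^sub>F q in near M (\<Gamma> t0). q \<in> W \<and> coord q \<in> ball (coord (\<Gamma> t0)) r"
        unfolding eventually_near using T W(2) r(1) by (intro exI[of _ T]) auto
      from eventually_near_compose[OF \<Gamma>M t0 this]
      have "\<forall>\<^sub>F t in nhds t0. t \<in> {0..1} \<longrightarrow> \<Gamma> t \<in> W \<and> coord (\<Gamma> t) \<in> ball (coord (\<Gamma> t0)) r"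
        unfolding eventually_inf_principal .
      then obtain d where "d > 0" "\<And>t. dist t t0 < d \<Longrightarrow> t \<in> {0..1} \<longrightarrow> \<Gamma> t \<in> W \<and> coord (\<Gamma> t) \<in> ball (coord (\<Gamma> t0)) r"
        unfolding eventually_nhds_metric by blast
      then show ?thesis using W(1) r by (intro exI[of _ W] exI[of _ r] exI[of _ d]) (auto simp: dist_real_def)
    qed
    have int: "\<exists>I. has_line_integral G coord \<Gamma> I"
      if conf: "\<And>W. coord_domain W \<Longrightarrow> conformal_on (coord ` W) (\<lambda>y. G (inv_into W coord y))" for G
    proof -
      have "(\<lambda>t. G (\<Gamma> t) * vector_derivative (coord \<circ> \<Gamma>) (at t within {0..1})) integrable_on {0..1}"
      proof (rule path_integral_exists[OF \<Gamma>(3)])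
        fix t0 :: real assume "t0 \<in> {0..1}"
        then obtain W r d where W: "coord_domain W" "r > 0" "ball (coord (\<Gamma> t0)) r \<subseteq> coord ` W" "d > 0"
          "\<And>t. t \<in> {0..1} \<Longrightarrow> \<bar>t - t0\<bar> < d \<Longrightarrow> \<Gamma> t \<in> W \<and> coord (\<Gamma> t) \<in> ball (coord (\<Gamma> t0)) r"
          using loc by metis
        obtain P where P: "\<And>y. y \<in> ball (coord (\<Gamma> t0)) r \<Longrightarrow>
            (P has_derivative (\<lambda>h. G (inv_into W coord y) * h)) (at y)"
          using conformal_primitive[OF conformal_on_subset[OF conf[OF W(1)] open_ball W(3)] convex_ball] by blast
        have "(P has_derivative (\<lambda>h. G (\<Gamma> t) * h)) (at ((coord \<circ> \<Gamma>) t))" if "t \<in> {0..1}" "\<bar>t - t0\<bar> < d" for t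
          using P[of "coord (\<Gamma> t)"] W(5)[OF that] coord_domainD(6)[OF W(1)] by simp
        then show "\<exists>d>0. \<exists>P. \<forall>t\<in>{0..1}. \<bar>t - t0\<bar> < d \<longrightarrow> (P has_derivative (\<lambda>h. G (\<Gamma> t) * h)) (at ((coord \<circ> \<Gamma>) t))"
          using W(4) by blast
      qed
      then show ?thesis unfolding has_line_integral_def by (auto simp: integrable_on_def)
    qed
    let ?v = "\<lambda>t. vector_derivative (coord \<circ> \<Gamma>) (at t within {0..1})"
    have whole: "((\<lambda>t. weier_vec (psi1 (\<Gamma> t)) (psi2 (\<Gamma> t)) (phi1 (\<Gamma> t)) (phi2 (\<Gamma> t)) (?v t)) has_integral F (\<Gamma> 1) - F (\<Gamma> 0)) {0..1}"
    proof (rule path_integral_local[OF \<Gamma>(3), where H="\<lambda>t. F (\<Gamma> t)"])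
      fix t0 :: real assume "t0 \<in> {0..1}"
      then obtain W r d where W: "coord_domain W" "d > 0"
        "\<And>t. t \<in> {0..1} \<Longrightarrow> \<bar>t - t0\<bar> < d \<Longrightarrow> \<Gamma> t \<in> W"
        using loc by metis
      have "((F \<circ> inv_into W coord) has_derivative weier_vec (psi1 (\<Gamma> t)) (psi2 (\<Gamma> t)) (phi1 (\<Gamma> t)) (phi2 (\<Gamma> t))) (at ((coord \<circ> \<Gamma>) t))
          \<and> F (\<Gamma> t) = (F \<circ> inv_into W coord) ((coord \<circ> \<Gamma>) t)"
        if "t \<in> {0..1}" "\<bar>t - t0\<bar> < d" for t
        using coord_domain_F_derivative(1)[OF W(1), of "coord (\<Gamma> t)"] W(3)[OF that] coord_domainD(6)[OF W(1)] by simp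
      then show "\<exists>d>0. \<exists>P. \<forall>t\<in>{0..1}. \<bar>t - t0\<bar> < d \<longrightarrow>
          (P has_derivative weier_vec (psi1 (\<Gamma> t)) (psi2 (\<Gamma> t)) (phi1 (\<Gamma> t)) (phi2 (\<Gamma> t))) (at ((coord \<circ> \<Gamma>) t)) \<and> F (\<Gamma> t) = P ((coord \<circ> \<Gamma>) t)"
        using W(2) by blast
    qed
    have val: "((\<lambda>t. weier_vec (psi1 (\<Gamma> t)) (psi2 (\<Gamma> t)) (phi1 (\<Gamma> t)) (phi2 (\<Gamma> t)) (?v t) $ i) has_integral (F (pathfinish \<Gamma>) - F p0) $ i) {0..1}" for i
      using has_integral_linear[OF whole bounded_linear_vec_nth[of i]] \<Gamma>(4) by (simp add: o_def pathfinish_def pathstart_def)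
    have re: "((\<lambda>t. L (G (\<Gamma> t) * ?v t)) has_integral L I) {0..1}" if "has_line_integral G coord \<Gamma> I" "bounded_linear L"
      for G I and L :: "lorentz \<Rightarrow> real"
      using has_integral_linear[OF that(1)[unfolded has_line_integral_def] that(2)] by (simp add: o_def)
    obtain I0 I1 I2 I3 where I: "has_line_integral ?G0 coord \<Gamma> I0" "has_line_integral ?G1 coord \<Gamma> I1"
      "has_line_integral ?G2 coord \<Gamma> I2" "has_line_integral ?G3 coord \<Gamma> I3"
      using int[OF G(1)] int[OF G(2)] int[OF G(3)] int[OF G(4)] by blast
    have "(F (pathfinish \<Gamma>) - F p0) $ 0 = lRe I0"
      by (rule has_integral_unique[OF val[of 0, unfolded weier_vec_nth] re[OF I(1) bounded_linear_lRe]])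
    moreover have "(F (pathfinish \<Gamma>) - F p0) $ 1 = lRe I1"
      by (rule has_integral_unique[OF val[of 1, unfolded weier_vec_nth] re[OF I(2) bounded_linear_lRe]])
    moreover have "(F (pathfinish \<Gamma>) - F p0) $ 2 = lRe I2"
      by (rule has_integral_unique[OF val[of 2, unfolded weier_vec_nth] re[OF I(3) bounded_linear_lRe]])
    moreover have "(F (pathfinish \<Gamma>) - F p0) $ 3 = lIm I3"
      by (rule has_integral_unique[OF val[of 3, unfolded weier_vec_nth] re[OF I(4) bounded_linear_lIm]])
    ultimately show ?thesis using I by blast
  qed
  then show ?thesis
    unfolding weierstrass_formulas_iff by blast
qed

end

theorem corollary1:
  shows
    "(\<forall>\<psi>1 \<psi>2 \<phi>1 \<phi>2 :: lorentz \<Rightarrow> lorentz. \<forall>a0.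
        conformal_on UNIV \<psi>1 \<and> conformal_on UNIV \<psi>2 \<and>
        conformal_on UNIV (\<lambda>a. lconj (\<phi>1 a)) \<and> conformal_on UNIV (\<lambda>a. lconj (\<phi>2 a)) \<longrightarrow>
        (\<exists>!F. weierstrass_formulas UNIV (\<lambda>a. a) a0 \<psi>1 \<psi>2 \<phi>1 \<phi>2 F) \<and>
        (\<forall>F \<Omega>. weierstrass_formulas UNIV (\<lambda>a. a) a0 \<psi>1 \<psi>2 \<phi>1 \<phi>2 F \<and>
               \<Omega> = {a. (\<psi>1 a * \<phi>2 a - \<psi>2 a * \<phi>1 a) * lconj (\<psi>1 a * \<phi>2 a - \<psi>2 a * \<phi>1 a) \<noteq> 0} \<longrightarrow>
               \<Omega> = {a. signature_1_1 (pullback_metric F a)} \<and>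
               lorentz_surface \<Omega> {(\<Omega>, \<lambda>a. a)} \<and>
               conformal_immersion {(\<Omega>, \<lambda>a. a)} F \<and>
               minimal {(\<Omega>, \<lambda>a. a)} F)) \<and>
     (\<forall>(M :: 'm::{t2_space, second_countable_topology} set) \<A> g F.
        lorentzian_surface M \<A> g \<and> simply_connected M \<and>
        isometric_immersion \<A> g F \<and> minimal \<A> F \<longrightarrow>
        (\<exists>\<L> a \<psi>1 \<psi>2 \<phi>1 \<phi>2.
           lorentz_surface M \<L> \<and> smooth_surface M (\<A> \<union> \<L>) \<and>
           (\<forall>(U, c)\<in>\<L>. c = a) \<and>
           conformal_immersion \<L> F \<and>
           conformal_map \<L> \<psi>1 \<and> conformal_map \<L> \<psi>2 \<and>
           conformal_map \<L> (\<lambda>p. lconj (\<phi>1 p)) \<and> conformal_map \<L> (\<lambda>p. lconj (\<phi>2 p)) \<and>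
           (\<forall>p0\<in>M. weierstrass_formulas M a p0 \<psi>1 \<psi>2 \<phi>1 \<phi>2 (\<lambda>p. F p - F p0))))"
proof (intro conjI allI impI)
  fix \<psi>1 \<psi>2 \<phi>1 \<phi>2 :: "lorentz \<Rightarrow> lorentz" and a0
  assume "conformal_on UNIV \<psi>1 \<and> conformal_on UNIV \<psi>2 \<and>
        conformal_on UNIV (\<lambda>a. lconj (\<phi>1 a)) \<and> conformal_on UNIV (\<lambda>a. lconj (\<phi>2 a))"
  then have conf: "conformal_on UNIV \<psi>1" "conformal_on UNIV \<psi>2"
    "conformal_on UNIV (\<lambda>a. lconj (\<phi>1 a))" "conformal_on UNIV (\<lambda>a. lconj (\<phi>2 a))" by auto
  show "\<exists>!F. weierstrass_formulas UNIV (\<lambda>a. a) a0 \<psi>1 \<psi>2 \<phi>1 \<phi>2 F"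
    using weierstrass_formulas_exist[OF conf, of a0] weierstrass_formulas_unique by blast
  fix F \<Omega>
  assume "weierstrass_formulas UNIV (\<lambda>a. a) a0 \<psi>1 \<psi>2 \<phi>1 \<phi>2 F \<and>
      \<Omega> = {a. (\<psi>1 a * \<phi>2 a - \<psi>2 a * \<phi>1 a) * lconj (\<psi>1 a * \<phi>2 a - \<psi>2 a * \<phi>1 a) \<noteq> 0}"
  then have F: "weierstrass_formulas UNIV (\<lambda>a. a) a0 \<psi>1 \<psi>2 \<phi>1 \<phi>2 F"
    and \<Omega>: "\<Omega> = {a. (\<psi>1 a * \<phi>2 a - \<psi>2 a * \<phi>1 a) * lconj (\<psi>1 a * \<phi>2 a - \<psi>2 a * \<phi>1 a) \<noteq> 0}" by blast+
  show "\<Omega> = {a. signature_1_1 (pullback_metric F a)}" "lorentz_surface \<Omega> {(\<Omega>, \<lambda>a. a)}"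
    "conformal_immersion {(\<Omega>, \<lambda>a. a)} F" "minimal {(\<Omega>, \<lambda>a. a)} F"
    by (rule weierstrass_conformal_minimal[OF conf F \<Omega>])+
next
  fix M :: "'m set" and \<A> g F
  assume *: "lorentzian_surface M \<A> g \<and> simply_connected M \<and> isometric_immersion \<A> g F \<and> minimal \<A> F"
  then interpret minimal_surface M \<A> g F by unfold_locales auto
  obtain u where "\<forall>p\<in>M. frame_at p u" using global_frame * by blast
  then interpret framed_surface M \<A> g F u by unfold_locales auto
  have "conformal_map coord_atlas psi1" "conformal_map coord_atlas psi2"
    "conformal_map coord_atlas (\<lambda>p. lconj (phi1 p))" "conformal_map coord_atlas (\<lambda>p. lconj (phi2 p))"
    using coord_domain_conformal unfolding conformal_map_def coord_atlas_def by auto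
  moreover have "\<forall>(U, c)\<in>coord_atlas. c = coord" by (auto simp: coord_atlas_def)
  ultimately show "\<exists>\<L> a \<psi>1 \<psi>2 \<phi>1 \<phi>2.
       lorentz_surface M \<L> \<and> smooth_surface M (\<A> \<union> \<L>) \<and> (\<forall>(U, c)\<in>\<L>. c = a) \<and> conformal_immersion \<L> F \<and>
       conformal_map \<L> \<psi>1 \<and> conformal_map \<L> \<psi>2 \<and>
       conformal_map \<L> (\<lambda>p. lconj (\<phi>1 p)) \<and> conformal_map \<L> (\<lambda>p. lconj (\<phi>2 p)) \<and>
       (\<forall>p0\<in>M. weierstrass_formulas M a p0 \<psi>1 \<psi>2 \<phi>1 \<phi>2 (\<lambda>p. F p - F p0))"
    using lorentz_surface_coord_atlas smooth_surface_coord_atlas conformal_immersion_coord_atlas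
      weierstrass_formulas_coord by blast
qed

end
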